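(* Let $d\ge1$ and fix $p\in\mathbb{N}$, $p\ge1$. Assume that for some $\Omega\in\mathbb{R}\setminus[-4d,0]$ there is a real $\mathcal{A}\in\ell^2(\mathbb{Z}^d)$ with $\Omega\mathcal{A}+\gamma_p|\mathcal{A}|^{2p}\mathcal{A}=\Delta\mathcal{A}$, such that $J_\Omega:=\Omega+(1+2p)\gamma_p|\mathcal{A}|^{2p}-\Delta$ has trivial null space in $\ell^2(\mathbb{Z}^d)$. For small $\epsilon>0$ let $\omega(\epsilon)$ and $U=U(\cdot,\epsilon)$ be the associated Klein--Gordon breather branch described in the context. Assume that $\Lambda\in i\mathbb{R}\setminus\{0\}$ is a simple isolated eigenvalue of the dNLS spectral problem $$\begin{pmatrix} 0 & -(\Omega-\Delta+\gamma_p\mathcal{A}^{2p}) \\ \Omega-\Delta+\gamma_p(1+2p)\mathcal{A}^{2p} & 0 \end{pmatrix} \begin{pmatrix} b_+ \\ b_- \end{pmatrix} = 2\Lambda \begin{pmatrix} b_+ \\ b_- \end{pmatrix}$$ with eigenvector $(b_+,b_-)\in\ell^2(\mathbb{Z}^d)\times\ell^2(\mathbb{Z}^d)$, and that $2\Lambda\notin\{i[\Omega,\Omega+4d]\}\cup\{-i[\Omega,\Omega+4d]\}$. Then there exist $\epsilon_0>0$ and $C_0>0$ such that for every $\epsilon\in(0,\epsilon_0)$ the spectral problem $$\left[1+(\lambda+im\omega(\epsilon))^2\right]B^{(m)}+\frac{\epsilon(1+2p)}{2\pi}\int_{-\pi}^{\pi}U^{2p}(\tau)W(\tau)e^{-im\tau}\,d\tau=\epsilon\Delta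 B^{(m)},\quad m\in\mathbb{Z},\qquad W(\tau)=\sum_{m\in\mathbb{Z}}B^{(m)}e^{im\tau},$$ admits a unique (up to scalar normalization of the eigenvector) analytic branch, in $\epsilon$, of eigenvalue--eigenvector pairs with purely imaginary $\lambda(\epsilon)\in i\mathbb{R}$ and $\{B^{(m)}(\epsilon)\}_{m\in\mathbb{Z}}\in\ell^{2,2}(\mathbb{Z};\ell^2(\mathbb{Z}^d))$ satisfying, for every $\epsilon\in(0,\epsilon_0)$, $$|\lambda(\epsilon)-\epsilon\Lambda|\le C_0\epsilon^2,$$ $$\|B^{(1)}-b_+-ib_-\|_{\ell^2(\mathbb{Z}^d)}+\|B^{(-1)}-b_++ib_-\|_{\ell^2(\mathbb{Z}^d)}\le C_0\epsilon,$$ $$\|B^{(0)}\|_{\ell^2(\mathbb{Z}^d)}+\sum_{|m|\ge2}\|B^{(m)}\|_{\ell^2(\mathbb{Z}^d)}\le C_0\epsilon .$$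
   Context: $\Delta$ is the discrete Laplacian, $(\Delta u)_n=\sum_{|k-n|=1}(u_k-u_n)$ on $\ell^2(\mathbb{Z}^d)$, with spectrum $[-4d,0]$; products and powers of sequences are componentwise; $\gamma_p=\frac{(2p+1)!}{p!(p+1)!}$. The space $\ell^{2,2}(\mathbb{Z};\ell^2(\mathbb{Z}^d))$ has norm $\big(\sum_{m\in\mathbb{Z}}(1+|m|^2)^2\|B^{(m)}\|^2_{\ell^2(\mathbb{Z}^d)}\big)^{1/2}$; the sequences $b_\pm$, $B^{(m)}$ are complex-valued. Breather branch: under the stated assumptions on $\mathcal{A}$, for all sufficiently small $\epsilon>0$ there is a unique analytic branch of solutions of $\omega^2U''+U+\epsilon U^{1+2p}=\epsilon\Delta U$ with $\omega(\epsilon)=\sqrt{1-\epsilon\Omega}$ and $U(\tau,\epsilon)=\sum_{m\in\mathbb{Z}}A^{(m)}(\epsilon)e^{im\tau}\in H^2_{\rm per}([-\pi,\pi];\ell^2(\mathbb{Z}^d))$, $A^{(m)}=A^{(-m)}$ real, such that $\|A^{(0)}\|_{\ell^2}+\|A^{(1)}-\mathcal{A}\|_{\ell^2}+\sum_{m\ge2}\|A^{(m)}\|_{\ell^2}\le C\epsilon$. The second spectral problem is the Fourier form of $\omega^2W''+2\lambda\omega W'+\lambda^2W+W+\epsilon(1+2p)U^{2p}W=\epsilon\Delta W$, obtained by substituting $w(t)=W(\omega t)e^{\lambda t}$ in the linearization of $\ddot u+u+\epsilon u^{1+2p}=\epsilon\Delta u$ at the breather $U$. The set $\{i[\Omega,\Omega+4d]\}\cup\{-i[\Omega,\Omega+4d]\}$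 is the continuous spectrum of the $2\times2$ matrix operator in the dNLS spectral problem. "Simple" means algebraic multiplicity one. *)

theory Defs
  imports "HOL-Analysis.Analysis"
begin

section \<open>Sequence spaces\<close>

text \<open>The lattice \<open>\<int>\<^sup>d\<close> is \<open>int ^ 'd\<close> with \<open>d = CARD('d)\<close>.\<close>

definition l2 :: "('n \<Rightarrow> 'v::real_normed_vector) set" where
  "l2 = {u. (\<lambda>n. (norm (u n))\<^sup>2) summable_on UNIV}"

definition l2_norm :: "('n \<Rightarrow> 'v::real_normed_vector) \<Rightarrow> real" where
  "l2_norm u = sqrt (\<Sum>\<^sub>\<infinity>n. (norm (u n))\<^sup>2)"

text \<open>\<open>l22\<close> is the weighted space of \<open>l2\<close>-valued sequences indexed by \<open>\<int>\<close>. By identifying a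
  periodic function with its Fourier coefficients it also plays the role of
  \<open>H\<^sup>2\<^sub>p\<^sub>e\<^sub>r([-\<pi>,\<pi>]; l2)\<close>.\<close>

definition l22 :: "(int \<Rightarrow> 'n \<Rightarrow> complex) set" where
  "l22 = {B. (\<forall>m. B m \<in> l2) \<and>
     (\<lambda>m. (1 + (real_of_int \<bar>m\<bar>)\<^sup>2)\<^sup>2 * (l2_norm (B m))\<^sup>2) summable_on UNIV}"

definition l22_norm :: "(int \<Rightarrow> 'n \<Rightarrow> complex) \<Rightarrow> real" where
  "l22_norm B = sqrt (\<Sum>\<^sub>\<infinity>m. (1 + (real_of_int \<bar>m\<bar>)\<^sup>2)\<^sup>2 * (l2_norm (B m))\<^sup>2)"

section \<open>Analytic dependence on a real parameter\<close>

definition analytic_scalar :: "(real \<Rightarrow> complex) \<Rightarrow> real set \<Rightarrow> bool" where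
  "analytic_scalar f S \<longleftrightarrow>
     (\<forall>s\<in>S. \<exists>r>0. \<exists>c :: nat \<Rightarrow> complex. \<forall>t\<in>S. \<bar>t - s\<bar> < r \<longrightarrow>
        (\<lambda>k. of_real ((t - s) ^ k) * c k) sums f t)"

text \<open>Analyticity as a map into the Banach space \<open>l22\<close>: locally a power series with coefficients
  in \<open>l22\<close> that converges in the norm of \<open>l22\<close>.\<close>

definition analytic_l22 :: "(real \<Rightarrow> int \<Rightarrow> 'n \<Rightarrow> complex) \<Rightarrow> real set \<Rightarrow> bool" where
  "analytic_l22 F S \<longleftrightarrow>
     (\<forall>s\<in>S. \<exists>r>0. \<exists>c :: nat \<Rightarrow> int \<Rightarrow> 'n \<Rightarrow> complex.
        (\<forall>k. c k \<in> l22) \<and>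
        (\<forall>t\<in>S. \<bar>t - s\<bar> < r \<longrightarrow> F t \<in> l22 \<and>
           (\<lambda>K. l22_norm (\<lambda>m n. F t m n - (\<Sum>k<K. of_real ((t - s) ^ k) * c k m n)))
             \<longlonglongrightarrow> 0))"

section \<open>The lattice equations\<close>

definition neighbours :: "int ^ 'd \<Rightarrow> (int ^ 'd) set" where
  "neighbours n = {k. (\<Sum>i\<in>UNIV. (k $ i - n $ i)\<^sup>2) = 1}"

text \<open>Finiteness ensures that the sum in the Laplacian below is a genuine one.\<close>

lemma finite_neighbours: "finite (neighbours n)"
proof -
  have "\<bar>k $ i - n $ i\<bar> \<le> 1" if "k \<in> neighbours n" for k i
  proof -
    have "(k $ i - n $ i)\<^sup>2 \<le> (\<Sum>i\<in>UNIV. (k $ i - n $ i)\<^sup>2)"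
      by (rule member_le_sum) auto
    then have "(k $ i - n $ i)\<^sup>2 \<le> 1"
      using that by (simp add: neighbours_def)
    then show ?thesis
      by (simp add: abs_square_le_1)
  qed
  then have "k $ i \<in> {n $ i - 1..n $ i + 1}" if "k \<in> neighbours n" for k i
    using that by (simp add: abs_le_iff) (smt (verit))
  then have "vec_nth ` neighbours n \<subseteq> (\<Pi>\<^sub>E i\<in>UNIV. {n $ i - 1..n $ i + 1})"
    unfolding PiE_UNIV_domain by (intro image_subsetI Pi_I)
  moreover have "finite (\<Pi>\<^sub>E i\<in>UNIV. {n $ i - 1..n $ i + 1})"
    by (rule finite_PiE) auto
  ultimately have "finite (vec_nth ` neighbours n)"
    by (rule finite_subset)
  then show ?thesis
    by (rule finite_imageD) (auto simp: inj_on_def vec_eq_iff)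
qed

definition laplacian :: "(int ^ 'd \<Rightarrow> 'v::ab_group_add) \<Rightarrow> int ^ 'd \<Rightarrow> 'v" where
  "laplacian u n = (\<Sum>k\<in>neighbours n. u k - u n)"

definition gam :: "nat \<Rightarrow> real" where
  "gam p = fact (2 * p + 1) / (fact p * fact (p + 1))"

definition stationary_dnls :: "nat \<Rightarrow> real \<Rightarrow> (int ^ 'd \<Rightarrow> real) \<Rightarrow> bool" where
  "stationary_dnls p \<Omega> \<A> \<longleftrightarrow> \<A> \<in> l2 \<and>
     (\<forall>n. \<Omega> * \<A> n + gam p * \<bar>\<A> n\<bar> ^ (2 * p) * \<A> n = laplacian \<A> n)"

definition J_op :: "nat \<Rightarrow> real \<Rightarrow> (int ^ 'd \<Rightarrow> real) \<Rightarrow> (int ^ 'd \<Rightarrow> complex) \<Rightarrow> int ^ 'd \<Rightarrow> complex"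
  where
  "J_op p \<Omega> \<A> v n =
     of_real \<Omega> * v n + of_real ((1 + 2 * real p) * gam p * \<bar>\<A> n\<bar> ^ (2 * p)) * v n - laplacian v n"

section \<open>The breather branch of the Klein--Gordon lattice\<close>

definition omega :: "real \<Rightarrow> real \<Rightarrow> real" where
  "omega \<Omega> \<epsilon> = sqrt (1 - \<epsilon> * \<Omega>)"

definition fourier_sum :: "(int \<Rightarrow> 'n \<Rightarrow> complex) \<Rightarrow> real \<Rightarrow> 'n \<Rightarrow> complex" where
  "fourier_sum F \<tau> n = (\<Sum>\<^sub>\<infinity>m. F m n * cis (real_of_int m * \<tau>))"

text \<open>Solutions in \<open>H\<^sup>2\<^sub>p\<^sub>e\<^sub>r\<close> are twice continuously differentiable in time because the equation
  expresses the second derivative through continuous functions; hence derivatives are classical.\<close>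

definition breather ::
  "nat \<Rightarrow> real \<Rightarrow> real \<Rightarrow> (int \<Rightarrow> int ^ 'd \<Rightarrow> complex) \<Rightarrow> bool" where
  "breather p \<Omega> \<epsilon> A \<longleftrightarrow>
     A \<in> l22 \<and> (\<forall>m n. A m n \<in> \<real>) \<and> (\<forall>m. A m = A (- m)) \<and>
     (\<exists>U' U''. \<forall>\<tau> n.
        ((\<lambda>t. fourier_sum A t n) has_vector_derivative U' \<tau> n) (at \<tau>) \<and>
        ((\<lambda>t. U' t n) has_vector_derivative U'' \<tau> n) (at \<tau>) \<and>
        of_real ((omega \<Omega> \<epsilon>)\<^sup>2) * U'' \<tau> n + fourier_sum A \<tau> n
          + of_real \<epsilon> * fourier_sum A \<tau> n ^ (1 + 2 * p)
        = of_real \<epsilon> * laplacian (fourier_sum A \<tau>) n)"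

definition breather_branch ::
  "nat \<Rightarrow> real \<Rightarrow> (int ^ 'd \<Rightarrow> real) \<Rightarrow> real \<Rightarrow> (real \<Rightarrow> int \<Rightarrow> int ^ 'd \<Rightarrow> complex) \<Rightarrow> bool" where
  "breather_branch p \<Omega> \<A> \<delta> A \<longleftrightarrow>
     analytic_l22 A {0<..<\<delta>} \<and>
     (\<forall>\<epsilon>\<in>{0<..<\<delta>}. breather p \<Omega> \<epsilon> (A \<epsilon>)) \<and>
     (\<exists>C. \<forall>\<epsilon>\<in>{0<..<\<delta>}.
        l2_norm (A \<epsilon> 0) + l2_norm (\<lambda>n. A \<epsilon> 1 n - of_real (\<A> n))
          + (\<Sum>\<^sub>\<infinity>m\<in>{2..}. l2_norm (A \<epsilon> m)) \<le> C * \<epsilon>)"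

section \<open>The dNLS spectral problem\<close>

type_synonym 'n cpair = "('n \<Rightarrow> complex) \<times> ('n \<Rightarrow> complex)"

definition dnls_op :: "nat \<Rightarrow> real \<Rightarrow> (int ^ 'd \<Rightarrow> real) \<Rightarrow> (int ^ 'd) cpair \<Rightarrow> (int ^ 'd) cpair" where
  "dnls_op p \<Omega> \<A> = (\<lambda>(u, v).
     (\<lambda>n. - (of_real \<Omega> * v n - laplacian v n + of_real (gam p * \<A> n ^ (2 * p)) * v n),
      \<lambda>n. of_real \<Omega> * u n - laplacian u n
            + of_real (gam p * (1 + 2 * real p) * \<A> n ^ (2 * p)) * u n))"

definition scale_pair :: "complex \<Rightarrow> 'n cpair \<Rightarrow> 'n cpair" where
  "scale_pair c = (\<lambda>(u, v). (\<lambda>n. c * u n, \<lambda>n. c * v n))"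

definition zero_pair :: "'n cpair" where
  "zero_pair = (\<lambda>n. 0, \<lambda>n. 0)"

definition shift_op :: "('n cpair \<Rightarrow> 'n cpair) \<Rightarrow> complex \<Rightarrow> 'n cpair \<Rightarrow> 'n cpair" where
  "shift_op T \<mu> x = (\<lambda>n. fst (T x) n - \<mu> * fst x n, \<lambda>n. snd (T x) n - \<mu> * snd x n)"

definition pair_norm :: "'n cpair \<Rightarrow> real" where
  "pair_norm = (\<lambda>(u, v). sqrt ((l2_norm u)\<^sup>2 + (l2_norm v)\<^sup>2))"

text \<open>Spectrum of an operator on \<open>l2 \<times> l2\<close>: complement of the set of \<open>\<mu>\<close> for which \<open>T - \<mu>\<close> is a
  bijection with bounded inverse.\<close>

definition pair_spectrum :: "('n cpair \<Rightarrow> 'n cpair) \<Rightarrow> complex set" where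
  "pair_spectrum T = - {\<mu>. bij_betw (shift_op T \<mu>) (l2 \<times> l2) (l2 \<times> l2) \<and>
     (\<exists>K. \<forall>x\<in>l2 \<times> l2. pair_norm x \<le> K * pair_norm (shift_op T \<mu> x))}"

definition eigenpair :: "('n cpair \<Rightarrow> 'n cpair) \<Rightarrow> complex \<Rightarrow> 'n cpair \<Rightarrow> bool" where
  "eigenpair T \<mu> x \<longleftrightarrow> x \<in> l2 \<times> l2 \<and> x \<noteq> zero_pair \<and> T x = scale_pair \<mu> x"

text \<open>Algebraic multiplicity one: the generalized eigenspace is one-dimensional.\<close>

definition simple_eigenvalue :: "('n cpair \<Rightarrow> 'n cpair) \<Rightarrow> complex \<Rightarrow> bool" where
  "simple_eigenvalue T \<mu> \<longleftrightarrow>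
     (\<exists>x. x \<noteq> zero_pair \<and>
        {y \<in> l2 \<times> l2. \<exists>k. (shift_op T \<mu> ^^ k) y = zero_pair} = range (\<lambda>c. scale_pair c x))"

definition continuous_spectrum_dnls :: "nat \<Rightarrow> real \<Rightarrow> complex set" where
  "continuous_spectrum_dnls d \<Omega> =
     (\<lambda>t. \<i> * of_real t) ` {\<Omega>..\<Omega> + 4 * real d} \<union> (\<lambda>t. - \<i> * of_real t) ` {\<Omega>..\<Omega> + 4 * real d}"

section \<open>The spectral problem at the breather\<close>

definition kg_spectral ::
  "nat \<Rightarrow> real \<Rightarrow> real \<Rightarrow> (int \<Rightarrow> int ^ 'd \<Rightarrow> complex) \<Rightarrow> complex
     \<Rightarrow> (int \<Rightarrow> int ^ 'd \<Rightarrow> complex) \<Rightarrow> bool" where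
  "kg_spectral p \<Omega> \<epsilon> A lam B \<longleftrightarrow>
     B \<in> l22 \<and> B \<noteq> (\<lambda>m n. 0) \<and>
     (\<forall>m n. (1 + (lam + \<i> * of_int m * of_real (omega \<Omega> \<epsilon>))\<^sup>2) * B m n
        + of_real (\<epsilon> * (1 + 2 * real p) / (2 * pi))
          * integral {- pi..pi} (\<lambda>\<tau>. fourier_sum A \<tau> n ^ (2 * p) * fourier_sum B \<tau> n
                                       * cis (- (real_of_int m * \<tau>)))
      = of_real \<epsilon> * laplacian (B m) n)"

definition kg_eigen_branch ::
  "nat \<Rightarrow> real \<Rightarrow> (real \<Rightarrow> int \<Rightarrow> int ^ 'd \<Rightarrow> complex) \<Rightarrow> complex
     \<Rightarrow> (int ^ 'd \<Rightarrow> complex) \<Rightarrow> (int ^ 'd \<Rightarrow> complex) \<Rightarrow> real \<Rightarrow> real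
     \<Rightarrow> (real \<Rightarrow> complex) \<Rightarrow> (real \<Rightarrow> int \<Rightarrow> int ^ 'd \<Rightarrow> complex) \<Rightarrow> bool" where
  "kg_eigen_branch p \<Omega> A \<Lambda> bp bm \<epsilon>\<^sub>0 C\<^sub>0 lam B \<longleftrightarrow>
     analytic_scalar lam {0<..<\<epsilon>\<^sub>0} \<and> analytic_l22 B {0<..<\<epsilon>\<^sub>0} \<and>
     (\<forall>\<epsilon>\<in>{0<..<\<epsilon>\<^sub>0}.
        kg_spectral p \<Omega> \<epsilon> (A \<epsilon>) (lam \<epsilon>) (B \<epsilon>) \<and>
        Re (lam \<epsilon>) = 0 \<and>
        cmod (lam \<epsilon> - of_real \<epsilon> * \<Lambda>) \<le> C\<^sub>0 * \<epsilon>\<^sup>2 \<and>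
        l2_norm (\<lambda>n. B \<epsilon> 1 n - bp n - \<i> * bm n)
          + l2_norm (\<lambda>n. B \<epsilon> (-1) n - bp n + \<i> * bm n) \<le> C\<^sub>0 * \<epsilon> \<and>
        l2_norm (B \<epsilon> 0) + (\<Sum>\<^sub>\<infinity>m\<in>{m. \<bar>m\<bar> \<ge> 2}. l2_norm (B \<epsilon> m)) \<le> C\<^sub>0 * \<epsilon>)"

end

theory Submission
  imports Defs "HOL-Complex_Analysis.Complex_Analysis"
begin

text \<open>Write \<open>\<lambda> = \<epsilon> \<mu>\<close>, divide the equations of the modes \<open>m = \<plusminus>1\<close> by \<open>\<epsilon>\<close> and those of the other modes
  by the dispersion factor \<open>1 + (\<lambda> + i m \<omega>)\<^sup>2\<close>, which stays away from zero. As \<open>\<epsilon> \<rightarrow> 0\<close> the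
  resulting operator on \<open>l2(\<int> \<times> \<int>\<^sup>d)\<close> converges in norm, and its limit at \<open>\<mu> = \<Lambda>\<close> is the
  dNLS operator shifted by \<open>2 \<Lambda>\<close> on the modes \<open>\<plusminus>1\<close> and the identity on the others, up to a
  triangular coupling. Off the continuous spectrum this limit is an invertible operator plus one of
  finite rank, so simplicity of the eigenvalue makes the linearisation in the pair of \<open>\<mu>\<close> and a
  normalised eigenvector invertible. A contraction then gives a unique
  eigenpair for small \<open>\<epsilon>\<close>. Its iterates are holomorphic in a complexified \<open>\<epsilon>\<close>, whence analyticity,
  and the symmetry \<open>\<mu> \<mapsto> - cnj \<mu>\<close> together with uniqueness forces \<open>\<mu>\<close> to be imaginary.\<close>

section \<open>The Hilbert space of square summable families\<close>

text \<open>The obstacle is that \<epsilon> = 0 is degenerate: at \<lambda> = 0 and \<omega> = 1 the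
  factor 1 + (i m)^2 vanishes for m = 1 and m = -1, so the kernel contains every \<open>l2\<close>
  profile in these two modes and the perturbation theory of isolated eigenvalues does not apply.
  Since \<omega>^2 = 1 - \<epsilon> \<Omega>, both factors are exactly divisible by \<epsilon>, and
  the quotient is what brings in the dNLS operator. The breather is analytic only on an open
  interval to the right of 0, so there is no expansion at \<epsilon> = 0 to start from. All
  estimates are therefore phrased through one small number \<sigma> proportional to \<epsilon>, and
  each s > 0 gets a complex disc of its own. The fixed point is sought in plain l2 over modes and
  sites, where multiplication by the breather is bounded because its Fourier coefficients are
  summable. The weight of \<open>l22\<close> is regained afterwards from the quadratic growth of the
  dispersion factor.\<close>

lemma L2_set_le_l2_norm:
  fixes u :: "'n \<Rightarrow> 'v::real_normed_vector"
  assumes "u \<in> l2"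
  shows "L2_set (\<lambda>i. norm (u i)) F \<le> l2_norm u"
proof (cases "finite F")
  case True
  have "(\<Sum>i\<in>F. (norm (u i))\<^sup>2) \<le> (\<Sum>\<^sub>\<infinity>n. (norm (u n))\<^sup>2)"
    using assms True unfolding l2_def by (intro finite_sum_le_infsum) auto
  then show ?thesis unfolding L2_set_def l2_norm_def by simp
next
  case False
  then show ?thesis by (simp add: l2_norm_def infsum_nonneg)
qed

lemma l2_norm_nonneg [simp]: "0 \<le> l2_norm u"
  by (simp add: l2_norm_def infsum_nonneg)

text \<open>Reduces \<open>l2\<close> estimates to finite index sets, where \<open>L2_set\<close>
  supplies the Minkowski and Cauchy-Schwarz inequalities.\<close>

lemma l2_boundI:
  fixes u :: "'n \<Rightarrow> 'v::real_normed_vector"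
  assumes "\<And>F. finite F \<Longrightarrow> L2_set (\<lambda>i. norm (u i)) F \<le> M"
  shows "u \<in> l2" and "l2_norm u \<le> M"
proof -
  have M: "0 \<le> M" using assms[of "{}"] by simp
  have *: "(\<Sum>i\<in>F. (norm (u i))\<^sup>2) \<le> M\<^sup>2" if "finite F" for F
  proof -
    have "sqrt (\<Sum>i\<in>F. (norm (u i))\<^sup>2) \<le> M" using assms[OF that] by (simp add: L2_set_def)
    then show ?thesis using sqrt_le_D by blast
  qed
  have s: "(\<lambda>n. (norm (u n))\<^sup>2) summable_on UNIV"
    by (rule nonneg_bounded_partial_sums_imp_summable_on[where C = "M\<^sup>2"])
       (auto intro!: eventually_finite_subsets_at_top_weakI *)
  then show "u \<in> l2" by (simp add: l2_def)
  have "(\<Sum>\<^sub>\<infinity>n. (norm (u n))\<^sup>2) \<le> M\<^sup>2"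
    by (rule infsum_le_finite_sums[OF s]) (auto intro: *)
  then show "l2_norm u \<le> M"
    unfolding l2_norm_def using M by (metis real_le_lsqrt)
qed

lemma norm_le_l2_norm: "u \<in> l2 \<Longrightarrow> norm (u i) \<le> l2_norm u"
  using L2_set_le_l2_norm[of u "{i}"] by (simp add: L2_set_def)

text \<open>One bound serves multiplication by bounded weights, shifts of modes and sites,
  restriction to a mode and conjugation. Injectivity of the index map ensures that no coordinate of
  \<open>u\<close> is counted twice.\<close>

lemma l2_scaled_bound:
  fixes u :: "'n \<Rightarrow> 'v::real_normed_vector" and w :: "'m \<Rightarrow> 'w::real_normed_vector"
  assumes "u \<in> l2" "inj \<pi>" "0 \<le> c" "\<And>i. norm (w i) \<le> c * norm (u (\<pi> i))"
  shows "w \<in> l2" and "l2_norm w \<le> c * l2_norm u"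
proof -
  have "L2_set (\<lambda>i. norm (w i)) F \<le> c * l2_norm u" for F
  proof -
    have "L2_set (\<lambda>i. norm (w i)) F \<le> L2_set (\<lambda>i. c * norm (u (\<pi> i))) F"
      by (intro L2_set_mono assms) auto
    also have "\<dots> = c * L2_set (\<lambda>i. norm (u (\<pi> i))) F"
      using assms(3) by (simp add: L2_set_right_distrib)
    also have "L2_set (\<lambda>i. norm (u (\<pi> i))) F = L2_set (\<lambda>i. norm (u i)) (\<pi> ` F)"
      unfolding L2_set_def using assms(2) by (subst sum.reindex) (auto simp: inj_on_def)
    also have "c * \<dots> \<le> c * l2_norm u"
      using assms by (intro mult_left_mono L2_set_le_l2_norm) auto
    finally show ?thesis .
  qed
  then show "w \<in> l2" and "l2_norm w \<le> c * l2_norm u"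
    using l2_boundI[of w "c * l2_norm u"] by auto
qed

lemma l2_add:
  fixes u v :: "'n \<Rightarrow> 'v::real_normed_vector"
  assumes "u \<in> l2" "v \<in> l2"
  shows "(\<lambda>i. u i + v i) \<in> l2" and "l2_norm (\<lambda>i. u i + v i) \<le> l2_norm u + l2_norm v"
proof -
  have "L2_set (\<lambda>i. norm (u i + v i)) F \<le> l2_norm u + l2_norm v" for F
  proof -
    have "L2_set (\<lambda>i. norm (u i + v i)) F \<le> L2_set (\<lambda>i. norm (u i) + norm (v i)) F"
      by (intro L2_set_mono norm_triangle_ineq) auto
    also have "\<dots> \<le> L2_set (\<lambda>i. norm (u i)) F + L2_set (\<lambda>i. norm (v i)) F"
      by (rule L2_set_triangle_ineq)
    also have "\<dots> \<le> l2_norm u + l2_norm v"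
      using assms by (intro add_mono L2_set_le_l2_norm)
    finally show ?thesis .
  qed
  then show "(\<lambda>i. u i + v i) \<in> l2" and "l2_norm (\<lambda>i. u i + v i) \<le> l2_norm u + l2_norm v"
    using l2_boundI[of "\<lambda>i. u i + v i" "l2_norm u + l2_norm v"] by auto
qed

lemma l2_zero: "(\<lambda>i. 0) \<in> l2"
  by (simp add: l2_def)

lemma l2_cmult:
  fixes c :: "'v::real_normed_div_algebra"
  assumes "u \<in> l2"
  shows "(\<lambda>i. c * u i) \<in> l2" and "l2_norm (\<lambda>i. c * u i) = norm c * l2_norm u"
proof -
  show *: "(\<lambda>i. c * u i) \<in> l2"
    using l2_scaled_bound(1)[OF assms inj_on_id, of "norm c" "\<lambda>i. c * u i"] by (simp add: norm_mult)
  have a: "l2_norm (\<lambda>i. c * u i) \<le> norm c * l2_norm u"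
    using l2_scaled_bound(2)[OF assms inj_on_id, of "norm c" "\<lambda>i. c * u i"] by (simp add: norm_mult)
  show "l2_norm (\<lambda>i. c * u i) = norm c * l2_norm u"
  proof (cases "c = 0")
    case False
    \<comment> \<open>Equality follows by applying the same bound to the inverse scaling.\<close>
    have "l2_norm u \<le> inverse (norm c) * l2_norm (\<lambda>i. c * u i)"
      using l2_scaled_bound(2)[OF * inj_on_id, of "inverse (norm c)" u] False
      by (simp add: norm_mult flip: mult.assoc)
    then show ?thesis using a False by (simp add: field_simps)
  qed (use a in \<open>simp add: l2_norm_def\<close>)
qed

text \<open>The square summable families become a type so that \<open>sums\<close>,
  \<open>bounded_linear\<close> and Banach's fixed point theorem, all tied to type classes, apply to
  them.\<close>

typedef 'i ell2 = "l2 :: ('i \<Rightarrow> complex) set"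
  morphisms coord Ell2
  using l2_zero by blast

lemma coord_l2 [simp]: "coord x \<in> l2"
  using coord by blast

lemma ell2_eqI: "(\<And>i. coord x i = coord y i) \<Longrightarrow> x = y"
  by (metis coord_inject ext)

instantiation ell2 :: (type) real_vector
begin
definition "0 = Ell2 (\<lambda>i. 0)"
definition "x + y = Ell2 (\<lambda>i. coord x i + coord y i)"
definition "x - y = Ell2 (\<lambda>i. coord x i + (-1) * coord y i)"
definition "- x = Ell2 (\<lambda>i. (-1) * coord x i)"
definition "scaleR r x = Ell2 (\<lambda>i. of_real r * coord x i)"

lemma coord_zero [simp]: "coord 0 i = 0"
  by (simp add: zero_ell2_def Ell2_inverse l2_zero)

lemma coord_add [simp]: "coord (x + y) i = coord x i + coord y i"
  by (simp add: plus_ell2_def Ell2_inverse l2_add)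

lemma coord_diff [simp]: "coord (x - y) i = coord x i - coord y i"
  using l2_add(1)[OF coord_l2[of x] l2_cmult(1)[OF coord_l2[of y], of "-1"]]
  unfolding minus_ell2_def by (simp add: Ell2_inverse)

lemma coord_uminus [simp]: "coord (- x) i = - coord x i"
  using l2_cmult(1)[OF coord_l2[of x], of "-1"]
  unfolding uminus_ell2_def by (simp add: Ell2_inverse)

lemma coord_scaleR [simp]: "coord (r *\<^sub>R x) i = of_real r * coord x i"
  unfolding scaleR_ell2_def by (subst Ell2_inverse) (auto intro!: l2_cmult)

instance
  by standard (auto intro!: ell2_eqI simp: algebra_simps)
end

instantiation ell2 :: (type) real_normed_vector
begin
definition "norm x = l2_norm (coord x)"
definition "dist x y = norm (x - y :: 'a ell2)"
definition "sgn x = x /\<^sub>R norm (x :: 'a ell2)"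
definition [code del]: "uniformity = (INF e\<in>{0<..}. principal {(x :: 'a ell2, y). dist x y < e})"
definition [code del]: "open (U :: 'a ell2 set) \<longleftrightarrow> (\<forall>x\<in>U. \<forall>\<^sub>F (x', y) in uniformity. x' = x \<longrightarrow> y \<in> U)"

instance
proof
  fix x y :: "'a ell2" and r :: real
  show "(norm x = 0) = (x = 0)"
  proof
    assume "norm x = 0"
    then have "cmod (coord x i) \<le> 0" for i
      using norm_le_l2_norm[of "coord x" i] by (simp add: norm_ell2_def)
    then show "x = 0" by (intro ell2_eqI) simp
  next
    assume "x = 0"
    then show "norm x = 0" by (simp add: norm_ell2_def l2_norm_def)
  qed
  show "norm (x + y) \<le> norm x + norm y"
    using l2_add(2)[of "coord x" "coord y"] by (simp add: norm_ell2_def coord_add[abs_def])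
  show "norm (r *\<^sub>R x) = \<bar>r\<bar> * norm x"
    using l2_cmult(2)[of "coord x" "of_real r"] by (simp add: norm_ell2_def coord_scaleR[abs_def])
qed (simp_all add: dist_ell2_def sgn_ell2_def uniformity_ell2_def open_ell2_def)
end

lemma norm_coord_le: "cmod (coord x i) \<le> norm x"
  using norm_le_l2_norm[of "coord x" i] by (simp add: norm_ell2_def)

lemma ell2_norm_boundI:
  "(\<And>F. finite F \<Longrightarrow> L2_set (\<lambda>i. cmod (coord x i)) F \<le> M) \<Longrightarrow> norm x \<le> M"
  unfolding norm_ell2_def by (rule l2_boundI(2))

lemma L2_set_coord_le: "L2_set (\<lambda>i. cmod (coord x i)) F \<le> norm x"
  unfolding norm_ell2_def by (rule L2_set_le_l2_norm) simp

lemma bounded_linear_coord: "bounded_linear (\<lambda>x. coord x i)"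
  by (rule bounded_linear_intro[where K = 1])
     (auto simp: norm_coord_le scaleR_conv_of_real)

lemma coord_sum: "coord (\<Sum>k\<in>S. f k) i = (\<Sum>k\<in>S. coord (f k) i)"
  by (induction S rule: infinite_finite_induct) auto

instance ell2 :: (type) banach
proof
  fix X :: "nat \<Rightarrow> 'a ell2"
  assume X: "Cauchy X"
  have "Cauchy (\<lambda>n. coord (X n) i)" for i
    by (rule bounded_linear.Cauchy[OF bounded_linear_coord X])
  then have "\<exists>l. (\<lambda>n. coord (X n) i) \<longlonglongrightarrow> l" for i
    using Cauchy_convergent convergent_def by blast
  then obtain u where u: "\<And>i. (\<lambda>n. coord (X n) i) \<longlonglongrightarrow> u i" by metis
  \<comment> \<open>The Cauchy estimate on a finite section, with the second index sent to infinity.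
    It yields both membership of the limit in \<open>l2\<close> and convergence in norm.\<close>
  have key: "L2_set (\<lambda>i. cmod (coord (X m) i - u i)) F \<le> e"
    if "finite F" "\<And>n. n \<ge> N \<Longrightarrow> norm (X m - X n) \<le> e" for m e N F
  proof (rule tendsto_upperbound)
    show "(\<lambda>n. L2_set (\<lambda>i. cmod (coord (X m) i - coord (X n) i)) F) \<longlonglongrightarrow>
           L2_set (\<lambda>i. cmod (coord (X m) i - u i)) F"
      unfolding L2_set_def by (intro tendsto_intros u)
    show "\<forall>\<^sub>F n in sequentially. L2_set (\<lambda>i. cmod (coord (X m) i - coord (X n) i)) F \<le> e"
      using eventually_ge_at_top[of N]
    proof eventually_elim
      case (elim n)
      then show ?case using L2_set_coord_le[of "X m - X n" F] that(2)[of n] by simp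
    qed
  qed simp
  obtain N1 where N1: "\<And>m n. m \<ge> N1 \<Longrightarrow> n \<ge> N1 \<Longrightarrow> norm (X m - X n) < 1"
    using X unfolding Cauchy_def dist_norm by (meson zero_less_one)
  have "(\<lambda>i. coord (X N1) i - u i) \<in> l2"
    using l2_boundI(1)[of "\<lambda>i. coord (X N1) i - u i" 1] key[of _ N1 N1 1] N1
    by (metis less_eq_real_def order_refl)
  then have "(\<lambda>i. coord (X N1) i + (-1) * (coord (X N1) i - u i)) \<in> l2"
    by (intro l2_add l2_cmult) auto
  then have ul2: "u \<in> l2" by simp
  have "X \<longlonglongrightarrow> Ell2 u"
  proof (rule metric_LIMSEQ_I)
    fix r :: real assume "r > 0"
    then have "r / 2 > 0" by simp
    then obtain N where N: "\<And>m n. m \<ge> N \<Longrightarrow> n \<ge> N \<Longrightarrow> norm (X m - X n) < r / 2"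
      using X unfolding Cauchy_def dist_norm by meson
    have "norm (X m - Ell2 u) \<le> r / 2" if "m \<ge> N" for m
      using key[of _ N m "r/2"] N that
      by (intro ell2_norm_boundI) (simp add: Ell2_inverse ul2 less_imp_le)
    then show "\<exists>no. \<forall>n\<ge>no. dist (X n) (Ell2 u) < r"
      unfolding dist_norm using \<open>r > 0\<close> by (intro exI[of _ N]) (metis field_sum_of_halves less_add_same_cancel1 order_le_less_trans half_gt_zero)
  qed
  then show "convergent X" by (rule convergentI)
qed

text \<open>The class instance has real scalars only. Complex homogeneity, on which holomorphy and
  the scaling of eigenvectors depend, is carried by this separate operation.\<close>

definition cscale :: "complex \<Rightarrow> 'i ell2 \<Rightarrow> 'i ell2" (infixr "*c" 75) where
  "c *c x = Ell2 (\<lambda>i. c * coord x i)"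

lemma coord_cscale [simp]: "coord (c *c x) i = c * coord x i"
  by (simp add: cscale_def Ell2_inverse l2_cmult)

lemma norm_cscale [simp]: "norm (c *c x) = cmod c * norm x"
  using l2_cmult(2)[of "coord x" c] by (simp add: norm_ell2_def coord_cscale[abs_def])

text \<open>Weighted composition operator: the common form of multiplication by a symbol in the
  mode, mode shifts and lattice translations.\<close>

definition wcomp :: "('i \<Rightarrow> complex) \<Rightarrow> ('i \<Rightarrow> 'j) \<Rightarrow> 'j ell2 \<Rightarrow> 'i ell2" where
  "wcomp a \<pi> x = Ell2 (\<lambda>i. a i * coord x (\<pi> i))"

lemma wcomp:
  assumes "inj \<pi>" "\<And>i. cmod (a i) \<le> c"
  shows "coord (wcomp a \<pi> x) i = a i * coord x (\<pi> i)" and "norm (wcomp a \<pi> x) \<le> c * norm x"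
proof -
  have "0 \<le> c" using assms(2) norm_ge_zero order_trans by blast
  then have "(\<lambda>i. a i * coord x (\<pi> i)) \<in> l2 \<and> l2_norm (\<lambda>i. a i * coord x (\<pi> i)) \<le> c * l2_norm (coord x)"
    by (intro conjI l2_scaled_bound[OF _ assms(1)])
       (auto simp: norm_mult intro!: mult_right_mono assms)
  then show "coord (wcomp a \<pi> x) i = a i * coord x (\<pi> i)" and "norm (wcomp a \<pi> x) \<le> c * norm x"
    by (auto simp: wcomp_def norm_ell2_def Ell2_inverse)
qed

definition unit_vec :: "'i \<Rightarrow> 'i ell2" where
  "unit_vec j = Ell2 (\<lambda>i. if i = j then 1 else 0)"

lemma coord_unit_vec [simp]: "coord (unit_vec j) i = (if i = j then 1 else 0)"
proof -
  have "(\<lambda>i. if i = j then 1 else 0 :: complex) \<in> l2"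
  proof (rule l2_boundI)
    fix F :: "'a set" assume F: "finite F"
    have "L2_set (\<lambda>i. cmod (if i = j then 1 else 0)) F \<le> (\<Sum>i\<in>F. cmod (if i = j then 1 else 0))"
      by (rule L2_set_le_sum) auto
    also have "\<dots> \<le> 1" using F by (simp add: if_distrib[of cmod] cong: if_cong)
    finally show "L2_set (\<lambda>i. cmod (if i = j then 1 else 0)) F \<le> 1" .
  qed
  then show ?thesis by (simp add: unit_vec_def Ell2_inverse)
qed

lemma norm_unit_vec_le:
  fixes j :: 'i
  shows "norm (unit_vec j) \<le> 1"
proof (rule ell2_norm_boundI)
  fix F :: "'i set" assume F: "finite F"
  have "L2_set (\<lambda>i. cmod (coord (unit_vec j) i)) F \<le> (\<Sum>i\<in>F. cmod (coord (unit_vec j) i))"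
    by (rule L2_set_le_sum) simp
  also have "\<dots> \<le> 1" using F by (simp add: if_distrib[of cmod] cong: if_cong)
  finally show "L2_set (\<lambda>i. cmod (coord (unit_vec j) i)) F \<le> 1" .
qed

section \<open>Bounded complex-linear operators\<close>

definition bclin :: "('i ell2 \<Rightarrow> 'j ell2) \<Rightarrow> bool" where
  "bclin f \<longleftrightarrow> bounded_linear f \<and> (\<forall>c x. f (c *c x) = c *c f x)"

lemma bclinI:
  assumes "\<And>x y. f (x + y) = f x + f y" "\<And>c x. f (c *c x) = c *c f x" "\<And>x. norm (f x) \<le> K * norm x"
  shows "bclin f"
proof -
  have *: "r *\<^sub>R x = of_real r *c x" for r and x :: "'x ell2" by (rule ell2_eqI) simp
  have "f (r *\<^sub>R x) = r *\<^sub>R f x" for r x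
    unfolding * by (rule assms)
  then show ?thesis unfolding bclin_def using assms
    by (auto intro!: bounded_linear_intro[where K = K] simp: mult.commute)
qed

lemma bclinD: "bclin f \<Longrightarrow> bounded_linear f" and bclin_cscale: "bclin f \<Longrightarrow> f (c *c x) = c *c f x"
  by (auto simp: bclin_def)

lemma bclin_compose: "bclin f \<Longrightarrow> bclin g \<Longrightarrow> bclin (\<lambda>x. f (g x))"
  unfolding bclin_def by (auto intro: bounded_linear_compose)

lemma bclin_add: "bclin f \<Longrightarrow> bclin g \<Longrightarrow> bclin (\<lambda>x. f x + g x)"
  unfolding bclin_def by (auto intro!: bounded_linear_add ell2_eqI simp: algebra_simps)

lemma bclin_sub: "bclin f \<Longrightarrow> bclin g \<Longrightarrow> bclin (\<lambda>x. f x - g x)"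
  unfolding bclin_def by (auto intro!: bounded_linear_sub ell2_eqI simp: algebra_simps)

lemma bclin_ident: "bclin (\<lambda>x. x)"
  unfolding bclin_def by auto

lemma bclin_cscale_const: "bclin (\<lambda>x. c *c x)"
  by (rule bclinI[where K = "cmod c"]) (auto intro!: ell2_eqI simp: algebra_simps)

lemma bclin_coord: "bclin (\<lambda>x. coord x i *c w)"
proof (rule bclinI[where K = "norm w"])
  show "norm (coord x i *c w) \<le> norm w * norm x" for x
    using mult_right_mono[OF norm_coord_le[of x i], of "norm w"] by (simp add: mult.commute)
qed (auto intro!: ell2_eqI simp: algebra_simps)

lemma bclin_wcomp:
  assumes "inj \<pi>" "\<And>i. cmod (a i) \<le> c"
  shows "bclin (wcomp a \<pi>)"
  by (rule bclinI[where K = c]) (auto intro!: ell2_eqI simp: wcomp[OF assms] algebra_simps)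

lemma bclin_sum: "(\<And>k. k \<in> S \<Longrightarrow> bclin (f k)) \<Longrightarrow> bclin (\<lambda>x. \<Sum>k\<in>S. f k x)"
proof (induction S rule: infinite_finite_induct)
  case (insert k S)
  then show ?case by (simp add: bclin_add)
qed (auto intro!: bclinI[where K = 0] ell2_eqI)

lemma bclin_funpow:
  fixes f :: "'i ell2 \<Rightarrow> 'i ell2"
  assumes "bclin f"
  shows "bclin (f ^^ k)"
proof (induction k)
  case 0
  have "f ^^ 0 = (\<lambda>x. x)" by auto
  then show ?case using bclin_ident by metis
next
  case (Suc k)
  have "f ^^ Suc k = (\<lambda>x. f ((f ^^ k) x))" by auto
  then show ?case using bclin_compose[OF assms Suc] by metis
qed

section \<open>Invertible operators and the Fredholm alternative\<close>

definition bcinv :: "('i ell2 \<Rightarrow> 'i ell2) \<Rightarrow> bool" where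
  "bcinv f \<longleftrightarrow> (\<exists>g. bclin g \<and> (\<forall>x. f (g x) = x) \<and> (\<forall>x. g (f x) = x))"

text \<open>The lower bound serves twice: it gives injectivity, and it bounds the inverse.\<close>

lemma bcinvI:
  assumes f: "bclin f" and surj: "\<And>y. \<exists>x. f x = y" and low: "\<And>x. norm x \<le> K * norm (f x)"
  shows "bcinv f"
proof -
  interpret f: bounded_linear f using f by (rule bclinD)
  have inj: "x = y" if "f x = f y" for x y
  proof -
    have "norm (x - y) \<le> K * norm (f (x - y))" by (rule low)
    then show ?thesis using that by (simp add: f.diff)
  qed
  define g where "g = (\<lambda>y. SOME x. f x = y)"
  have fg: "f (g y) = y" for y unfolding g_def using surj[of y] by (rule someI_ex)
  have gf: "g (f x) = x" for x by (rule inj) (rule fg)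
  have "bclin g"
  proof (rule bclinI[where K = K])
    show "g (x + y) = g x + g y" for x y by (rule inj) (simp add: fg f.add)
    show "g (c *c x) = c *c g x" for c x by (rule inj) (simp add: fg bclin_cscale[OF f])
    show "norm (g x) \<le> K * norm x" for x using low[of "g x"] by (simp add: fg)
  qed
  then show ?thesis unfolding bcinv_def using fg gf by blast
qed

lemma bcinv_compose:
  assumes "bcinv f" "bcinv g"
  shows "bcinv (\<lambda>x. f (g x))"
proof -
  obtain f' where f': "bclin f'" "\<And>x. f (f' x) = x" "\<And>x. f' (f x) = x"
    using assms(1) by (auto simp: bcinv_def)
  obtain g' where g': "bclin g'" "\<And>x. g (g' x) = x" "\<And>x. g' (g x) = x"
    using assms(2) by (auto simp: bcinv_def)
  show ?thesis unfolding bcinv_def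
    by (rule exI[of _ "\<lambda>x. g' (f' x)"]) (simp add: bclin_compose f' g')
qed

lemma bcinv_neumann:
  assumes R: "bclin R" "\<And>x. norm (R x) \<le> q * norm x" and q: "0 \<le> q" "q < 1"
  shows "bcinv (\<lambda>x. x - R x)"
proof (rule bcinvI)
  interpret R: bounded_linear R using R(1) by (rule bclinD)
  show "bclin (\<lambda>x. x - R x)" by (intro bclin_sub bclin_ident R)
  show "\<exists>x. x - R x = y" for y
  proof -
    \<comment> \<open>Banach's fixed point theorem for the map sending x to y + R x takes the place
      of summing the Neumann series.\<close>
    have "\<exists>!x. y + R x = x"
      by (rule banach_fix_type[OF q]) (use R(2) in \<open>simp add: dist_norm flip: R.diff\<close>)
    then show ?thesis by (metis add_diff_cancel_right')
  qed
  show "norm x \<le> (1 / (1 - q)) * norm (x - R x)" for x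
  proof -
    have "norm x \<le> norm (x - R x) + norm (R x)"
      using norm_triangle_ineq[of "x - R x" "R x"] by simp
    then have "norm x \<le> norm (x - R x) + q * norm x" using R(2)[of x] by linarith
    then show ?thesis using q by (simp add: field_simps)
  qed
qed

text \<open>The functionals are coordinates of \<open>bclin\<close> operators, so they inherit
  boundedness and complex linearity without a dual space. The inductive form turns facts about
  finite rank into inductions on the number of summands.\<close>

inductive finite_rank :: "('i ell2 \<Rightarrow> 'i ell2) \<Rightarrow> bool" where
  zero: "finite_rank (\<lambda>x. 0)"
| add_rank1: "finite_rank K \<Longrightarrow> bclin (f :: 'i ell2 \<Rightarrow> 'i ell2) \<Longrightarrow> finite_rank (\<lambda>x. K x + coord (f x) i *c w)"

lemma bclin_finite_rank: "finite_rank K \<Longrightarrow> bclin K"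
proof (induction rule: finite_rank.induct)
  case zero
  show ?case by (rule bclinI[where K = 0]) (auto intro: ell2_eqI)
next
  case (add_rank1 K f i w)
  then show ?case by (intro bclin_add bclin_compose[OF bclin_coord])
qed

lemma finite_rank_single: "bclin (f :: 'i ell2 \<Rightarrow> 'i ell2) \<Longrightarrow> finite_rank (\<lambda>x. coord (f x) i *c w)"
  using finite_rank.add_rank1[OF finite_rank.zero] by simp

lemma finite_rank_add: "finite_rank K \<Longrightarrow> finite_rank L \<Longrightarrow> finite_rank (\<lambda>x. L x + K x)"
proof (induction rule: finite_rank.induct)
  case (add_rank1 K f i w)
  then show ?case using finite_rank.add_rank1[of "\<lambda>x. L x + K x" f i w] by (simp add: add.assoc)
qed simp

lemma finite_rank_sum:
  "(\<And>k. k \<in> S \<Longrightarrow> finite_rank (f k)) \<Longrightarrow> finite_rank (\<lambda>x. \<Sum>k\<in>S. f k x)"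
proof (induction S rule: infinite_finite_induct)
  case (insert k S)
  then show ?case by (simp add: finite_rank_add)
qed (auto intro: finite_rank.zero)

lemma finite_rank_post:
  assumes g: "bclin g" and K: "finite_rank K"
  shows "finite_rank (\<lambda>x. g (K x))"
  using K
proof (induction rule: finite_rank.induct)
  interpret g: bounded_linear g using g by (rule bclinD)
  case zero
  show ?case using finite_rank.zero by (simp add: g.zero)
next
  interpret g: bounded_linear g using g by (rule bclinD)
  case (add_rank1 K f i w)
  then show ?case
    using finite_rank.add_rank1[of "\<lambda>x. g (K x)" f i "g w"] by (simp add: g.add bclin_cscale[OF g])
qed

lemma finite_rank_range:
  "finite_rank K \<Longrightarrow> \<exists>T. finite T \<and> (\<forall>x. K x \<in> span T)"
proof (induction rule: finite_rank.induct)
  case zero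
  show ?case by (rule exI[of _ "{}"]) (simp add: span_zero)
next
  case (add_rank1 K f i w)
  then obtain T where T: "finite T" "\<And>x. K x \<in> span T" by blast
  \<comment> \<open>\<open>span\<close> is over the reals, so a complex line is spanned by
    \<open>w\<close> together with i times \<open>w\<close>.\<close>
  have cw: "c *c w = Re c *\<^sub>R w + Im c *\<^sub>R (\<i> *c w)" for c
    by (rule ell2_eqI) (simp add: algebra_simps complex_eq_iff)
  have "c *c w \<in> span (insert w (insert (\<i> *c w) T))" for c
    by (subst cw, intro span_add span_scale span_base) auto
  moreover have "K x \<in> span (insert w (insert (\<i> *c w) T))" for x
    using T(2)[of x] span_mono[of T "insert w (insert (\<i> *c w) T)"] by blast
  ultimately show ?case using T(1)
    by (intro exI[of _ "insert w (insert (\<i> *c w) T)"]) (auto intro: span_add)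
qed

text \<open>Here \<open>g\<close> is linear only in the algebraic sense. Composed with
  \<open>K\<close> it takes values built from finitely many vectors \<open>g w\<close>, which makes
  the composition bounded. This supplies the continuity of the inverse in the Fredholm alternative
  below.\<close>

lemma finite_rank_compose_bounded:
  assumes K: "finite_rank K"
    and g: "\<And>x y. g (x + y) = g x + g y" "\<And>c x. g (c *c x) = c *c g x"
  shows "\<exists>C. \<forall>y. norm (g (K y)) \<le> C * norm y"
  using K
proof (induction rule: finite_rank.induct)
  case zero
  have "g 0 = 0" using g(1)[of 0 0] by simp
  then show ?case by (intro exI[of _ 0]) simp
next
  case (add_rank1 K f i w)
  then obtain C where C: "\<And>y. norm (g (K y)) \<le> C * norm y" by blast
  obtain D where D: "\<And>y. norm (f y) \<le> norm y * D"
    using bounded_linear.bounded[OF bclinD[OF \<open>bclin f\<close>]] by blast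
  have "norm (g (K y + coord (f y) i *c w)) \<le> (C + D * norm (g w)) * norm y" for y
  proof -
    have "norm (g (K y + coord (f y) i *c w)) \<le> norm (g (K y)) + cmod (coord (f y) i) * norm (g w)"
      using norm_triangle_ineq[of "g (K y)" "g (coord (f y) i *c w)"] by (simp only: g norm_cscale)
    also have "\<dots> \<le> C * norm y + (norm y * D) * norm (g w)"
      using order_trans[OF norm_coord_le D] by (intro add_mono C mult_right_mono) auto
    finally show ?thesis by (simp add: algebra_simps)
  qed
  then show ?case by blast
qed

text \<open>By counting: the image of a basis is independent and has as many elements as the basis,
  so a vector outside its span would give one independent vector too many.\<close>

lemma linear_inj_on_finite_span_surj:
  fixes h :: "'a::real_vector \<Rightarrow> 'a"
  assumes h: "linear h" and inj: "inj h" and T: "finite T" and into: "\<And>x. x \<in> span T \<Longrightarrow> h x \<in> span T"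
  shows "h ` span T = span T"
proof -
  obtain B where B: "B \<subseteq> T" "independent B" "T \<subseteq> span B"
    using maximal_independent_subset[of T] by blast
  have spB: "span B = span T"
    using B(1,3) span_superset[of T] by (simp add: span_eq subset_trans)
  have fB: "finite B" using B(1) T finite_subset by blast
  have ind: "independent (h ` B)"
    by (rule linear_independent_injective_image[OF h B(2) inj_on_subset[OF inj subset_UNIV]])
  have sub: "h ` B \<subseteq> span B" using into spB B(1) by (auto intro: span_base)
  have card: "card (h ` B) = card B" using inj by (simp add: card_image inj_on_subset)
  have "b \<in> span (h ` B)" if b: "b \<in> span T" for b
  proof (rule ccontr)
    assume nb: "b \<notin> span (h ` B)"
    then have "independent (insert b (h ` B))" using ind by (simp add: independent_insert)
    moreover have "insert b (h ` B) \<subseteq> span B" using sub b spB by simp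
    ultimately have "card (insert b (h ` B)) \<le> card B"
      using independent_span_bound[OF fB] by blast
    moreover have "b \<notin> h ` B" using nb by (auto intro: span_base)
    ultimately show False using fB card by simp
  qed
  moreover have "span (h ` B) = h ` span B" using h by (rule linear_span_image)
  ultimately show ?thesis using into spB by auto
qed

text \<open>The map preserves the finite-dimensional span that contains the range of
  \<open>K\<close>, hence is onto there by injectivity. Solving for - K y inside that span yields a
  correction \<open>w\<close>, and y + w is a preimage of y.\<close>

lemma bcinv_id_plus_finite_rank:
  assumes K: "finite_rank K" and inj: "\<And>x. x + K x = 0 \<Longrightarrow> x = 0"
  shows "bcinv (\<lambda>x. x + K x)"
proof -
  have Kl: "bclin K" using K by (rule bclin_finite_rank)
  interpret K: bounded_linear K using Kl by (rule bclinD)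
  define h where "h = (\<lambda>x. x + K x)"
  have hl: "bclin h" unfolding h_def by (intro bclin_add bclin_ident Kl)
  interpret h: bounded_linear h using hl by (rule bclinD)
  have hinj: "x = y" if "h x = h y" for x y
    using inj[of "x - y"] that by (simp add: h_def K.diff algebra_simps)
  obtain T where T: "finite T" "\<And>x. K x \<in> span T" using finite_rank_range[OF K] by blast
  have img: "h ` span T = span T"
  proof (rule linear_inj_on_finite_span_surj[OF h.linear _ T(1)])
    show "inj h" using hinj by (rule injI)
    show "h x \<in> span T" if "x \<in> span T" for x
      unfolding h_def using that T(2) by (rule span_add)
  qed
  have surj: "\<exists>x. h x = y" for y
  proof -
    have "- K y \<in> h ` span T" unfolding img using T(2) by (simp add: span_neg)
    then obtain w where w: "h w = - K y" by auto
    have "h (y + w) = y" unfolding h.add w by (simp add: h_def)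
    then show ?thesis by blast
  qed
  define g where "g = (\<lambda>y. SOME x. h x = y)"
  have hg: "h (g y) = y" for y unfolding g_def using surj[of y] by (rule someI_ex)
  have ga: "g (x + y) = g x + g y" for x y by (rule hinj) (simp add: hg h.add)
  have gc: "g (c *c x) = c *c g x" for c x by (rule hinj) (simp add: hg bclin_cscale[OF hl])
  obtain C where C: "\<And>y. norm (g (K y)) \<le> C * norm y"
    using finite_rank_compose_bounded[OF K, of g] ga gc by blast
  have "norm x \<le> (1 + C) * norm (h x)" for x
  proof -
    have "g (h x) = x" by (rule hinj) (rule hg)
    \<comment> \<open>The resolvent-type identity g = 1 - g K bounds the inverse, since g K has
      already been bounded.\<close>
    moreover have "g (h x) = h x - g (K (h x))"
    proof (rule hinj)
      show "h (g (h x)) = h (h x - g (K (h x)))" by (simp only: hg h.diff) (simp add: h_def)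
    qed
    ultimately have "norm x \<le> norm (h x) + norm (g (K (h x)))"
      by (metis norm_triangle_ineq4)
    then show ?thesis using C[of "h x"] by (simp add: algebra_simps)
  qed
  then have "bcinv h" using hl surj by (intro bcinvI[of h "1 + C"])
  then show ?thesis by (simp add: h_def)
qed

text \<open>Factor the sum as M (1 + g K), with \<open>g\<close> the inverse of
  \<open>M\<close>.\<close>

lemma bcinv_plus_finite_rank:
  assumes M: "bcinv M" "bclin M" and K: "finite_rank K" and inj: "\<And>x. M x + K x = 0 \<Longrightarrow> x = 0"
  shows "bcinv (\<lambda>x. M x + K x)"
proof -
  obtain g where g: "bclin g" "\<And>x. M (g x) = x" "\<And>x. g (M x) = x"
    using M by (auto simp: bcinv_def)
  interpret M: bounded_linear M using M(2) by (rule bclinD)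
  have *: "M x + K x = M (x + g (K x))" for x by (simp add: M.add g)
  have "bcinv (\<lambda>x. x + g (K x))"
  proof (rule bcinv_id_plus_finite_rank)
    show "finite_rank (\<lambda>x. g (K x))" by (rule finite_rank_post[OF g(1) K])
    show "x = 0" if "x + g (K x) = 0" for x
      by (rule inj) (simp add: * that M.zero)
  qed
  from bcinv_compose[OF M(1) this] show ?thesis unfolding * .
qed

section \<open>Holomorphic families\<close>

text \<open>A weak notion, easy to verify: holomorphic coordinates plus one bound on the disc. By
  \<open>hol_family_power_series\<close> it already implies a power series converging in norm on
  that disc.\<close>

definition hol_family :: "(complex \<Rightarrow> 'i ell2) \<Rightarrow> complex \<Rightarrow> real \<Rightarrow> bool" where
  "hol_family F s \<rho> \<longleftrightarrow>
     (\<forall>i. (\<lambda>z. coord (F z) i) holomorphic_on ball s \<rho>) \<and> (\<exists>M. \<forall>z\<in>ball s \<rho>. norm (F z) \<le> M)"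

lemma hol_familyI:
  "(\<And>i. (\<lambda>z. coord (F z) i) holomorphic_on ball s \<rho>) \<Longrightarrow> (\<And>z. z \<in> ball s \<rho> \<Longrightarrow> norm (F z) \<le> M)
    \<Longrightarrow> hol_family F s \<rho>"
  unfolding hol_family_def by blast

lemma hol_familyD: "hol_family F s \<rho> \<Longrightarrow> (\<lambda>z. coord (F z) i) holomorphic_on ball s \<rho>"
  unfolding hol_family_def by blast

lemma higher_deriv_linear_combination:
  assumes "finite J" "\<And>j. j \<in> J \<Longrightarrow> f j holomorphic_on S" "open S" "s \<in> S"
  shows "(deriv ^^ k) (\<lambda>z. \<Sum>j\<in>J. v j * f j z) s = (\<Sum>j\<in>J. v j * (deriv ^^ k) (f j) s)"
  using assms(1,2)
proof (induction J)
  case (insert j J)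
  have "(deriv ^^ k) (\<lambda>z. v j * f j z + (\<Sum>j\<in>J. v j * f j z)) s
      = (deriv ^^ k) (\<lambda>z. v j * f j z) s + (deriv ^^ k) (\<lambda>z. \<Sum>j\<in>J. v j * f j z) s"
    using insert.prems assms by (intro higher_deriv_add) (auto intro!: holomorphic_intros)
  moreover have "(deriv ^^ k) (\<lambda>z. v j * f j z) s = v j * (deriv ^^ k) (f j) s"
    using insert.prems assms by (intro higher_deriv_cmult) auto
  ultimately show ?case using insert by simp
qed simp

text \<open>The Cauchy inequality for the scalar products with finitely supported vectors bounds the
  norm of the coefficient vectors.\<close>

lemma hol_family_power_series:
  assumes hol: "hol_family F s \<rho>"
  shows "\<exists>c. \<forall>z\<in>ball s \<rho>. (\<lambda>k. (z - s) ^ k *c c k) sums F z"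
proof -
  obtain M0 where M0: "\<And>z. z \<in> ball s \<rho> \<Longrightarrow> norm (F z) \<le> M0" using hol unfolding hol_family_def by blast
  define M where "M = max M0 0"
  have M: "norm (F z) \<le> M" if "z \<in> ball s \<rho>" for z using M0[OF that] by (simp add: M_def)
  have M_nonneg: "0 \<le> M" by (simp add: M_def)
  have holc: "(\<lambda>z. coord (F z) i) holomorphic_on ball s \<rho>" for i using hol by (auto simp: hol_family_def)
  define a where "a k i = (deriv ^^ k) (\<lambda>z. coord (F z) i) s / fact k" for k i
  have bound: "L2_set (\<lambda>i. cmod (a k i)) J \<le> M / r ^ k" if J: "finite J" and r: "0 < r" "r < \<rho>" for k J r
  proof (cases "L2_set (\<lambda>i. cmod (a k i)) J = 0")
    case False
    define N where "N = L2_set (\<lambda>i. cmod (a k i)) J"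
    have N: "N > 0" using False L2_set_nonneg[of "\<lambda>i. cmod (a k i)" J] unfolding N_def by linarith
    \<comment> \<open>The weights are the conjugated coefficients, so the k-th derivative of
      \<open>g\<close> at \<open>s\<close> is k! N^2. Cauchy's inequality bounds it by k! N M / r^k,
      and one factor N cancels.\<close>
    define g where "g = (\<lambda>z. \<Sum>j\<in>J. cnj (a k j) * coord (F z) j)"
    have sub: "cball s r \<subseteq> ball s \<rho>" using r by auto
    have gh: "g holomorphic_on ball s \<rho>" unfolding g_def by (intro holomorphic_intros holc)
    have gM: "cmod (g z) \<le> N * M" if "z \<in> ball s \<rho>" for z
    proof -
      have "cmod (g z) \<le> (\<Sum>j\<in>J. \<bar>cmod (a k j)\<bar> * \<bar>cmod (coord (F z) j)\<bar>)"
        unfolding g_def by (rule order_trans[OF norm_sum]) (simp add: norm_mult)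
      also have "\<dots> \<le> N * L2_set (\<lambda>j. cmod (coord (F z) j)) J"
        unfolding N_def by (rule L2_set_mult_ineq)
      also have "\<dots> \<le> N * M"
        using N order_trans[OF L2_set_coord_le M[OF that]] by (intro mult_left_mono) auto
      finally show ?thesis .
    qed
    have "cmod ((deriv ^^ k) g s) \<le> fact k * (N * M) / r ^ k"
    proof (rule Cauchy_inequality)
      show "g holomorphic_on ball s r" using gh sub by (meson holomorphic_on_subset ball_subset_cball subset_trans)
      show "continuous_on (cball s r) g" using gh sub holomorphic_on_imp_continuous_on continuous_on_subset by blast
      show "cmod (g x) \<le> N * M" if "cmod (s - x) = r" for x
        using that r by (intro gM) (simp add: dist_norm)
    qed (use r in auto)
    moreover have "(deriv ^^ k) g s = (\<Sum>j\<in>J. cnj (a k j) * (fact k * a k j))"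
      unfolding g_def by (subst higher_deriv_linear_combination[OF J holc]) (use r in \<open>auto simp: a_def\<close>)
    moreover have "\<dots> = fact k * (\<Sum>j\<in>J. of_real ((cmod (a k j))\<^sup>2))"
      unfolding complex_norm_square sum_distrib_left by (simp add: mult_ac)
    moreover have "(\<Sum>j\<in>J. complex_of_real ((cmod (a k j))\<^sup>2)) = of_real (N\<^sup>2)"
      by (simp add: N_def L2_set_def sum_nonneg)
    ultimately have "fact k * N\<^sup>2 \<le> fact k * (N * M / r ^ k)"
      by (simp add: norm_mult norm_power mult_ac)
    then have "N\<^sup>2 \<le> N * M / r ^ k" by (rule mult_left_le_imp_le) simp
    then show ?thesis using N r unfolding N_def[symmetric] by (simp add: power2_eq_square field_simps)
  qed (use M_nonneg r in simp)
  show ?thesis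
  proof (cases "\<rho> > 0")
    case True
    have al2: "a k \<in> l2" for k
      by (rule l2_boundI(1)) (rule bound[of _ "\<rho>/2"], use True in auto)
    define c where "c k = Ell2 (a k)" for k
    have cc: "coord (c k) i = a k i" for k i by (simp add: c_def Ell2_inverse al2)
    have cn: "norm (c k) \<le> M / r ^ k" if "0 < r" "r < \<rho>" for k r
      by (rule ell2_norm_boundI) (simp add: cc bound that)
    have "(\<lambda>k. (z - s) ^ k *c c k) sums F z" if z: "z \<in> ball s \<rho>" for z
    proof -
      \<comment> \<open>Any radius strictly between |z - s| and \<rho> makes the majorant geometric;
        the midpoint is one.\<close>
      define r where "r = (cmod (z - s) + \<rho>) / 2"
      have r: "0 < r" "r < \<rho>" "cmod (z - s) < r" using z True
        by (auto simp: r_def dist_norm norm_minus_commute add_nonneg_pos)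
      have "summable (\<lambda>k. (z - s) ^ k *c c k)"
      proof (rule summable_comparison_test')
        show "summable (\<lambda>k. M * (cmod (z - s) / r) ^ k)"
          using r by (intro summable_mult summable_geometric) (simp add: norm_divide)
        show "norm ((z - s) ^ k *c c k) \<le> M * (cmod (z - s) / r) ^ k" for k
          using mult_left_mono[OF cn[OF r(1,2), of k], of "cmod (z - s) ^ k"]
          by (simp add: norm_power power_divide field_simps)
      qed
      then obtain G where G: "(\<lambda>k. (z - s) ^ k *c c k) sums G" by (auto simp: summable_def)
      have "G = F z"
      proof (rule ell2_eqI)
        fix i
        have "(\<lambda>k. coord ((z - s) ^ k *c c k) i) sums coord G i"
          by (rule bounded_linear.sums[OF bounded_linear_coord G])
        moreover have "(\<lambda>k. a k i * (z - s) ^ k) sums coord (F z) i"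
          unfolding a_def by (rule holomorphic_power_series[OF holc z])
        ultimately show "coord G i = coord (F z) i"
          by (simp add: cc mult.commute sums_iff)
      qed
      with G show ?thesis by simp
    qed
    then show ?thesis by blast
  next
    case False
    then have "ball s \<rho> = {}" by simp
    then show ?thesis by blast
  qed
qed

lemma hol_family_const: "hol_family (\<lambda>z. x) s \<rho>"
  by (rule hol_familyI[where M = "norm x"]) auto

lemma hol_family_add:
  assumes "hol_family F s \<rho>" "hol_family G s \<rho>"
  shows "hol_family (\<lambda>z. F z + G z) s \<rho>"
proof -
  obtain M N where "\<And>z. z \<in> ball s \<rho> \<Longrightarrow> norm (F z) \<le> M" "\<And>z. z \<in> ball s \<rho> \<Longrightarrow> norm (G z) \<le> N"
    using assms unfolding hol_family_def by blast
  then show ?thesis using assms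
    by (intro hol_familyI[where M = "M + N"])
       (auto simp: hol_family_def intro!: holomorphic_intros norm_triangle_mono)
qed

text \<open>A coordinate of \<open>Q (F z)\<close> mixes infinitely many coordinates of
  \<open>F z\<close>, so coordinatewise holomorphy does not pass through directly. It does through
  the norm-convergent power series, to which \<open>Q\<close> applies term by term.\<close>

lemma hol_family_bclin:
  assumes hol: "hol_family F s \<rho>" and Q: "bclin Q"
  shows "hol_family (\<lambda>z. Q (F z)) s \<rho>"
proof -
  obtain M where M: "\<And>z. z \<in> ball s \<rho> \<Longrightarrow> norm (F z) \<le> M" using hol unfolding hol_family_def by blast
  obtain c where c: "\<And>z. z \<in> ball s \<rho> \<Longrightarrow> (\<lambda>k. (z - s) ^ k *c c k) sums F z"
    using hol_family_power_series[OF hol] by blast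
  obtain K where K: "\<And>x. norm (Q x) \<le> norm x * K" "K > 0"
    using bounded_linear.pos_bounded[OF bclinD[OF Q]] by blast
  show ?thesis
  proof (rule hol_familyI[where M = "M * K"])
    fix i
    show "(\<lambda>z. coord (Q (F z)) i) holomorphic_on ball s \<rho>"
    proof (rule power_series_holomorphic)
      fix z assume "z \<in> ball s \<rho>"
      then have "(\<lambda>k. Q ((z - s) ^ k *c c k)) sums Q (F z)"
        by (intro bounded_linear.sums[OF bclinD[OF Q]] c)
      from bounded_linear.sums[OF bounded_linear_coord this]
      show "(\<lambda>k. coord (Q (c k)) i * (z - s) ^ k) sums coord (Q (F z)) i"
        by (simp add: bclin_cscale[OF Q] mult.commute)
    qed
  next
    fix z assume "z \<in> ball s \<rho>"
    then show "norm (Q (F z)) \<le> M * K"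
      using K(2) by (intro order_trans[OF K(1)] mult_right_mono M) auto
  qed
qed

lemma hol_family_diff:
  assumes "hol_family F s \<rho>" "hol_family G s \<rho>"
  shows "hol_family (\<lambda>z. F z - G z) s \<rho>"
proof -
  have "hol_family (\<lambda>z. F z + (-1) *c G z) s \<rho>"
    by (intro hol_family_add assms hol_family_bclin[OF _ bclin_cscale_const])
  moreover have "F z + (-1) *c G z = F z - G z" for z by (rule ell2_eqI) simp
  ultimately show ?thesis by simp
qed

lemma hol_family_wcomp:
  assumes hol: "hol_family F s \<rho>" and \<pi>: "inj \<pi>"
    and a: "\<And>i. (\<lambda>z. a z i) holomorphic_on ball s \<rho>" "\<And>z i. z \<in> ball s \<rho> \<Longrightarrow> cmod (a z i) \<le> c"
  shows "hol_family (\<lambda>z. wcomp (a z) \<pi> (F z)) s \<rho>"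
proof -
  obtain M where M: "\<And>z. z \<in> ball s \<rho> \<Longrightarrow> norm (F z) \<le> M" using hol unfolding hol_family_def by blast
  have holc: "(\<lambda>z. coord (F z) i) holomorphic_on ball s \<rho>" for i using hol by (auto simp: hol_family_def)
  show ?thesis
  proof (rule hol_familyI[where M = "\<bar>c\<bar> * M"])
    fix i
    have "(\<lambda>z. a z i * coord (F z) (\<pi> i)) holomorphic_on ball s \<rho>"
      by (intro holomorphic_intros a holc)
    then show "(\<lambda>z. coord (wcomp (a z) \<pi> (F z)) i) holomorphic_on ball s \<rho>"
      by (rule holomorphic_transform) (simp add: wcomp(1)[OF \<pi> a(2)])
  next
    fix z assume z: "z \<in> ball s \<rho>"
    have "norm (wcomp (a z) \<pi> (F z)) \<le> \<bar>c\<bar> * norm (F z)"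
      using a(2)[OF z] by (intro wcomp(2) \<pi>) (meson abs_ge_self order_trans)
    also have "\<dots> \<le> \<bar>c\<bar> * M" using M[OF z] by (intro mult_left_mono) auto
    finally show "norm (wcomp (a z) \<pi> (F z)) \<le> \<bar>c\<bar> * M" .
  qed
qed

lemma hol_family_uniform_limit:
  assumes hol: "\<And>k. hol_family (F k) s \<rho>"
    and lim: "\<And>k z. z \<in> ball s \<rho> \<Longrightarrow> norm (F k z - G z) \<le> e k" and e: "e \<longlonglongrightarrow> 0"
  shows "hol_family G s \<rho>"
proof -
  obtain M where M: "\<And>z. z \<in> ball s \<rho> \<Longrightarrow> norm (F 0 z) \<le> M"
    using hol[of 0] unfolding hol_family_def by blast
  show ?thesis
  proof (rule hol_familyI[where M = "M + e 0"])
    fix z assume z: "z \<in> ball s \<rho>"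
    have "norm (G z) \<le> norm (F 0 z) + norm (F 0 z - G z)"
      using norm_triangle_ineq4[of "F 0 z" "F 0 z - G z"] by simp
    then show "norm (G z) \<le> M + e 0" using M[OF z] lim[OF z, of 0] by linarith
  next
    fix i
    have ul: "uniform_limit (ball s \<rho>) (\<lambda>k z. coord (F k z) i) (\<lambda>z. coord (G z) i) sequentially"
    proof (rule uniform_limitI)
      fix r :: real assume "r > 0"
      then have "\<forall>\<^sub>F k in sequentially. e k < r" using e by (simp add: order_tendsto_iff)
      then show "\<forall>\<^sub>F k in sequentially. \<forall>z\<in>ball s \<rho>. dist (coord (F k z) i) (coord (G z) i) < r"
      proof eventually_elim
        case (elim k)
        show ?case
        proof
          fix z assume z: "z \<in> ball s \<rho>"
          have "dist (coord (F k z) i) (coord (G z) i) \<le> norm (F k z - G z)"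
            using norm_coord_le[of "F k z - G z" i] by (simp add: dist_norm)
          then show "dist (coord (F k z) i) (coord (G z) i) < r" using lim[OF z, of k] elim by linarith
        qed
      qed
    qed
    show "(\<lambda>z. coord (G z) i) holomorphic_on ball s \<rho>"
    proof (rule holomorphic_uniform_sequence[OF open_ball])
      show "(\<lambda>z. coord (F k z) i) holomorphic_on ball s \<rho>" for k using hol by (auto simp: hol_family_def)
      fix x assume "x \<in> ball s \<rho>"
      then obtain d where d: "d > 0" "cball x d \<subseteq> ball s \<rho>" using open_contains_cball open_ball by blast
      then show "\<exists>d>0. cball x d \<subseteq> ball s \<rho> \<and>
          uniform_limit (cball x d) (\<lambda>k z. coord (F k z) i) (\<lambda>z. coord (G z) i) sequentially"
        using uniform_limit_on_subset[OF ul] by blast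
    qed
  qed
qed

text \<open>\<open>G\<close> is given only pointwise. The iterates started at the constant
  \<open>x0\<close> are holomorphic in z and approach \<open>G\<close> at the rate 2^(-k), uniformly
  in z.\<close>

lemma hol_family_fixpoint:
  fixes \<Psi> :: "complex \<Rightarrow> 'i ell2 \<Rightarrow> 'i ell2"
  assumes r: "0 \<le> r"
    and into: "\<And>z x. z \<in> ball s \<rho> \<Longrightarrow> x \<in> cball x0 r \<Longrightarrow> \<Psi> z x \<in> cball x0 r"
    and contr: "\<And>z x y. z \<in> ball s \<rho> \<Longrightarrow> x \<in> cball x0 r \<Longrightarrow> y \<in> cball x0 r \<Longrightarrow>
        norm (\<Psi> z x - \<Psi> z y) \<le> norm (x - y) / 2"
    and hol: "\<And>F. hol_family F s \<rho> \<Longrightarrow> (\<And>z. z \<in> ball s \<rho> \<Longrightarrow> F z \<in> cball x0 r) \<Longrightarrow>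
        hol_family (\<lambda>z. \<Psi> z (F z)) s \<rho>"
    and G: "\<And>z. z \<in> ball s \<rho> \<Longrightarrow> G z \<in> cball x0 r \<and> \<Psi> z (G z) = G z"
  shows "hol_family G s \<rho>"
proof -
  define F where "F k = (\<lambda>z. (\<Psi> z ^^ k) x0)" for k
  have F: "hol_family (F k) s \<rho> \<and> (\<forall>z\<in>ball s \<rho>. F k z \<in> cball x0 r \<and> norm (F k z - G z) \<le> (1/2)^k * r)" for k
  proof (induction k)
    case 0
    show ?case using G r by (auto simp: F_def hol_family_const dist_norm)
  next
    case (Suc k)
    have eq: "F (Suc k) z = \<Psi> z (F k z)" for z by (simp add: F_def)
    have "hol_family (F (Suc k)) s \<rho>" using hol[of "F k"] Suc by (simp add: eq[abs_def])
    moreover have "norm (F (Suc k) z - G z) \<le> (1/2)^Suc k * r" if z: "z \<in> ball s \<rho>" for z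
    proof -
      have "norm (F (Suc k) z - G z) = norm (\<Psi> z (F k z) - \<Psi> z (G z))"
        using G[OF z] by (simp add: eq)
      also have "\<dots> \<le> norm (F k z - G z) / 2" using z Suc G by (intro contr) auto
      finally show ?thesis using Suc z by fastforce
    qed
    moreover have "F (Suc k) z \<in> cball x0 r" if z: "z \<in> ball s \<rho>" for z
      unfolding eq using z Suc by (intro into) auto
    ultimately show ?case by blast
  qed
  show ?thesis
  proof (rule hol_family_uniform_limit)
    show "hol_family (F k) s \<rho>" for k using F by blast
    show "norm (F k z - G z) \<le> (1/2)^k * r" if "z \<in> ball s \<rho>" for k z using F that by blast
    have "(\<lambda>k. (1/2 :: real)^k * r) \<longlonglongrightarrow> 0 * r" by (intro tendsto_mult LIMSEQ_power_zero tendsto_const) auto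
    then show "(\<lambda>k. (1/2 :: real)^k * r) \<longlonglongrightarrow> 0" by simp
  qed
qed

lemma cball_contraction_fixpoint:
  fixes \<Psi> :: "'a::banach \<Rightarrow> 'a"
  assumes r: "0 \<le> r" and contr: "\<And>x y. x \<in> cball x0 r \<Longrightarrow> y \<in> cball x0 r \<Longrightarrow> norm (\<Psi> x - \<Psi> y) \<le> norm (x - y) / 2"
    and x0: "norm (\<Psi> x0 - x0) \<le> e" "e \<le> r / 2"
  shows "\<Psi> ` cball x0 r \<subseteq> cball x0 r"
    and "\<exists>!x. x \<in> cball x0 r \<and> \<Psi> x = x"
    and "x \<in> cball x0 r \<Longrightarrow> \<Psi> x = x \<Longrightarrow> norm (x - x0) \<le> 2 * e"
proof -
  \<comment> \<open>This one estimate gives the invariance of the ball, as r/2 + e \<le> r, and, at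
    a fixed point, the a priori bound 2 e.\<close>
  have bd: "norm (\<Psi> x - x0) \<le> norm (x - x0) / 2 + e" if "x \<in> cball x0 r" for x
  proof -
    have "norm (\<Psi> x - x0) \<le> norm (\<Psi> x - \<Psi> x0) + norm (\<Psi> x0 - x0)"
      using norm_triangle_ineq[of "\<Psi> x - \<Psi> x0" "\<Psi> x0 - x0"] by simp
    also have "norm (\<Psi> x - \<Psi> x0) \<le> norm (x - x0) / 2" using that r by (intro contr) auto
    finally show ?thesis using x0 by linarith
  qed
  show im: "\<Psi> ` cball x0 r \<subseteq> cball x0 r"
  proof safe
    fix x assume x: "x \<in> cball x0 r"
    then have "norm (x - x0) \<le> r" by (simp add: dist_norm norm_minus_commute)
    then show "\<Psi> x \<in> cball x0 r" using bd[OF x] x0(2) by (simp add: dist_norm norm_minus_commute)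
  qed
  show "\<exists>!x. x \<in> cball x0 r \<and> \<Psi> x = x"
    by (rule Banach_fix[of _ "1/2"]) (use im contr r in \<open>auto simp: dist_norm complete_eq_closed\<close>)
  show "norm (x - x0) \<le> 2 * e" if "x \<in> cball x0 r" "\<Psi> x = x" using bd[OF that(1)] that(2) by simp
qed

section \<open>The weighted space and convolutions\<close>

lemma l2_norm_power2: "(l2_norm u)\<^sup>2 = (\<Sum>\<^sub>\<infinity>n. (norm (u n))\<^sup>2)"
  by (simp add: l2_norm_def infsum_nonneg)

text \<open>Tonelli's theorem for the squared norms; it lets a family over modes and sites be
  handled mode by mode.\<close>

lemma l2_pair_iff:
  fixes U :: "int \<Rightarrow> 'n \<Rightarrow> complex"
  shows "(\<lambda>(m, n). U m n) \<in> l2 \<longleftrightarrow>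
    (\<forall>m. U m \<in> l2) \<and> (\<lambda>m. (l2_norm (U m))\<^sup>2) summable_on UNIV" (is "?A \<longleftrightarrow> ?B")
  and l2_norm_pair:
    "(\<lambda>(m, n). U m n) \<in> l2 \<Longrightarrow> (l2_norm (\<lambda>(m, n). U m n))\<^sup>2 = (\<Sum>\<^sub>\<infinity>m. (l2_norm (U m))\<^sup>2)"
proof -
  have eq: "(\<lambda>x. (norm (case x of (m, n) \<Rightarrow> U m n))\<^sup>2) = (\<lambda>(m, n). (norm (U m n))\<^sup>2)"
    by (auto simp: fun_eq_iff)
  have "(\<lambda>(m, n). (norm (U m n))\<^sup>2) summable_on Sigma UNIV (\<lambda>_. UNIV) \<longleftrightarrow> ?B"
    using Infinite_Sum.abs_summable_on_Sigma_iff[where f = "\<lambda>(m, n). (norm (U m n))\<^sup>2" and A = UNIV and B = "\<lambda>_. UNIV"]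
    by (simp add: l2_def l2_norm_power2 infsum_nonneg case_prod_unfold)
  then show "?A \<longleftrightarrow> ?B" by (simp add: l2_def eq)
  show "(l2_norm (\<lambda>(m, n). U m n))\<^sup>2 = (\<Sum>\<^sub>\<infinity>m. (l2_norm (U m))\<^sup>2)" if ?A
    using infsum_Sigma'_banach[of "\<lambda>m n. (norm (U m n))\<^sup>2" UNIV "\<lambda>_. UNIV"] that
    by (simp add: l2_def eq l2_norm_power2)
qed

definition wt :: "int \<Rightarrow> real" where "wt m = 1 + (real_of_int m)\<^sup>2"

lemma wt_ge_1: "1 \<le> wt m" by (simp add: wt_def)

lemma wt_pos [simp]: "0 < wt m" by (rule less_le_trans[OF zero_less_one wt_ge_1])

lemma wt_simps [simp]: "wt m \<noteq> 0" "\<bar>wt m\<bar> = wt m" "0 \<le> wt m" "1 + (real_of_int \<bar>m\<bar>)\<^sup>2 = wt m"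
  using wt_pos[of m] by (auto simp: wt_def)

text \<open>Dividing the coordinates by the weight identifies \<open>ell2\<close> isometrically with \<open>l22\<close>.\<close>

definition unweight :: "(int \<times> 'n) ell2 \<Rightarrow> int \<Rightarrow> 'n \<Rightarrow> complex" where
  "unweight x m n = coord x (m, n) / of_real (wt m)"

lemma unweight_l22: "unweight x \<in> l22" and l22_norm_unweight: "l22_norm (unweight x) = norm x"
proof -
  have x: "(\<lambda>(m, n). coord x (m, n)) \<in> l2" by (simp add: case_prod_unfold)
  have rows: "(\<lambda>n. coord x (m, n)) \<in> l2" for m using x l2_pair_iff[of "\<lambda>m n. coord x (m, n)"] by blast
  have eq: "unweight x m = (\<lambda>n. (1 / of_real (wt m)) * coord x (m, n))" for m
    by (simp add: unweight_def fun_eq_iff)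
  have n: "(1 + (real_of_int \<bar>m\<bar>)\<^sup>2)\<^sup>2 * (l2_norm (unweight x m))\<^sup>2 = (l2_norm (\<lambda>n. coord x (m, n)))\<^sup>2" for m
  proof -
    have "l2_norm (unweight x m) = l2_norm (\<lambda>n. coord x (m, n)) / wt m"
      unfolding eq l2_cmult(2)[OF rows] using wt_pos[of m] by (simp add: norm_divide)
    then have "wt m * l2_norm (unweight x m) = l2_norm (\<lambda>n. coord x (m, n))" by simp
    then show ?thesis unfolding wt_simps by (metis power_mult_distrib)
  qed
  show "unweight x \<in> l22"
    unfolding l22_def mem_Collect_eq n using x l2_pair_iff[of "\<lambda>m n. coord x (m, n)"]
    unfolding eq by (blast intro: l2_cmult(1)[OF rows])
  show "l22_norm (unweight x) = norm x"
    unfolding l22_norm_def n l2_norm_pair[OF x, symmetric] norm_ell2_def by (simp add: case_prod_unfold)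
qed

lemma l22_imp_unweight:
  assumes "B \<in> l22"
  shows "\<exists>x. B = unweight x"
proof -
  have rows: "B m \<in> l2" for m using assms by (auto simp: l22_def)
  have n: "(l2_norm (\<lambda>n. of_real (wt m) * B m n))\<^sup>2 = (1 + (real_of_int \<bar>m\<bar>)\<^sup>2)\<^sup>2 * (l2_norm (B m))\<^sup>2" for m
    unfolding l2_cmult(2)[OF rows] wt_simps by (simp add: power_mult_distrib)
  have "(\<lambda>(m, n). of_real (wt m) * B m n) \<in> l2"
    unfolding l2_pair_iff n using assms by (auto simp: l22_def intro: l2_cmult(1)[OF rows])
  then have "B = unweight (Ell2 (\<lambda>(m, n). of_real (wt m) * B m n))"
    by (auto simp: fun_eq_iff unweight_def Ell2_inverse)
  then show ?thesis ..
qed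

lemma norm_unweight_le: "cmod (unweight x m n) \<le> norm x / wt m"
  using norm_coord_le[of x "(m, n)"] wt_pos[of m] by (simp add: unweight_def norm_divide divide_right_mono)

text \<open>Summability of the inverse weight embeds \<open>l22\<close> into the absolutely summable
  Fourier series, on which the convolution bounds rest.\<close>

lemma summable_wt: "(\<lambda>m. 1 / wt m) summable_on UNIV"
proof -
  have "summable (\<lambda>n. 1 / (1 + (real n)\<^sup>2))"
  proof (rule summable_comparison_test_ev)
    show "summable (\<lambda>n. inverse ((real n)\<^sup>2))" using inverse_power_summable[of 2, where 'a = real] by simp
    show "\<forall>\<^sub>F n in sequentially. norm (1 / (1 + (real n)\<^sup>2)) \<le> inverse ((real n)\<^sup>2)"
      using eventually_gt_at_top[of 0]
    proof eventually_elim
      case (elim n)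
      then show ?case by (simp add: inverse_eq_divide) (intro divide_left_mono mult_pos_pos add_pos_nonneg, auto)
    qed
  qed
  then have nat: "(\<lambda>n. 1 / (1 + (real n)\<^sup>2)) summable_on UNIV"
    by (simp add: summable_on_UNIV_nonneg_real_iff)
  have "(\<lambda>m. 1 / wt m) summable_on range int"
    using nat by (subst summable_on_reindex) (auto simp: o_def wt_def)
  moreover have "(\<lambda>m. 1 / wt m) summable_on range (\<lambda>n. - int n)"
    using nat by (subst summable_on_reindex) (auto simp: o_def wt_def inj_def)
  ultimately have "(\<lambda>m. 1 / wt m) summable_on (range int \<union> range (\<lambda>n. - int n))"
    by (rule summable_on_union)
  moreover have "range int \<union> range (\<lambda>n. - int n) = UNIV"
  proof -
    have "m \<in> range int \<union> range (\<lambda>n. - int n)" for m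
      by (cases m rule: int_cases2) auto
    then show ?thesis by blast
  qed
  ultimately show ?thesis by simp
qed

lemma l2_norm_unweight_le: "l2_norm (unweight x m) \<le> norm x / wt m"
proof -
  have "inj (Pair m :: 'a \<Rightarrow> _)" by (simp add: inj_def)
  from l2_scaled_bound(2)[OF coord_l2[of x] this, of "1 / wt m" "unweight x m"]
  show ?thesis by (simp add: norm_ell2_def unweight_def norm_divide)
qed

section \<open>Real-analytic curves and holomorphic families\<close>

lemma analytic_l22_I:
  assumes "\<And>s. s \<in> S \<Longrightarrow> \<exists>\<rho>>0. \<exists>G. hol_family G (of_real s) \<rho> \<and>
      (\<forall>t\<in>S. \<bar>t - s\<bar> < \<rho> \<longrightarrow> F t = unweight (G (of_real t)))"
  shows "analytic_l22 F S"
  unfolding analytic_l22_def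
proof
  fix s assume "s \<in> S"
  then obtain \<rho> G where \<rho>: "\<rho> > 0" and G: "hol_family G (of_real s) \<rho>"
    and F: "\<And>t. t \<in> S \<Longrightarrow> \<bar>t - s\<bar> < \<rho> \<Longrightarrow> F t = unweight (G (of_real t))" using assms by metis
  obtain c where c: "\<And>z. z \<in> ball (of_real s) \<rho> \<Longrightarrow> (\<lambda>k. (z - of_real s) ^ k *c c k) sums G z"
    using hol_family_power_series[OF G] by blast
  show "\<exists>r>0. \<exists>c. (\<forall>k. c k \<in> l22) \<and> (\<forall>t\<in>S. \<bar>t - s\<bar> < r \<longrightarrow> F t \<in> l22 \<and>
           (\<lambda>K. l22_norm (\<lambda>m n. F t m n - (\<Sum>k<K. of_real ((t - s) ^ k) * c k m n))) \<longlonglongrightarrow> 0)"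
  proof (intro exI[of _ \<rho>] conjI \<rho> exI[of _ "\<lambda>k. unweight (c k)"] allI ballI impI unweight_l22)
    fix t assume t: "t \<in> S" "\<bar>t - s\<bar> < \<rho>"
    show "F t \<in> l22" by (simp add: F t unweight_l22)
    have "of_real t \<in> ball (of_real s :: complex) \<rho>" using t by (simp add: dist_norm abs_minus_commute flip: of_real_diff)
    then have "(\<lambda>k. of_real ((t - s) ^ k) *c c k) sums G (of_real t)" using c by fastforce
    then have "(\<lambda>K. G (of_real t) - (\<Sum>k<K. of_real ((t - s) ^ k) *c c k)) \<longlonglongrightarrow> G (of_real t) - G (of_real t)"
      unfolding sums_def by (intro tendsto_diff tendsto_const)
    then have "(\<lambda>K. norm (G (of_real t) - (\<Sum>k<K. of_real ((t - s) ^ k) *c c k))) \<longlonglongrightarrow> 0"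
      by (simp add: tendsto_norm_zero_iff)
    moreover have "(\<lambda>m n. F t m n - (\<Sum>k<K. of_real ((t - s) ^ k) * unweight (c k) m n))
        = unweight (G (of_real t) - (\<Sum>k<K. of_real ((t - s) ^ k) *c c k))" for K
      by (simp add: F t unweight_def fun_eq_iff coord_sum diff_divide_distrib sum_divide_distrib)
    ultimately show "(\<lambda>K. l22_norm (\<lambda>m n. F t m n - (\<Sum>k<K. of_real ((t - s) ^ k) * unweight (c k) m n))) \<longlonglongrightarrow> 0"
      by (simp add: l22_norm_unweight)
  qed
qed

lemma analytic_scalar_I:
  assumes "\<And>s. s \<in> S \<Longrightarrow> \<exists>\<rho>>0. \<exists>g. g holomorphic_on ball (of_real s) \<rho> \<and>
      (\<forall>t\<in>S. \<bar>t - s\<bar> < \<rho> \<longrightarrow> f t = g (of_real t))"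
  shows "analytic_scalar f S"
  unfolding analytic_scalar_def
proof
  fix s assume "s \<in> S"
  then obtain \<rho> g where \<rho>: "\<rho> > 0" and g: "g holomorphic_on ball (of_real s) \<rho>"
    and f: "\<And>t. t \<in> S \<Longrightarrow> \<bar>t - s\<bar> < \<rho> \<Longrightarrow> f t = g (of_real t)" using assms by metis
  show "\<exists>r>0. \<exists>c. \<forall>t\<in>S. \<bar>t - s\<bar> < r \<longrightarrow> (\<lambda>k. of_real ((t - s) ^ k) * c k) sums f t"
  proof (intro exI[of _ \<rho>] conjI \<rho> exI[of _ "\<lambda>k. (deriv ^^ k) g (of_real s) / fact k"] ballI impI)
    fix t assume t: "t \<in> S" "\<bar>t - s\<bar> < \<rho>"
    have "of_real t \<in> ball (of_real s :: complex) \<rho>" using t by (simp add: dist_norm abs_minus_commute flip: of_real_diff)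
    from holomorphic_power_series[OF g this]
    show "(\<lambda>k. of_real ((t - s) ^ k) * ((deriv ^^ k) g (of_real s) / fact k)) sums f t"
      by (simp add: f t mult.commute)
  qed
qed

text \<open>A power series that converges at one real point s + \<eta> has bounded terms there,
  hence converges on complex discs of smaller radius. The Lipschitz bound at the centre later keeps
  the continued breather close to the real one.\<close>

lemma analytic_l22_complexify:
  assumes A: "analytic_l22 A S" and S: "open S" "s \<in> S"
  shows "\<exists>\<rho>>0. \<exists>G C. hol_family G (of_real s) \<rho> \<and>
    (\<forall>z\<in>ball (of_real s) \<rho>. norm (G z - G (of_real s)) \<le> C * cmod (z - of_real s)) \<and>
    (\<forall>t\<in>S. \<bar>t - s\<bar> < \<rho> \<longrightarrow> A t = unweight (G (of_real t)))"
proof -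
  obtain r c where r: "r > 0" and c: "\<And>k. c k \<in> l22"
    and lim: "\<And>t. t \<in> S \<Longrightarrow> \<bar>t - s\<bar> < r \<Longrightarrow> A t \<in> l22 \<and>
        (\<lambda>K. l22_norm (\<lambda>m n. A t m n - (\<Sum>k<K. of_real ((t - s) ^ k) * c k m n))) \<longlonglongrightarrow> 0"
    using A[unfolded analytic_l22_def, rule_format, OF S(2)] by blast
  obtain x where x: "\<And>k. c k = unweight (x k)" using l22_imp_unweight[OF c] by metis
  have sums: "\<exists>y. A t = unweight y \<and> (\<lambda>k. of_real (t - s) ^ k *c x k) sums y" if t: "t \<in> S" "\<bar>t - s\<bar> < r" for t
  proof -
    obtain y where y: "A t = unweight y" using lim[OF t] l22_imp_unweight by blast
    have "(\<lambda>m n. A t m n - (\<Sum>k<K. of_real ((t - s) ^ k) * c k m n))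
        = unweight (y - (\<Sum>k<K. of_real (t - s) ^ k *c x k))" for K
      by (simp add: y x unweight_def fun_eq_iff coord_sum diff_divide_distrib sum_divide_distrib)
    then have "(\<lambda>K. norm (y - (\<Sum>k<K. of_real (t - s) ^ k *c x k))) \<longlonglongrightarrow> 0"
      using lim[OF t] by (simp add: l22_norm_unweight)
    then have "(\<lambda>K. y - (\<Sum>k<K. of_real (t - s) ^ k *c x k)) \<longlonglongrightarrow> 0" by (simp add: tendsto_norm_zero_iff)
    then have "(\<lambda>K. y - (y - (\<Sum>k<K. of_real (t - s) ^ k *c x k))) \<longlonglongrightarrow> y - 0"
      by (intro tendsto_diff tendsto_const)
    then show ?thesis using y by (auto simp: sums_def)
  qed
  obtain d where d: "d > 0" "\<And>t. \<bar>t - s\<bar> < d \<Longrightarrow> t \<in> S"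
    using S unfolding open_dist dist_real_def by blast
  \<comment> \<open>Convergence of the series is known only at parameters in \<open>S\<close>, so
    \<eta> must respect the distance \<open>d\<close> to the complement as well as
    \<open>r\<close>.\<close>
  define \<eta> where "\<eta> = min d r / 2"
  have \<eta>: "0 < \<eta>" "\<eta> < d" "\<eta> < r" using d r by (auto simp: \<eta>_def)
  have "\<exists>y. (\<lambda>k. of_real \<eta> ^ k *c x k) sums y"
    using sums[of "s + \<eta>"] d(2)[of "s + \<eta>"] \<eta> by auto
  then have "(\<lambda>k. of_real \<eta> ^ k *c x k) \<longlonglongrightarrow> 0" using summable_LIMSEQ_zero summable_def by blast
  then have "Bseq (\<lambda>k. of_real \<eta> ^ k *c x k)" using convergent_def convergent_imp_Bseq by blast
  then obtain M where M: "M > 0" "\<And>k. norm (of_real \<eta> ^ k *c x k) \<le> M" by (auto simp: Bseq_def)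
  have xM: "norm (x k) \<le> M / \<eta> ^ k" for k
    using M(2)[of k] \<eta> by (simp add: norm_power field_simps)
  \<comment> \<open>Halving the radius makes the ratio of the geometric majorant less than 1/2, so
    its sum is at most 2 M.\<close>
  define \<rho> where "\<rho> = \<eta> / 2"
  have coeff_le: "norm (z ^ k *c x k) \<le> M * (cmod z / \<eta>) ^ k" for k z
    using mult_left_mono[OF xM, of "cmod z ^ k" k] by (simp add: norm_power power_divide field_simps)
  have geo: "summable (\<lambda>k. M * (cmod z / \<eta>) ^ k)" "suminf (\<lambda>k. M * (cmod z / \<eta>) ^ k) \<le> 2 * M"
    if "cmod z < \<rho>" for z
  proof -
    have le: "cmod z / \<eta> < 1 / 2" using that \<eta> by (simp add: \<rho>_def field_simps)
    have "(\<lambda>k. (cmod z / \<eta>) ^ k) sums (1 / (1 - cmod z / \<eta>))"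
      using le \<eta> by (intro geometric_sums) (simp add: norm_divide)
    note * = sums_mult[OF this, of M]
    have "1 / 2 \<le> 1 - cmod z / \<eta>" using le by linarith
    then have "M / (1 - cmod z / \<eta>) \<le> M / (1 / 2)"
      using M(1) by (intro divide_left_mono mult_pos_pos) linarith+
    with *
    show "summable (\<lambda>k. M * (cmod z / \<eta>) ^ k)" "suminf (\<lambda>k. M * (cmod z / \<eta>) ^ k) \<le> 2 * M"
      by (auto simp: sums_iff)
  qed
  have sm: "summable (\<lambda>k. norm (z ^ k *c x k))" if "cmod z < \<rho>" for z
    by (rule summable_comparison_test'[OF geo(1)[OF that]]) (unfold real_norm_def abs_norm_cancel, rule coeff_le)
  define G where "G z = (\<Sum>k. (z - of_real s) ^ k *c x k)" for z
  have Gs: "(\<lambda>k. (z - of_real s) ^ k *c x k) sums G z" if "z \<in> ball (of_real s) \<rho>" for z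
    unfolding G_def using summable_norm_cancel[OF sm[of "z - of_real s"]] that
    by (auto simp: dist_norm norm_minus_commute intro: summable_sums)
  have "hol_family G (of_real s) \<rho>"
  proof (rule hol_familyI)
    show "(\<lambda>z. coord (G z) i) holomorphic_on ball (of_real s) \<rho>" for i
    proof (rule power_series_holomorphic)
      fix z :: complex assume "z \<in> ball (of_real s) \<rho>"
      from bounded_linear.sums[OF bounded_linear_coord Gs[OF this]]
      show "(\<lambda>k. coord (x k) i * (z - of_real s) ^ k) sums coord (G z) i" by (simp add: mult.commute)
    qed
    fix z :: complex assume "z \<in> ball (of_real s) \<rho>"
    then have z: "cmod (z - of_real s) < \<rho>" by (simp add: dist_norm norm_minus_commute)
    show "norm (G z) \<le> 2 * M"
      unfolding G_def using suminf_le[OF coeff_le sm[OF z] geo(1)[OF z]] summable_norm[OF sm[OF z]] geo(2)[OF z] by linarith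
  qed
  moreover have "norm (G z - G (of_real s)) \<le> (2 * M / \<eta>) * cmod (z - of_real s)" if "z \<in> ball (of_real s) \<rho>" for z
  proof -
    define w where "w = z - of_real s"
    have w: "cmod w < \<rho>" using that by (simp add: w_def dist_norm norm_minus_commute)
    have G0: "G (of_real s) = 1 *c x 0"
    proof -
      have eq: "(\<lambda>k. 0 ^ k *c x k) = (\<lambda>k. if k = 0 then 0 ^ k *c x k else 0)"
        by (auto simp: fun_eq_iff intro!: ell2_eqI)
      have "(\<lambda>k. 0 ^ k *c x k) sums (0 ^ 0 *c x 0)" by (subst eq) (rule sums_single)
      then show ?thesis by (simp add: G_def sums_iff)
    qed
    have "(\<lambda>k. w ^ k *c x k) sums G z" using Gs[OF that] by (simp add: w_def)
    then have "(\<lambda>k. w ^ Suc k *c x (Suc k)) sums (G z - G (of_real s))"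
      unfolding G0 by (subst sums_Suc_iff) simp
    then have "norm (G z - G (of_real s)) \<le> suminf (\<lambda>k. (cmod w / \<eta>) * (M * (cmod w / \<eta>) ^ k))"
    proof (subst sums_unique, assumption, intro norm_suminf_le)
      show "norm (w ^ Suc k *c x (Suc k)) \<le> (cmod w / \<eta>) * (M * (cmod w / \<eta>) ^ k)" for k
        using coeff_le[of w "Suc k"] by (simp add: mult_ac)
      show "summable (\<lambda>k. (cmod w / \<eta>) * (M * (cmod w / \<eta>) ^ k))"
        by (intro summable_mult[OF geo(1)[OF w]])
    qed
    also have "\<dots> = (cmod w / \<eta>) * suminf (\<lambda>k. M * (cmod w / \<eta>) ^ k)"
      by (rule suminf_mult[OF geo(1)[OF w]])
    also have "\<dots> \<le> (cmod w / \<eta>) * (2 * M)"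
      using \<eta> by (intro mult_left_mono geo(2)[OF w]) auto
    finally show ?thesis by (simp add: w_def mult_ac)
  qed
  moreover have "A t = unweight (G (of_real t))" if t: "t \<in> S" "\<bar>t - s\<bar> < \<rho>" for t
  proof -
    have "\<bar>t - s\<bar> < r" using t \<eta> by (simp add: \<rho>_def)
    then obtain y where y: "A t = unweight y" "(\<lambda>k. of_real (t - s) ^ k *c x k) sums y" using sums[OF t(1)] by blast
    then show ?thesis by (simp add: G_def sums_iff)
  qed
  moreover have "\<rho> > 0" using \<eta> by (simp add: \<rho>_def)
  ultimately show ?thesis by blast
qed

section \<open>Convolution operators\<close>

definition shiftmul :: "('n \<Rightarrow> complex) \<Rightarrow> int \<Rightarrow> (int \<times> 'n) ell2 \<Rightarrow> (int \<times> 'n) ell2" where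
  "shiftmul a k = wcomp (\<lambda>(m, n). a n) (\<lambda>(m, n). (m - k, n))"

lemma shiftmul:
  assumes "\<And>n. cmod (a n) \<le> c"
  shows "coord (shiftmul a k x) (m, n) = a n * coord x (m - k, n)"
    and "norm (shiftmul a k x) \<le> c * norm x" and "bclin (shiftmul a k)"
proof -
  have i: "inj (\<lambda>(m, n). (m - k, n))" by (auto simp: inj_def)
  have b: "cmod (case j of (m, n) \<Rightarrow> a n) \<le> c" for j :: "int \<times> 'a" using assms by (cases j) auto
  show "coord (shiftmul a k x) (m, n) = a n * coord x (m - k, n)"
    "norm (shiftmul a k x) \<le> c * norm x" "bclin (shiftmul a k)"
    unfolding shiftmul_def using wcomp[OF i b, where x = x] bclin_wcomp[OF i b] by auto
qed

text \<open>Multiplication by a periodic function seen on the Fourier side: convolution in the mode,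
  pointwise product at each site.\<close>

definition conv :: "(int \<Rightarrow> 'n \<Rightarrow> complex) \<Rightarrow> (int \<times> 'n) ell2 \<Rightarrow> (int \<times> 'n) ell2" where
  "conv A x = (\<Sum>\<^sub>\<infinity>k. shiftmul (A k) k x)"

text \<open>A majorant summable over modes and uniform over sites: exactly the norm under which
  convolution acts boundedly on l2.\<close>

definition dominated :: "(int \<Rightarrow> 'n \<Rightarrow> complex) \<Rightarrow> (int \<Rightarrow> real) \<Rightarrow> bool" where
  "dominated A g \<longleftrightarrow> g summable_on UNIV \<and> (\<forall>m n. cmod (A m n) \<le> g m)"

text \<open>Young's inequality for l1 * l2: the operator norms of the shifted multiplications are
  summable, so their sum converges absolutely at every vector.\<close>

lemma
  assumes A: "dominated A g"
  shows has_sum_coord_conv: "((\<lambda>k. A k n * coord x (m - k, n)) has_sum coord (conv A x) (m, n)) UNIV"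
    and norm_conv: "norm (conv A x) \<le> (\<Sum>\<^sub>\<infinity>k. g k) * norm x"
    and bclin_conv: "bclin (conv A)"
proof -
  have g: "g summable_on UNIV" and le: "\<And>m n. cmod (A m n) \<le> g m" using A by (auto simp: dominated_def)
  have gx: "((\<lambda>k. g k * norm x) has_sum (\<Sum>\<^sub>\<infinity>k. g k) * norm x) UNIV" for x :: "(int \<times> 'a) ell2"
    by (intro has_sum_cmult_left has_sum_infsum g)
  have hs: "((\<lambda>k. shiftmul (A k) k x) has_sum conv A x) UNIV" for x
    unfolding conv_def
  proof (rule has_sum_infsum, rule abs_summable_summable)
    show "(\<lambda>k. shiftmul (A k) k x) abs_summable_on UNIV"
      by (rule Infinite_Sum.abs_summable_on_comparison_test'[OF has_sum_imp_summable[OF gx]])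
         (rule shiftmul(2)[OF le])
  qed
  have co: "((\<lambda>k. A k n * coord x (m - k, n)) has_sum coord (conv A x) (m, n)) UNIV" for x m n
    using has_sum_bounded_linear[OF bounded_linear_coord[of "(m, n)"] hs[of x]] by (simp add: o_def shiftmul(1)[OF le])
  then show "((\<lambda>k. A k n * coord x (m - k, n)) has_sum coord (conv A x) (m, n)) UNIV" .
  have no: "norm (conv A x) \<le> (\<Sum>\<^sub>\<infinity>k. g k) * norm x" for x
    by (rule norm_infsum_le[OF hs gx]) (rule shiftmul(2)[OF le])
  then show "norm (conv A x) \<le> (\<Sum>\<^sub>\<infinity>k. g k) * norm x" .
  show "bclin (conv A)"
  proof (rule bclinI)
    fix x y c
    show "conv A (x + y) = conv A x + conv A y"
    proof (rule ell2_eqI, safe)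
      fix m n
      show "coord (conv A (x + y)) (m, n) = coord (conv A x + conv A y) (m, n)"
        using has_sum_unique[OF co[of n "x + y" m] , of "coord (conv A x) (m, n) + coord (conv A y) (m, n)"]
          has_sum_add[OF co[of n x m] co[of n y m]] by (simp add: algebra_simps)
    qed
    show "conv A (c *c x) = c *c conv A x"
    proof (rule ell2_eqI, safe)
      fix m n
      show "coord (conv A (c *c x)) (m, n) = coord (c *c conv A x) (m, n)"
        using has_sum_unique[OF co[of n "c *c x" m] , of "c * coord (conv A x) (m, n)"]
          has_sum_cmult_right[OF co[of n x m], of c] by (simp add: algebra_simps)
    qed
  qed (rule no)
qed

lemma conv_diff:
  assumes "dominated A g" "dominated A' g'" "dominated (\<lambda>m n. A m n - A' m n) h"
  shows "conv A x - conv A' x = conv (\<lambda>m n. A m n - A' m n) x"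
proof (rule ell2_eqI, safe)
  fix m n
  show "coord (conv A x - conv A' x) (m, n) = coord (conv (\<lambda>m n. A m n - A' m n) x) (m, n)"
    using has_sum_unique[OF has_sum_coord_conv[OF assms(3), of n x m],
        of "coord (conv A x) (m, n) - coord (conv A' x) (m, n)"]
      has_sum_add[OF has_sum_coord_conv[OF assms(1), of n x m] has_sum_uminusI[OF has_sum_coord_conv[OF assms(2), of n x m]]]
    by (simp add: algebra_simps)
qed

text \<open>Each coordinate is an infinite sum of holomorphic terms; the M-test with majorant
  \<open>g k * M\<close> makes the convergence over finite subsets uniform, and on closed subdiscs a
  uniform limit of holomorphic functions is holomorphic.\<close>

lemma hol_family_conv:
  assumes hol: "hol_family F s \<rho>"
    and A: "\<And>k n. (\<lambda>z. A z k n) holomorphic_on ball s \<rho>" "\<And>z. z \<in> ball s \<rho> \<Longrightarrow> dominated (A z) g"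
  shows "hol_family (\<lambda>z. conv (A z) (F z)) s \<rho>"
proof (cases "ball s \<rho> = {}")
  case False
  then have g: "g summable_on UNIV" and g0: "0 \<le> g k" for k
    using A(2) norm_ge_zero order_trans unfolding dominated_def by (blast, blast)
  obtain M where M: "\<And>z. z \<in> ball s \<rho> \<Longrightarrow> norm (F z) \<le> M" using hol unfolding hol_family_def by blast
  have holc: "(\<lambda>z. coord (F z) i) holomorphic_on ball s \<rho>" for i using hol unfolding hol_family_def by blast
  show ?thesis
  proof (rule hol_familyI)
    fix z assume z: "z \<in> ball s \<rho>"
    have "norm (conv (A z) (F z)) \<le> (\<Sum>\<^sub>\<infinity>k. g k) * norm (F z)" by (rule norm_conv[OF A(2)[OF z]])
    also have "\<dots> \<le> (\<Sum>\<^sub>\<infinity>k. g k) * M" by (intro mult_left_mono M z infsum_nonneg g0)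
    finally show "norm (conv (A z) (F z)) \<le> (\<Sum>\<^sub>\<infinity>k. g k) * M" .
  next
    fix i :: "int \<times> 'a"
    obtain m n where i: "i = (m, n)" by (cases i)
    define f where "f = (\<lambda>z. coord (conv (A z) (F z)) (m, n))"
    have ul: "uniform_limit (ball s \<rho>) (\<lambda>X z. \<Sum>k\<in>X. A z k n * coord (F z) (m - k, n)) f
        (finite_subsets_at_top UNIV)"
    proof (rule Weierstrass_m_test_general')
      show "(\<lambda>k. g k * M) summable_on UNIV" by (intro summable_on_cmult_left g)
      fix z assume z: "z \<in> ball s \<rho>"
      show "((\<lambda>k. A z k n * coord (F z) (m - k, n)) has_sum f z) UNIV"
        unfolding f_def by (rule has_sum_coord_conv[OF A(2)[OF z]])
      show "cmod (A z k n * coord (F z) (m - k, n)) \<le> g k * M" for k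
        unfolding norm_mult using A(2)[OF z] order_trans[OF norm_coord_le M[OF z]] g0
        by (intro mult_mono) (auto simp: dominated_def)
    qed
    have "f holomorphic_on ball s \<rho>"
    proof -
      have "\<exists>f'. (f has_field_derivative f') (at x)" if x: "x \<in> ball s \<rho>" for x
      proof -
        obtain d where d: "d > 0" "cball x d \<subseteq> ball s \<rho>" using x open_contains_cball open_ball by blast
        have h: "(\<lambda>z. \<Sum>k\<in>X. A z k n * coord (F z) (m - k, n)) holomorphic_on ball s \<rho>" for X
          by (intro holomorphic_intros A holc)
        have "f holomorphic_on ball x d"
        proof (rule holomorphic_uniform_limit[OF _ uniform_limit_on_subset[OF ul d(2)]])
          show "\<forall>\<^sub>F X in finite_subsets_at_top UNIV. continuous_on (cball x d) (\<lambda>z. \<Sum>k\<in>X. A z k n * coord (F z) (m - k, n))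
             \<and> (\<lambda>z. \<Sum>k\<in>X. A z k n * coord (F z) (m - k, n)) holomorphic_on ball x d"
            using h d(2) by (intro always_eventually allI conjI)
              (meson holomorphic_on_imp_continuous_on holomorphic_on_subset ball_subset_cball subset_trans)+
        qed auto
        then show ?thesis using d(1) by (auto simp: holomorphic_on_open)
      qed
      then show ?thesis by (simp add: holomorphic_on_open)
    qed
    then show "(\<lambda>z. coord (conv (A z) (F z)) i) holomorphic_on ball s \<rho>" by (simp add: f_def i)
  qed
next
  case True
  then show ?thesis unfolding hol_family_def by (metis empty_iff holomorphic_on_empty)
qed

text \<open>Telescoping: the difference of the (k+1)-th powers is f applied to the difference of the
  k-th powers, plus f - f' applied to the k-th power of f'.\<close>

lemma funpow_diff_bound:
  fixes f f' :: "'i ell2 \<Rightarrow> 'i ell2"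
  assumes f: "bclin f" "\<And>x. norm (f x) \<le> a * norm x" and f': "\<And>x. norm (f' x) \<le> a * norm x"
    and d: "\<And>x. norm (f x - f' x) \<le> d * norm x" and a: "1 \<le> a" "0 \<le> d"
  shows "norm ((f ^^ k) x) \<le> a ^ k * norm x" "norm ((f' ^^ k) x) \<le> a ^ k * norm x"
    "norm ((f ^^ k) x - (f' ^^ k) x) \<le> real k * a ^ k * d * norm x"
proof -
  have pf: "norm ((h ^^ k) x) \<le> a ^ k * norm x" if "\<And>x. norm (h x) \<le> a * norm x" for h :: "'i ell2 \<Rightarrow> 'i ell2" and k x
  proof (induction k)
    case (Suc k)
    have "norm ((h ^^ Suc k) x) \<le> a * norm ((h ^^ k) x)" using that[of "(h ^^ k) x"] by simp
    also have "\<dots> \<le> a * (a ^ k * norm x)" using Suc a by (intro mult_left_mono) auto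
    finally show ?case by simp
  qed simp
  show "norm ((f ^^ k) x) \<le> a ^ k * norm x" "norm ((f' ^^ k) x) \<le> a ^ k * norm x"
    using pf f f' by blast+
  interpret f: bounded_linear f using f(1) by (rule bclinD)
  show "norm ((f ^^ k) x - (f' ^^ k) x) \<le> real k * a ^ k * d * norm x"
  proof (induction k)
    case (Suc k)
    have "(f ^^ Suc k) x - (f' ^^ Suc k) x = f ((f ^^ k) x - (f' ^^ k) x) + (f ((f' ^^ k) x) - f' ((f' ^^ k) x))"
      by (simp add: f.diff)
    then have "norm ((f ^^ Suc k) x - (f' ^^ Suc k) x)
        \<le> norm (f ((f ^^ k) x - (f' ^^ k) x)) + norm (f ((f' ^^ k) x) - f' ((f' ^^ k) x))"
      using norm_triangle_ineq by metis
    also have "\<dots> \<le> a * (real k * a ^ k * d * norm x) + d * (a ^ k * norm x)"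
    proof (rule add_mono)
      show "norm (f ((f ^^ k) x - (f' ^^ k) x)) \<le> a * (real k * a ^ k * d * norm x)"
        using Suc a by (intro order_trans[OF f(2)] mult_left_mono) auto
      show "norm (f ((f' ^^ k) x) - f' ((f' ^^ k) x)) \<le> d * (a ^ k * norm x)"
        using pf[OF f'] a by (intro order_trans[OF d] mult_left_mono) auto
    qed
    \<comment> \<open>As 1 \<le> a, the second term may take an extra factor \<open>a\<close>; the
      bound then has exponent k throughout instead of k - 1.\<close>
    also have "\<dots> \<le> a * (real k * a ^ k * d * norm x) + a * (d * (a ^ k * norm x))"
      using mult_right_mono[OF a(1), of "d * (a ^ k * norm x)"] a by simp
    finally show ?case by (simp add: algebra_simps)
  qed simp
qed

section \<open>The operators of the spectral problem\<close>

lemma neighbours_shift: "neighbours n = (\<lambda>e. n + e) ` neighbours 0"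
proof
  show "neighbours n \<subseteq> (\<lambda>e. n + e) ` neighbours 0"
  proof
    fix k assume "k \<in> neighbours n"
    then have "k - n \<in> neighbours 0" by (simp add: neighbours_def)
    then show "k \<in> (\<lambda>e. n + e) ` neighbours 0" by (intro image_eqI[of _ _ "k - n"]) auto
  qed
qed (auto simp: neighbours_def)

lemma card_neighbours: "card (neighbours (n :: int ^ 'd)) = 2 * CARD('d)"
proof -
  have eq: "neighbours (0 :: int ^ 'd) = (\<lambda>(i, \<sigma>). axis i \<sigma>) ` (UNIV \<times> {1, -1})"
  proof (intro equalityI subsetI)
    fix k :: "int ^ 'd" assume "k \<in> neighbours 0"
    then have k: "(\<Sum>i\<in>UNIV. (k $ i)\<^sup>2) = 1" by (simp add: neighbours_def)
    have "\<exists>i. k $ i \<noteq> 0"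
    proof (rule ccontr)
      assume "\<nexists>i. k $ i \<noteq> 0"
      then show False using k by simp
    qed
    then obtain i where i: "k $ i \<noteq> 0" ..
    have s: "(k $ i)\<^sup>2 + (\<Sum>j\<in>UNIV - {i}. (k $ j)\<^sup>2) = 1"
      using k by (simp add: sum.remove[of UNIV i])
    have "0 < (k $ i)\<^sup>2" using i by simp
    moreover have "0 \<le> (\<Sum>j\<in>UNIV - {i}. (k $ j)\<^sup>2)" by (simp add: sum_nonneg)
    ultimately have ki: "(k $ i)\<^sup>2 = 1" and rest: "(\<Sum>j\<in>UNIV - {i}. (k $ j)\<^sup>2) = 0" using s by linarith+
    have "k $ j = 0" if "j \<noteq> i" for j
      using rest that by (subst (asm) sum_nonneg_eq_0_iff) auto
    then have "k = axis i (k $ i)" by (auto simp: vec_eq_iff axis_def)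
    moreover have "k $ i = 1 \<or> k $ i = -1" using ki by (simp add: power2_eq_1_iff)
    ultimately show "k \<in> (\<lambda>(i, \<sigma>). axis i \<sigma>) ` (UNIV \<times> {1, -1})" by force
  qed (auto simp: neighbours_def axis_def if_distrib[of "\<lambda>x. x\<^sup>2"] cong: if_cong)
  have "inj_on (\<lambda>(i, \<sigma>). axis i \<sigma> :: int ^ 'd) (UNIV \<times> {1, -1})"
    by (auto simp: inj_on_def axis_eq_axis)
  then have "card (neighbours (0 :: int ^ 'd)) = 2 * CARD('d)"
    unfolding eq by (simp add: card_image card_cartesian_product)
  then show ?thesis by (subst neighbours_shift) (simp add: card_image inj_on_def)
qed

text \<open>The adjacency operator is separated from the Laplacian because its norm bound 2 d is
  half the width of the spectrum [-4 d, 0]. The gap argument for the limit operator relies on this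
  centring.\<close>

definition nbr :: "(int \<times> (int ^ 'd)) ell2 \<Rightarrow> (int \<times> (int ^ 'd)) ell2" where
  "nbr x = (\<Sum>e\<in>neighbours 0. wcomp (\<lambda>_. 1) (\<lambda>(m, n). (m, n + e)) x)"

lemma inj_site_shift: "inj (\<lambda>(m, n). (m :: int, n + e :: int ^ 'd))"
  by (auto simp: inj_def)

lemma coord_nbr: "coord (nbr x) (m, n) = (\<Sum>k\<in>neighbours n. coord x (m, k))"
  unfolding nbr_def coord_sum
  by (subst neighbours_shift) (simp add: wcomp(1)[OF inj_site_shift, where c = 1] sum.reindex inj_on_def)

lemma bclin_nbr: "bclin nbr"
  unfolding nbr_def[abs_def] by (intro bclin_sum bclin_wcomp[OF inj_site_shift, where c = 1]) simp

lemma norm_nbr: "norm (nbr (x :: (int \<times> (int ^ 'd)) ell2)) \<le> 2 * real CARD('d) * norm x"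
proof -
  have "norm (nbr x) \<le> (\<Sum>e\<in>neighbours (0 :: int ^ 'd). 1 * norm x)"
    unfolding nbr_def by (rule sum_norm_le) (rule wcomp(2)[OF inj_site_shift], simp)
  then show ?thesis by (simp add: card_neighbours)
qed

definition lap :: "(int \<times> (int ^ 'd)) ell2 \<Rightarrow> (int \<times> (int ^ 'd)) ell2" where
  "lap x = nbr x - of_nat (2 * CARD('d)) *c x"

lemma coord_lap: "coord (lap x) (m, n) = laplacian (\<lambda>k. coord x (m, k)) n"
  by (simp add: lap_def coord_nbr laplacian_def sum_subtractf card_neighbours)

lemma bclin_lap: "bclin lap"
  unfolding lap_def[abs_def] by (intro bclin_sub bclin_nbr bclin_cscale_const)

lemma norm_lap: "norm (lap (x :: (int \<times> (int ^ 'd)) ell2)) \<le> 4 * real CARD('d) * norm x"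
proof -
  have "norm (lap x) \<le> norm (nbr x) + norm (of_nat (2 * CARD('d)) *c x)"
    unfolding lap_def by (rule norm_triangle_ineq4)
  then show ?thesis using norm_nbr[of x] by (simp add: norm_mult)
qed

definition diag :: "(int \<Rightarrow> complex) \<Rightarrow> (int \<times> 'n) ell2 \<Rightarrow> (int \<times> 'n) ell2" where
  "diag f = wcomp (\<lambda>(m, n). f m) (\<lambda>i. i)"

lemma diag:
  fixes x :: "(int \<times> 'n) ell2"
  assumes "\<And>m. cmod (f m) \<le> c"
  shows "coord (diag f x) (m, n) = f m * coord x (m, n)"
    and "norm (diag f x) \<le> c * norm x" and "bclin (diag f :: (int \<times> 'n) ell2 \<Rightarrow> _)"
proof -
  have b: "cmod (case j of (m, n) \<Rightarrow> f m) \<le> c" for j :: "int \<times> 'n" using assms by (cases j) auto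
  show "coord (diag f x) (m, n) = f m * coord x (m, n)" "norm (diag f x) \<le> c * norm x"
    unfolding diag_def using wcomp[OF inj_on_id2 b, where x = x] by auto
  show "bclin (diag f :: (int \<times> 'n) ell2 \<Rightarrow> _)"
    unfolding diag_def by (rule bclin_wcomp[OF inj_on_id2 b])
qed

lemma hol_family_diag:
  assumes "hol_family F s \<rho>" "\<And>m. (\<lambda>z. f z m) holomorphic_on ball s \<rho>"
    "\<And>z m. z \<in> ball s \<rho> \<Longrightarrow> cmod (f z m) \<le> c"
  shows "hol_family (\<lambda>z. diag (f z) (F z)) s \<rho>"
  unfolding diag_def
proof (rule hol_family_wcomp[OF assms(1) inj_on_id2])
  fix i :: "int \<times> 'a"
  show "(\<lambda>z. case i of (m, n) \<Rightarrow> f z m) holomorphic_on ball s \<rho>" using assms(2) by (cases i) simp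
  show "cmod (case i of (m, n) \<Rightarrow> f z m) \<le> c" if "z \<in> ball s \<rho>" for z
    using assms(3)[OF that] by (cases i) simp
qed

text \<open>Fourier form of (1 + 2 p) U^(2 p) W minus the Laplacian of W, the part of the spectral
  problem that carries the prefactor \<epsilon>.\<close>

definition op_T :: "nat \<Rightarrow> (int \<Rightarrow> int ^ 'd \<Rightarrow> complex) \<Rightarrow> (int \<times> (int ^ 'd)) ell2 \<Rightarrow> (int \<times> (int ^ 'd)) ell2" where
  "op_T p A x = of_nat (2 * p + 1) *c (conv A ^^ (2 * p)) x - lap x"

lemma op_T:
  fixes A :: "int \<Rightarrow> int ^ 'd \<Rightarrow> complex"
  assumes A: "dominated A g" and a: "1 \<le> a" "(\<Sum>\<^sub>\<infinity>m. g m) \<le> a"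
  shows "bclin (op_T p A)"
    and "norm (op_T p A x) \<le> (real (2 * p + 1) * a ^ (2 * p) + 4 * real CARD('d)) * norm x"
    and "dominated A' g' \<Longrightarrow> (\<Sum>\<^sub>\<infinity>m. g' m) \<le> a \<Longrightarrow> dominated (\<lambda>m n. A' m n - A m n) h \<Longrightarrow>
      norm (op_T p A' x - op_T p A x) \<le> real (2 * p + 1) * (real (2 * p) * a ^ (2 * p)) * (\<Sum>\<^sub>\<infinity>m. h m) * norm x"
proof -
  have ca: "norm (conv B y) \<le> a * norm y" if "dominated B g'" "(\<Sum>\<^sub>\<infinity>m. g' m) \<le> a"
    for B :: "int \<Rightarrow> int ^ 'd \<Rightarrow> complex" and g' y
    using that by (intro order_trans[OF norm_conv[OF that(1)]] mult_right_mono) auto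
  show "bclin (op_T p A)"
    unfolding op_T_def[abs_def] using bclin_compose[OF bclin_cscale_const bclin_funpow[OF bclin_conv[OF A]]]
    by (intro bclin_sub bclin_lap)
  have "norm ((conv A ^^ (2 * p)) x) \<le> a ^ (2 * p) * norm x"
    using funpow_diff_bound(1)[of "conv A" a "conv A" 0 "2 * p" x] ca[OF A a(2)] bclin_conv[OF A] a(1) by simp
  then have "real (2 * p + 1) * norm ((conv A ^^ (2 * p)) x) \<le> real (2 * p + 1) * (a ^ (2 * p) * norm x)"
    by (intro mult_left_mono) auto
  moreover have "norm (op_T p A x) \<le> norm (of_nat (2 * p + 1) *c (conv A ^^ (2 * p)) x) + norm (lap x)"
    unfolding op_T_def by (rule norm_triangle_ineq4)
  ultimately show "norm (op_T p A x) \<le> (real (2 * p + 1) * a ^ (2 * p) + 4 * real CARD('d)) * norm x"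
    using norm_lap[of x] unfolding norm_cscale norm_of_nat by (simp only: distrib_right mult.assoc)
  assume A': "dominated A' g'" "(\<Sum>\<^sub>\<infinity>m. g' m) \<le> a" and h: "dominated (\<lambda>m n. A' m n - A m n) h"
  have h0: "0 \<le> (\<Sum>\<^sub>\<infinity>m. h m)"
    using h norm_ge_zero order_trans unfolding dominated_def by (intro infsum_nonneg) blast
  have "norm ((conv A' ^^ (2 * p)) x - (conv A ^^ (2 * p)) x)
      \<le> real (2 * p) * a ^ (2 * p) * (\<Sum>\<^sub>\<infinity>m. h m) * norm x"
    by (rule funpow_diff_bound(3)[OF bclin_conv[OF A'(1)] ca[OF A'] ca[OF A a(2)] _ a(1) h0])
       (simp add: conv_diff[OF A'(1) A h] norm_conv[OF h])
  then have "real (2 * p + 1) * norm ((conv A' ^^ (2 * p)) x - (conv A ^^ (2 * p)) x)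
      \<le> real (2 * p + 1) * (real (2 * p) * a ^ (2 * p) * (\<Sum>\<^sub>\<infinity>m. h m) * norm x)"
    by (intro mult_left_mono) auto
  moreover have "op_T p A' x - op_T p A x
      = of_nat (2 * p + 1) *c ((conv A' ^^ (2 * p)) x - (conv A ^^ (2 * p)) x)"
    by (rule ell2_eqI) (simp add: op_T_def algebra_simps)
  ultimately show "norm (op_T p A' x - op_T p A x)
      \<le> real (2 * p + 1) * (real (2 * p) * a ^ (2 * p)) * (\<Sum>\<^sub>\<infinity>m. h m) * norm x"
    by (simp only: norm_cscale norm_of_nat mult.assoc)
qed

lemma hol_family_op_T:
  assumes F: "hol_family F s \<rho>"
    and A: "\<And>k n. (\<lambda>z. A z k n) holomorphic_on ball s \<rho>" "\<And>z. z \<in> ball s \<rho> \<Longrightarrow> dominated (A z) g"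
  shows "hol_family (\<lambda>z. op_T p (A z) (F z)) s \<rho>"
proof -
  have "hol_family (\<lambda>z. (conv (A z) ^^ k) (F z)) s \<rho>" for k
  proof (induction k)
    case (Suc k)
    then show ?case using hol_family_conv[OF Suc A] by simp
  qed (simp add: F)
  then show ?thesis unfolding op_T_def
    by (intro hol_family_diff hol_family_bclin[OF _ bclin_cscale_const] hol_family_bclin[OF F bclin_lap])
qed

section \<open>Dispersion factor and regularised symbols\<close>

definition dispersion :: "complex \<Rightarrow> complex \<Rightarrow> complex \<Rightarrow> int \<Rightarrow> complex" where
  "dispersion \<epsilon> \<omega> \<mu> m = 1 + (\<epsilon> * \<mu> + \<i> * of_int m * \<omega>)\<^sup>2"

text \<open>Multiplying the spectral problem at modes \<open>m = \<plusminus>1\<close> by \<open>1 / \<epsilon>\<close> and at the other modes by the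
  inverse of the dispersion factor regularises the limit \<open>\<epsilon> \<rightarrow> 0\<close>, with \<open>\<lambda> = \<epsilon> \<mu>\<close>.\<close>

definition res_symbol :: "real \<Rightarrow> complex \<Rightarrow> complex \<Rightarrow> complex \<Rightarrow> int \<Rightarrow> complex" where
  "res_symbol \<Omega> \<epsilon> \<omega> \<mu> m =
     (if \<bar>m\<bar> = 1 then of_real \<Omega> + \<epsilon> * \<mu>\<^sup>2 + 2 * \<i> * of_int m * \<mu> * \<omega> else 1)"

text \<open>Off the modes 1 and -1 it is of order \<epsilon>. In the limit those modes stop
  receiving input but still feed the modes 1 and -1, so the coupling becomes triangular.\<close>

definition cpl_symbol :: "complex \<Rightarrow> complex \<Rightarrow> complex \<Rightarrow> int \<Rightarrow> complex" where
  "cpl_symbol \<epsilon> \<omega> \<mu> m = (if \<bar>m\<bar> = 1 then 1 else \<epsilon> / dispersion \<epsilon> \<omega> \<mu> m)"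

definition kg_op ::
  "nat \<Rightarrow> real \<Rightarrow> (int \<Rightarrow> int ^ 'd \<Rightarrow> complex) \<Rightarrow> complex \<Rightarrow> complex \<Rightarrow> complex
    \<Rightarrow> (int \<times> (int ^ 'd)) ell2 \<Rightarrow> (int \<times> (int ^ 'd)) ell2" where
  "kg_op p \<Omega> A \<epsilon> \<omega> \<mu> x = diag (res_symbol \<Omega> \<epsilon> \<omega> \<mu>) x + diag (cpl_symbol \<epsilon> \<omega> \<mu>) (op_T p A x)"

text \<open>The derivative of \<open>kg_op\<close> in \<mu> at the limit \<epsilon> = 0, \<omega> =
  1.\<close>

definition mode_op :: "(int \<times> 'n) ell2 \<Rightarrow> (int \<times> 'n) ell2" where
  "mode_op = diag (\<lambda>m. if \<bar>m\<bar> = 1 then 2 * \<i> * of_int m else 0)"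

lemma abs_int_cases: "\<bar>m :: int\<bar> = 1 \<or> m = 0 \<or> \<bar>m\<bar> \<ge> 2" by linarith

text \<open>For m = 0 the factor is close to 1. Otherwise 1 + z^2 splits into 1 + i z and 1 - i z,
  and for |m| \<ge> 2 each of the two is at least a multiple of |m|.\<close>

lemma dispersion_lower:
  assumes "cmod (\<epsilon> * \<mu>) \<le> 1 / 10" "cmod (\<omega> - 1) \<le> 1 / 10" "\<bar>m\<bar> \<noteq> 1"
  shows "wt m / 12 \<le> cmod (dispersion \<epsilon> \<omega> \<mu> m)"
proof (cases "m = 0")
  case True
  have "1 - cmod ((\<epsilon> * \<mu>)\<^sup>2) \<le> cmod (1 + (\<epsilon> * \<mu>)\<^sup>2)"
    using norm_triangle_ineq4[of "1 + (\<epsilon> * \<mu>)\<^sup>2" "(\<epsilon> * \<mu>)\<^sup>2"] by simp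
  moreover have "cmod ((\<epsilon> * \<mu>)\<^sup>2) \<le> (1/10)\<^sup>2"
    unfolding norm_power by (rule power_mono[OF assms(1)]) simp
  ultimately show ?thesis using True by (simp add: dispersion_def wt_def power2_eq_square)
next
  case False
  define t where "t = real_of_int \<bar>m\<bar>"
  have t: "t \<ge> 2" using assms(3) False abs_int_cases[of m] by (simp add: t_def)
  have om: "cmod \<omega> \<ge> 9/10"
    using norm_triangle_ineq4[of "\<omega>" "\<omega> - 1"] assms(2) by simp
  have fac: "dispersion \<epsilon> \<omega> \<mu> m = (1 - of_int m * \<omega> + \<i> * (\<epsilon> * \<mu>)) * (1 + of_int m * \<omega> - \<i> * (\<epsilon> * \<mu>))"
    by (simp add: dispersion_def power2_eq_square algebra_simps)
  \<comment> \<open>The term m \<omega> contributes at least 9 t / 10 and the others take away at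
    most 11/10; for t \<ge> 2 this leaves 7 t / 20, sharp at t = 2. The unimodular \<open>c\<close>
    lets one estimate cover both factors.\<close>
  have low: "7/20 * t \<le> cmod (1 + of_int k * \<omega> + c * (\<epsilon> * \<mu>))" if "\<bar>k\<bar> = \<bar>m\<bar>" "cmod c = 1" for k c
  proof -
    have "cmod (of_int k * \<omega>) \<le> cmod (1 + of_int k * \<omega> + c * (\<epsilon> * \<mu>)) + cmod (1 + c * (\<epsilon> * \<mu>))"
      using norm_triangle_ineq4[of "1 + of_int k * \<omega> + c * (\<epsilon> * \<mu>)" "1 + c * (\<epsilon> * \<mu>)"] by simp
    moreover have "cmod (1 + c * (\<epsilon> * \<mu>)) \<le> 1 + 1/10"
      using norm_triangle_ineq[of 1 "c * (\<epsilon> * \<mu>)"] assms(1) that(2) by (simp add: norm_mult)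
    moreover have "cmod (of_int k * \<omega>) = t * cmod \<omega>"
      using arg_cong[OF that(1), of real_of_int] by (simp add: norm_mult t_def)
    moreover have "t * (9/10) \<le> t * cmod \<omega>" using om t by (intro mult_left_mono) auto
    ultimately show ?thesis using t by linarith
  qed
  have "7/20 * t \<le> cmod (1 - of_int m * \<omega> + \<i> * (\<epsilon> * \<mu>))" using low[of "- m" \<i>] by simp
  moreover have "7/20 * t \<le> cmod (1 + of_int m * \<omega> - \<i> * (\<epsilon> * \<mu>))" using low[of m "- \<i>"] by simp
  ultimately have "(7/20 * t) * (7/20 * t) \<le> cmod (dispersion \<epsilon> \<omega> \<mu> m)"
    unfolding fac norm_mult using t by (intro mult_mono) auto
  moreover have "2 * 2 \<le> t * t" using t by (intro mult_mono) auto
  then have "(1 + t * t) / 12 \<le> (7/20 * t) * (7/20 * t)" by (simp add: field_simps)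
  moreover have "wt m = 1 + t * t" by (simp add: wt_def t_def power2_eq_square)
  ultimately show ?thesis by simp
qed

lemma cpl_symbol_bound:
  assumes "cmod (\<epsilon> * \<mu>) \<le> 1 / 10" "cmod (\<omega> - 1) \<le> 1 / 10" "\<bar>m\<bar> \<noteq> 1"
  shows "wt m * cmod (cpl_symbol \<epsilon> \<omega> \<mu> m) \<le> 12 * cmod \<epsilon>" "cmod (cpl_symbol \<epsilon> \<omega> \<mu> m) \<le> 12 * cmod \<epsilon>"
proof -
  note D = dispersion_lower[OF assms]
  have "0 < wt m / 12" by simp
  then have D0: "0 < cmod (dispersion \<epsilon> \<omega> \<mu> m)" using D by linarith
  have "cmod \<epsilon> * (wt m / 12) \<le> cmod \<epsilon> * cmod (dispersion \<epsilon> \<omega> \<mu> m)" using D by (intro mult_left_mono) auto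
  then show *: "wt m * cmod (cpl_symbol \<epsilon> \<omega> \<mu> m) \<le> 12 * cmod \<epsilon>"
    using assms(3) D0 by (simp add: cpl_symbol_def norm_divide field_simps)
  have "1 * cmod (cpl_symbol \<epsilon> \<omega> \<mu> m) \<le> wt m * cmod (cpl_symbol \<epsilon> \<omega> \<mu> m)"
    by (intro mult_right_mono wt_ge_1) auto
  with * show "cmod (cpl_symbol \<epsilon> \<omega> \<mu> m) \<le> 12 * cmod \<epsilon>" by simp
qed

text \<open>The difference of reciprocals has D' - D in the numerator, which carries a factor
  \<epsilon> and grows like 3 \<open>wt m\<close>, over a product of size at least
  (\<open>wt m\<close> / 12)^2. Hence 432 = 3 * 144.\<close>

lemma cpl_symbol_diff:
  assumes "cmod (\<epsilon> * \<mu>) \<le> 1 / 10" "cmod (\<epsilon> * \<mu>') \<le> 1 / 10" "cmod (\<omega> - 1) \<le> 1 / 10" "cmod \<epsilon> \<le> 1"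
  shows "cmod (cpl_symbol \<epsilon> \<omega> \<mu> m - cpl_symbol \<epsilon> \<omega> \<mu>' m) \<le> 432 * cmod \<epsilon> * cmod (\<mu> - \<mu>')"
proof (cases "\<bar>m\<bar> = 1")
  case True
  then show ?thesis by (simp add: cpl_symbol_def)
next
  case False
  define D D' where "D = dispersion \<epsilon> \<omega> \<mu> m" and "D' = dispersion \<epsilon> \<omega> \<mu>' m"
  have D: "wt m / 12 \<le> cmod D" "wt m / 12 \<le> cmod D'"
    using dispersion_lower assms False by (auto simp: D_def D'_def)
  have w: "0 < wt m / 12" by simp
  have nz: "D \<noteq> 0" "D' \<noteq> 0" using D w by (auto simp: not_le[symmetric])
  have om: "cmod \<omega> \<le> 11/10"
    using norm_triangle_ineq[of "\<omega> - 1" 1] assms(3) by simp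
  define t where "t = real_of_int \<bar>m\<bar>"
  have t: "t \<ge> 0" by (simp add: t_def)
  have "D' - D = \<epsilon> * (\<mu>' - \<mu>) * (\<epsilon> * \<mu> + \<epsilon> * \<mu>' + 2 * \<i> * of_int m * \<omega>)"
    by (simp add: D_def D'_def dispersion_def power2_eq_square algebra_simps)
  then have "cmod (D' - D) = cmod \<epsilon> * cmod (\<mu> - \<mu>') * cmod (\<epsilon> * \<mu> + \<epsilon> * \<mu>' + 2 * \<i> * of_int m * \<omega>)"
    by (simp add: norm_mult norm_minus_commute)
  moreover have "cmod (\<epsilon> * \<mu> + \<epsilon> * \<mu>' + 2 * \<i> * of_int m * \<omega>) \<le> 3 * wt m"
  proof -
    have "cmod (\<epsilon> * \<mu> + \<epsilon> * \<mu>' + 2 * \<i> * of_int m * \<omega>) \<le> cmod (\<epsilon> * \<mu>) + cmod (\<epsilon> * \<mu>') + cmod (2 * \<i> * of_int m * \<omega>)"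
      by (intro norm_triangle_mono norm_triangle_ineq order_refl)
    also have "cmod (2 * \<i> * of_int m * \<omega>) = 2 * t * cmod \<omega>" by (simp add: norm_mult t_def)
    also have "2 * t * cmod \<omega> \<le> 2 * t * (11/10)" using om t by (intro mult_left_mono) auto
    finally have "cmod (\<epsilon> * \<mu> + \<epsilon> * \<mu>' + 2 * \<i> * of_int m * \<omega>) \<le> 1/5 + 11/5 * t" using assms by linarith
    also have "\<dots> \<le> 3 * (1 + t\<^sup>2)"
    proof -
      have "t \<le> t * t + 1 / 4" using zero_le_power2[of "t - 1/2"] by (simp add: power2_eq_square algebra_simps)
      moreover have "0 \<le> t * t" by simp
      moreover have "1 / 5 + 11 / 5 * t \<le> 3 * (1 + q)" if "t \<le> q + 1 / 4" "0 \<le> q" for q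
        using that by argo
      ultimately show ?thesis unfolding power2_eq_square by blast
    qed
    finally show ?thesis by (simp add: wt_def t_def)
  qed
  ultimately have DD: "cmod (D' - D) \<le> cmod \<epsilon> * cmod (\<mu> - \<mu>') * (3 * wt m)"
    by (metis mult_left_mono norm_ge_zero mult_nonneg_nonneg)
  have "cpl_symbol \<epsilon> \<omega> \<mu> m - cpl_symbol \<epsilon> \<omega> \<mu>' m = \<epsilon> * (D' - D) / (D * D')"
    using nz False by (simp add: cpl_symbol_def D_def D'_def field_simps)
  then have "cmod (cpl_symbol \<epsilon> \<omega> \<mu> m - cpl_symbol \<epsilon> \<omega> \<mu>' m) = cmod \<epsilon> * cmod (D' - D) / (cmod D * cmod D')"
    by (simp add: norm_mult norm_divide)
  also have "\<dots> \<le> (1 * (cmod \<epsilon> * cmod (\<mu> - \<mu>') * (3 * wt m))) / ((wt m / 12) * (wt m / 12))"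
    using DD D assms(4) w by (intro frac_le mult_mono mult_pos_pos) auto
  also have "\<dots> = 432 * cmod \<epsilon> * cmod (\<mu> - \<mu>') / wt m"
    by (simp add: field_simps)
  also have "\<dots> \<le> 432 * cmod \<epsilon> * cmod (\<mu> - \<mu>') / 1"
    using wt_ge_1[of m] by (intro divide_left_mono) auto
  finally show ?thesis by simp
qed

lemma mode_symbol_bound: "cmod (if \<bar>m\<bar> = 1 then 2 * \<i> * of_int m else 0) \<le> 2"
proof (cases "\<bar>m\<bar> = 1")
  case True
  then have "\<bar>real_of_int m\<bar> = 1" by linarith
  then show ?thesis by (simp add: norm_mult)
qed simp

section \<open>Uniform estimates near the limit problem\<close>

locale kg_data =
  fixes p :: nat and \<Omega> :: real and \<A> :: "int ^ 'd \<Rightarrow> real" and \<Lambda> :: complex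
  assumes A_l2: "\<A> \<in> l2"
begin

definition A0 :: "int \<Rightarrow> int ^ 'd \<Rightarrow> complex" where
  "A0 m n = (if \<bar>m\<bar> = 1 then of_real (\<A> n) else 0)"

definition g0 :: "int \<Rightarrow> real" where
  "g0 m = (if \<bar>m\<bar> = 1 then l2_norm \<A> else 0)"

lemma has_sum_g0: "(g0 has_sum 2 * l2_norm \<A>) UNIV"
proof (rule has_sum_finite_neutralI[of "{-1, 1}"])
  show "2 * l2_norm \<A> = sum g0 {-1, 1}" by (simp add: g0_def)
qed (auto simp: g0_def)

lemma dominated_A0: "dominated A0 g0"
  unfolding dominated_def using has_sum_imp_summable[OF has_sum_g0] norm_le_l2_norm[OF A_l2]
  by (auto simp: A0_def g0_def)

lemma infsum_g0: "infsum g0 UNIV = 2 * l2_norm \<A>"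
  using has_sum_g0 by (rule infsumI)

text \<open>One number measures the distance to the limit data 0, 1 and \<open>A0\<close>. The
  parameters are complex so that the same estimates hold on complex discs, where analyticity is
  proved.\<close>

definition near :: "real \<Rightarrow> complex \<Rightarrow> complex \<Rightarrow> (int \<Rightarrow> int ^ 'd \<Rightarrow> complex) \<Rightarrow> bool" where
  "near \<sigma> \<epsilon> \<omega> A \<longleftrightarrow> cmod \<epsilon> \<le> \<sigma> \<and> cmod (\<omega> - 1) \<le> \<sigma> \<and>
     (\<exists>h. dominated (\<lambda>m n. A m n - A0 m n) h \<and> infsum h UNIV \<le> \<sigma>)"

definition L\<mu> :: real where "L\<mu> = cmod \<Lambda> + 1"

text \<open>Chosen so that |\<epsilon> \<mu>| \<le> 1/10 whenever |\<epsilon>| \<le> \<sigma>1 and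
  \<mu> is within distance 1 of \<Lambda>, as \<open>dispersion_lower\<close> requires.\<close>

definition \<sigma>1 :: real where "\<sigma>1 = 1 / (10 * L\<mu>)"

lemma L\<mu>: "L\<mu> \<ge> 1" by (simp add: L\<mu>_def)

lemma \<sigma>1: "0 < \<sigma>1" "\<sigma>1 \<le> 1 / 10"
  using L\<mu> by (auto simp: \<sigma>1_def field_simps)

text \<open>Exceeds the summed majorant 2 \<open>l2_norm \<A>\<close> of \<open>A0\<close> by enough
  to cover nearby breathers, and is at least 1 for the sake of
  \<open>funpow_diff_bound\<close>.\<close>

definition a0 :: real where "a0 = 2 * l2_norm \<A> + 2"

definition CT :: real where "CT = real (2 * p + 1) * a0 ^ (2 * p) + 4 * real CARD('d)"

definition CD :: real where "CD = real (2 * p + 1) * (real (2 * p) * a0 ^ (2 * p))"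

text \<open>The sum of the constants of \<open>kg_op_near\<close> and
  \<open>kg_op_lipschitz\<close>, so that a single constant serves both; in particular 444 = 12 +
  432.\<close>

definition CK :: real where "CK = L\<mu>\<^sup>2 + 4 * L\<mu> + 5 + 2 * CD + 444 * CT"

lemma a0: "1 \<le> a0" by (simp add: a0_def)

lemma CT: "0 \<le> CT" and CD: "0 \<le> CD" using a0 by (auto simp: CT_def CD_def intro!: add_nonneg_nonneg mult_nonneg_nonneg)

lemma CK: "L\<mu>\<^sup>2 + 2 * L\<mu> + 3 + 2 * CD + 12 * CT \<le> CK" "2 * L\<mu> + 2 + 432 * CT \<le> CK" "CT \<le> CK" "0 \<le> CK"
  using CT CD L\<mu> by (auto simp: CK_def)

context
  fixes \<sigma> :: real and \<epsilon> \<omega> :: complex and A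
  assumes near: "near \<sigma> \<epsilon> \<omega> A" and \<sigma>: "\<sigma> \<le> \<sigma>1"
begin

lemma near_bounds:
  shows "cmod \<epsilon> \<le> \<sigma>" "cmod (\<omega> - 1) \<le> 1 / 10" "cmod (\<omega> - 1) \<le> \<sigma>" "0 \<le> \<sigma>" "cmod \<epsilon> \<le> 1" "cmod \<omega> \<le> 11 / 10"
    and "cmod (\<mu> - \<Lambda>) \<le> 1 \<Longrightarrow> cmod \<mu> \<le> L\<mu>"
    and "cmod (\<mu> - \<Lambda>) \<le> 1 \<Longrightarrow> cmod (\<epsilon> * \<mu>) \<le> 1 / 10"
proof -
  show e: "cmod \<epsilon> \<le> \<sigma>" and o: "cmod (\<omega> - 1) \<le> \<sigma>" using near by (auto simp: near_def)
  then show "cmod (\<omega> - 1) \<le> 1 / 10" "cmod \<epsilon> \<le> 1" using \<sigma> \<sigma>1 by linarith+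
  show "0 \<le> \<sigma>" using e norm_ge_zero order_trans by blast
  show "cmod \<omega> \<le> 11 / 10"
    using norm_triangle_ineq[of "\<omega> - 1" 1] o \<sigma> \<sigma>1 by simp
  assume m: "cmod (\<mu> - \<Lambda>) \<le> 1"
  show M: "cmod \<mu> \<le> L\<mu>" using norm_triangle_ineq[of "\<mu> - \<Lambda>" \<Lambda>] m by (simp add: L\<mu>_def)
  have "cmod (\<epsilon> * \<mu>) \<le> \<sigma>1 * L\<mu>" unfolding norm_mult using e \<sigma> \<sigma>1 M by (intro mult_mono) auto
  then show "cmod (\<epsilon> * \<mu>) \<le> 1 / 10" using L\<mu> by (simp add: \<sigma>1_def)
qed

lemma near_dominated:
  obtains h where "dominated (\<lambda>m n. A m n - A0 m n) h" "infsum h UNIV \<le> \<sigma>"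
    "dominated A (\<lambda>m. g0 m + h m)" "(\<Sum>\<^sub>\<infinity>m. g0 m + h m) \<le> a0"
proof -
  obtain h where h: "dominated (\<lambda>m n. A m n - A0 m n) h" "infsum h UNIV \<le> \<sigma>"
    using near by (auto simp: near_def)
  have hs: "h summable_on UNIV" using h(1) by (simp add: dominated_def)
  have gs: "g0 summable_on UNIV" using dominated_A0 by (simp add: dominated_def)
  have "cmod (A m n) \<le> g0 m + h m" for m n
  proof -
    have "cmod (A m n) \<le> cmod (A0 m n) + cmod (A m n - A0 m n)"
      using norm_triangle_ineq[of "A0 m n" "A m n - A0 m n"] by simp
    then show ?thesis using dominated_A0 h(1) unfolding dominated_def by (meson add_mono order_trans)
  qed
  then have "dominated A (\<lambda>m. g0 m + h m)" using summable_on_add[OF gs hs] by (simp add: dominated_def)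
  moreover have "(\<Sum>\<^sub>\<infinity>m. g0 m + h m) \<le> a0"
    using infsum_add[OF gs hs] h(2) \<sigma> \<sigma>1 by (simp add: infsum_g0 a0_def)
  ultimately show thesis using h that by blast
qed

lemma res_symbol_bound:
  assumes "cmod (\<mu> - \<Lambda>) \<le> 1"
  shows "cmod (res_symbol \<Omega> \<epsilon> \<omega> \<mu> m) \<le> \<bar>\<Omega>\<bar> + L\<mu>\<^sup>2 + 3 * L\<mu> + 1"
proof (cases "\<bar>m\<bar> = 1")
  case True
  then have m: "\<bar>real_of_int m\<bar> = 1" by linarith
  note nb = near_bounds(1-6) near_bounds(7,8)[OF assms]
  have "cmod (\<epsilon> * \<mu>\<^sup>2) \<le> 1 * L\<mu>\<^sup>2"
    unfolding norm_mult norm_power using nb by (intro mult_mono power_mono) auto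
  moreover have "cmod (2 * \<i> * of_int m * \<mu> * \<omega>) \<le> 2 * (L\<mu> * (11/10))"
    using mult_mono[OF nb(7) nb(6)] L\<mu> m by (simp add: norm_mult)
  ultimately show ?thesis
    using True L\<mu> norm_triangle_ineq[of "of_real \<Omega> + \<epsilon> * \<mu>\<^sup>2" "2 * \<i> * of_int m * \<mu> * \<omega>"]
      norm_triangle_ineq[of "of_real \<Omega>" "\<epsilon> * \<mu>\<^sup>2"]
    by (simp add: res_symbol_def)
next
  case False
  then show ?thesis using L\<mu> by (simp add: res_symbol_def)
qed

lemma cpl_symbol_le_2:
  assumes "cmod (\<mu> - \<Lambda>) \<le> 1"
  shows "cmod (cpl_symbol \<epsilon> \<omega> \<mu> m) \<le> 2"
proof (cases "\<bar>m\<bar> = 1")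
  case False
  then show ?thesis
    using cpl_symbol_bound(2)[OF near_bounds(8)[OF assms] near_bounds(2) False] near_bounds(1) \<sigma> \<sigma>1 by linarith
qed (simp add: cpl_symbol_def)

lemma op_T_bounds:
  "bclin (op_T p A)" "norm (op_T p A x) \<le> CT * norm x" "norm (op_T p A x - op_T p A0 x) \<le> CD * \<sigma> * norm x"
  "bclin (op_T p A0)" "norm (op_T p A0 x) \<le> CT * norm x"
proof -
  obtain h where h: "dominated (\<lambda>m n. A m n - A0 m n) h" "infsum h UNIV \<le> \<sigma>"
    "dominated A (\<lambda>m. g0 m + h m)" "(\<Sum>\<^sub>\<infinity>m. g0 m + h m) \<le> a0" by (rule near_dominated)
  have g: "infsum g0 UNIV \<le> a0" by (simp add: infsum_g0 a0_def)
  show "bclin (op_T p A)" by (rule op_T(1)[OF h(3) a0 h(4)])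
  show "bclin (op_T p A0)" by (rule op_T(1)[OF dominated_A0 a0 g])
  show "norm (op_T p A x) \<le> CT * norm x" unfolding CT_def by (rule op_T(2)[OF h(3) a0 h(4)])
  show "norm (op_T p A0 x) \<le> CT * norm x" unfolding CT_def by (rule op_T(2)[OF dominated_A0 a0 g])
  have "norm (op_T p A x - op_T p A0 x) \<le> CD * infsum h UNIV * norm x"
    unfolding CD_def by (rule op_T(3)[OF dominated_A0 a0 g h(3,4,1)])
  also have "\<dots> \<le> CD * \<sigma> * norm x" using CD h(2) by (intro mult_right_mono mult_left_mono) auto
  finally show "norm (op_T p A x - op_T p A0 x) \<le> CD * \<sigma> * norm x" .
qed

lemma bclin_kg_op:
  assumes "cmod (\<mu> - \<Lambda>) \<le> 1"
  shows "bclin (kg_op p \<Omega> A \<epsilon> \<omega> \<mu>)"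
  unfolding kg_op_def[abs_def]
  by (intro bclin_add bclin_compose[OF diag(3)[OF cpl_symbol_le_2[OF assms]]] op_T_bounds diag(3)[OF res_symbol_bound[OF assms]])

text \<open>Once the linear part in \<mu> is removed, the remaining Lipschitz constant is of order
  \<sigma> rather than merely bounded. This is what makes the Newton map below a
  contraction.\<close>

lemma kg_op_lipschitz:
  assumes m: "cmod (\<mu> - \<Lambda>) \<le> 1" and m': "cmod (\<mu>' - \<Lambda>) \<le> 1"
  shows "norm (kg_op p \<Omega> A \<epsilon> \<omega> \<mu> x - kg_op p \<Omega> A \<epsilon> \<omega> \<mu>' x - (\<mu> - \<mu>') *c mode_op x)
    \<le> CK * \<sigma> * cmod (\<mu> - \<mu>') * norm x"
proof -
  note nb = near_bounds(1-6) near_bounds(7,8)[OF m] near_bounds(7,8)[OF m']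
  let ?\<iota> = "\<lambda>m :: int. if \<bar>m\<bar> = 1 then 2 * \<i> * of_int m else 0"
  define f where "f = (\<lambda>m. res_symbol \<Omega> \<epsilon> \<omega> \<mu> m - res_symbol \<Omega> \<epsilon> \<omega> \<mu>' m - (\<mu> - \<mu>') * ?\<iota> m)"
  define g where "g = (\<lambda>m. cpl_symbol \<epsilon> \<omega> \<mu> m - cpl_symbol \<epsilon> \<omega> \<mu>' m)"
  have f: "cmod (f k) \<le> (2 * L\<mu> + 2) * \<sigma> * cmod (\<mu> - \<mu>')" for k
  proof (cases "\<bar>k\<bar> = 1")
    case True
    then have k: "\<bar>real_of_int k\<bar> = 1" by linarith
    \<comment> \<open>The square in the symbol leaves \<epsilon> (\<mu> + \<mu>') and the frequency
      leaves \<omega> - 1; both are small.\<close>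
    have "f k = (\<mu> - \<mu>') * (\<epsilon> * (\<mu> + \<mu>') + 2 * \<i> * of_int k * (\<omega> - 1))"
      using True by (simp add: f_def res_symbol_def power2_eq_square algebra_simps)
    then have "cmod (f k) = cmod (\<mu> - \<mu>') * cmod (\<epsilon> * (\<mu> + \<mu>') + 2 * \<i> * of_int k * (\<omega> - 1))" by (simp add: norm_mult)
    also have "\<dots> \<le> cmod (\<mu> - \<mu>') * (\<sigma> * (L\<mu> + L\<mu>) + 2 * \<sigma>)"
    proof (rule mult_left_mono)
      have "cmod (\<epsilon> * (\<mu> + \<mu>')) \<le> \<sigma> * (L\<mu> + L\<mu>)"
        unfolding norm_mult using nb by (intro mult_mono norm_triangle_mono) auto
      moreover have "cmod (2 * \<i> * of_int k * (\<omega> - 1)) \<le> 2 * \<sigma>" using nb k by (simp add: norm_mult)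
      ultimately show "cmod (\<epsilon> * (\<mu> + \<mu>') + 2 * \<i> * of_int k * (\<omega> - 1)) \<le> \<sigma> * (L\<mu> + L\<mu>) + 2 * \<sigma>"
        by (rule norm_triangle_mono)
    qed simp
    finally show ?thesis by (simp add: algebra_simps)
  next
    case False
    then show ?thesis using nb L\<mu> by (simp add: f_def res_symbol_def)
  qed
  have g: "cmod (g k) \<le> 432 * \<sigma> * cmod (\<mu> - \<mu>')" for k
  proof -
    have "cmod (g k) \<le> 432 * cmod \<epsilon> * cmod (\<mu> - \<mu>')"
      unfolding g_def by (rule cpl_symbol_diff) (use nb in auto)
    also have "\<dots> \<le> 432 * \<sigma> * cmod (\<mu> - \<mu>')" using nb by (intro mult_right_mono mult_left_mono) auto
    finally show ?thesis .
  qed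
  have "kg_op p \<Omega> A \<epsilon> \<omega> \<mu> x - kg_op p \<Omega> A \<epsilon> \<omega> \<mu>' x - (\<mu> - \<mu>') *c mode_op x
      = diag f x + diag g (op_T p A x)"
  proof (rule ell2_eqI, safe)
    fix k n
    show "coord (kg_op p \<Omega> A \<epsilon> \<omega> \<mu> x - kg_op p \<Omega> A \<epsilon> \<omega> \<mu>' x - (\<mu> - \<mu>') *c mode_op x) (k, n)
        = coord (diag f x + diag g (op_T p A x)) (k, n)"
      by (simp only: kg_op_def mode_op_def coord_diff coord_add coord_cscale diag(1)[OF f] diag(1)[OF g]
          diag(1)[OF res_symbol_bound[OF m]] diag(1)[OF res_symbol_bound[OF m']]
          diag(1)[OF cpl_symbol_le_2[OF m]] diag(1)[OF cpl_symbol_le_2[OF m']] diag(1)[OF mode_symbol_bound])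
         (simp add: f_def g_def algebra_simps)
  qed
  then have "norm (kg_op p \<Omega> A \<epsilon> \<omega> \<mu> x - kg_op p \<Omega> A \<epsilon> \<omega> \<mu>' x - (\<mu> - \<mu>') *c mode_op x)
      \<le> norm (diag f x) + norm (diag g (op_T p A x))" by (simp add: norm_triangle_ineq)
  also have "norm (diag f x) \<le> (2 * L\<mu> + 2) * \<sigma> * cmod (\<mu> - \<mu>') * norm x" by (rule diag(2)[OF f])
  also have "norm (diag g (op_T p A x)) \<le> 432 * \<sigma> * cmod (\<mu> - \<mu>') * (CT * norm x)"
    using nb by (intro order_trans[OF diag(2)[OF g]] mult_left_mono op_T_bounds) auto
  also have "(2 * L\<mu> + 2) * \<sigma> * cmod (\<mu> - \<mu>') * norm x + 432 * \<sigma> * cmod (\<mu> - \<mu>') * (CT * norm x)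
     = (2 * L\<mu> + 2 + 432 * CT) * (\<sigma> * cmod (\<mu> - \<mu>') * norm x)" by (simp add: algebra_simps)
  also have "\<dots> \<le> CK * (\<sigma> * cmod (\<mu> - \<mu>') * norm x)"
    using CK nb by (intro mult_right_mono) auto
  finally show ?thesis by (simp add: mult.assoc)
qed

text \<open>Three sources of error are added up: the change of the diagonal symbol, the change of
  the breather inside \<open>op_T\<close>, and the coupling off the modes 1 and -1, which vanishes
  in the limit.\<close>

lemma kg_op_near:
  assumes m: "cmod (\<mu> - \<Lambda>) \<le> 1"
  shows "norm (kg_op p \<Omega> A \<epsilon> \<omega> \<mu> x - kg_op p \<Omega> A0 0 1 \<Lambda> x) \<le> CK * (\<sigma> + cmod (\<mu> - \<Lambda>)) * norm x"
proof -
  note nb = near_bounds(1-6) near_bounds(7,8)[OF m]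
  define f where "f = (\<lambda>m. res_symbol \<Omega> \<epsilon> \<omega> \<mu> m - res_symbol \<Omega> 0 1 \<Lambda> m)"
  define g where "g = (\<lambda>m. cpl_symbol \<epsilon> \<omega> \<mu> m - cpl_symbol 0 1 \<Lambda> m)"
  have f: "cmod (f k) \<le> (L\<mu>\<^sup>2 + 2 * L\<mu> + 3) * (\<sigma> + cmod (\<mu> - \<Lambda>))" for k
  proof (cases "\<bar>k\<bar> = 1")
    case True
    then have k: "\<bar>real_of_int k\<bar> = 1" by linarith
    have "f k = \<epsilon> * \<mu>\<^sup>2 + 2 * \<i> * of_int k * ((\<mu> - \<Lambda>) * \<omega> + \<Lambda> * (\<omega> - 1))"
      using True by (simp add: f_def res_symbol_def algebra_simps)
    also have "cmod \<dots> \<le> \<sigma> * L\<mu>\<^sup>2 + 2 * (cmod (\<mu> - \<Lambda>) * (11 / 10) + L\<mu> * \<sigma>)"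
    proof (rule norm_triangle_mono)
      show "cmod (\<epsilon> * \<mu>\<^sup>2) \<le> \<sigma> * L\<mu>\<^sup>2"
        unfolding norm_mult norm_power using nb by (intro mult_mono power_mono) auto
      have "cmod ((\<mu> - \<Lambda>) * \<omega> + \<Lambda> * (\<omega> - 1)) \<le> cmod (\<mu> - \<Lambda>) * (11 / 10) + L\<mu> * \<sigma>"
      proof (rule norm_triangle_mono)
        show "cmod ((\<mu> - \<Lambda>) * \<omega>) \<le> cmod (\<mu> - \<Lambda>) * (11 / 10)"
          unfolding norm_mult using nb by (intro mult_left_mono) auto
        show "cmod (\<Lambda> * (\<omega> - 1)) \<le> L\<mu> * \<sigma>"
          unfolding norm_mult using nb L\<mu> by (intro mult_mono) (auto simp: L\<mu>_def)
      qed
      then show "cmod (2 * \<i> * of_int k * ((\<mu> - \<Lambda>) * \<omega> + \<Lambda> * (\<omega> - 1))) \<le> 2 * (cmod (\<mu> - \<Lambda>) * (11 / 10) + L\<mu> * \<sigma>)"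
        using k by (simp add: norm_mult)
    qed
    also have "\<dots> \<le> (L\<mu>\<^sup>2 + 2 * L\<mu> + 3) * (\<sigma> + cmod (\<mu> - \<Lambda>))"
    proof -
      have "(L\<mu>\<^sup>2 + 2 * L\<mu> + 3) * (\<sigma> + cmod (\<mu> - \<Lambda>)) = \<sigma> * L\<mu>\<^sup>2 + 2 * (L\<mu> * \<sigma>) + 3 * \<sigma>
          + (L\<mu>\<^sup>2 + 2 * L\<mu>) * cmod (\<mu> - \<Lambda>) + 3 * cmod (\<mu> - \<Lambda>)" by (simp add: algebra_simps)
      moreover have "0 \<le> (L\<mu>\<^sup>2 + 2 * L\<mu>) * cmod (\<mu> - \<Lambda>)" using L\<mu> by simp
      moreover have "0 \<le> cmod (\<mu> - \<Lambda>)" by simp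
      ultimately show ?thesis using nb(4) by argo
    qed
    finally show ?thesis .
  next
    case False
    then show ?thesis using nb L\<mu> by (simp add: f_def res_symbol_def)
  qed
  have g: "cmod (g k) \<le> 12 * \<sigma>" for k
  proof (cases "\<bar>k\<bar> = 1")
    case False
    then show ?thesis using cpl_symbol_bound(2)[OF nb(8) nb(2) False] nb(1) by (simp add: g_def cpl_symbol_def)
  qed (use nb in \<open>simp add: g_def cpl_symbol_def\<close>)
  have r0: "cmod (res_symbol \<Omega> 0 1 \<Lambda> k) \<le> (\<bar>\<Omega>\<bar> + L\<mu>\<^sup>2 + 3 * L\<mu> + 1) + (L\<mu>\<^sup>2 + 2 * L\<mu> + 3) * (\<sigma> + cmod (\<mu> - \<Lambda>))" for k
    using norm_triangle_ineq4[of "res_symbol \<Omega> \<epsilon> \<omega> \<mu> k" "f k"] res_symbol_bound[OF m, of k] f[of k]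
    by (simp add: f_def)
  have c0: "cmod (cpl_symbol 0 1 \<Lambda> k) \<le> 1" for k by (simp add: cpl_symbol_def)
  have "kg_op p \<Omega> A \<epsilon> \<omega> \<mu> x - kg_op p \<Omega> A0 0 1 \<Lambda> x
      = diag f x + (diag (cpl_symbol \<epsilon> \<omega> \<mu>) (op_T p A x - op_T p A0 x) + diag g (op_T p A0 x))"
  proof (rule ell2_eqI, safe)
    fix k n
    show "coord (kg_op p \<Omega> A \<epsilon> \<omega> \<mu> x - kg_op p \<Omega> A0 0 1 \<Lambda> x) (k, n)
        = coord (diag f x + (diag (cpl_symbol \<epsilon> \<omega> \<mu>) (op_T p A x - op_T p A0 x) + diag g (op_T p A0 x))) (k, n)"
      by (simp only: kg_op_def coord_diff coord_add diag(1)[OF f] diag(1)[OF g]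
          diag(1)[OF res_symbol_bound[OF m]] diag(1)[OF r0]
          diag(1)[OF cpl_symbol_le_2[OF m]] diag(1)[OF c0])
         (simp add: f_def g_def algebra_simps)
  qed
  also have "norm \<dots> \<le> (L\<mu>\<^sup>2 + 2 * L\<mu> + 3) * (\<sigma> + cmod (\<mu> - \<Lambda>)) * norm x
      + (2 * (CD * \<sigma> * norm x) + 12 * \<sigma> * (CT * norm x))"
    using nb by (intro norm_triangle_mono diag(2)[OF f] order_trans[OF diag(2)[OF g]]
        order_trans[OF diag(2)[OF cpl_symbol_le_2[OF m]]] mult_left_mono op_T_bounds) auto
  also have "\<dots> \<le> (L\<mu>\<^sup>2 + 2 * L\<mu> + 3) * (\<sigma> + cmod (\<mu> - \<Lambda>)) * norm x
      + (2 * CD + 12 * CT) * (\<sigma> + cmod (\<mu> - \<Lambda>)) * norm x"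
  proof -
    have "(2 * CD + 12 * CT) * \<sigma> * norm x \<le> (2 * CD + 12 * CT) * (\<sigma> + cmod (\<mu> - \<Lambda>)) * norm x"
      using CT CD by (intro mult_right_mono mult_left_mono) auto
    then show ?thesis by (simp add: algebra_simps)
  qed
  also have "\<dots> = (L\<mu>\<^sup>2 + 2 * L\<mu> + 3 + 2 * CD + 12 * CT) * ((\<sigma> + cmod (\<mu> - \<Lambda>)) * norm x)"
    by (simp add: algebra_simps)
  also have "\<dots> \<le> CK * ((\<sigma> + cmod (\<mu> - \<Lambda>)) * norm x)" using CK nb by (intro mult_right_mono) auto
  finally show ?thesis by (simp add: mult.assoc)
qed

end

lemma hol_family_kg_op:
  assumes F: "hol_family F s \<rho>" and near: "\<And>z. z \<in> ball s \<rho> \<Longrightarrow> near \<sigma> (\<epsilon> z) (\<omega> z) (A z)" and \<sigma>: "\<sigma> \<le> \<sigma>1"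
    and A: "\<And>k n. (\<lambda>z. A z k n) holomorphic_on ball s \<rho>" "\<And>z. z \<in> ball s \<rho> \<Longrightarrow> dominated (A z) g"
    and hol: "\<epsilon> holomorphic_on ball s \<rho>" "\<omega> holomorphic_on ball s \<rho>" "\<mu> holomorphic_on ball s \<rho>"
    and \<mu>: "\<And>z. z \<in> ball s \<rho> \<Longrightarrow> cmod (\<mu> z - \<Lambda>) \<le> 1"
  shows "hol_family (\<lambda>z. kg_op p \<Omega> (A z) (\<epsilon> z) (\<omega> z) (\<mu> z) (F z)) s \<rho>"
  unfolding kg_op_def
proof (intro hol_family_add hol_family_diag hol_family_op_T[OF F A])
  fix m
  show "(\<lambda>z. res_symbol \<Omega> (\<epsilon> z) (\<omega> z) (\<mu> z) m) holomorphic_on ball s \<rho>"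
    unfolding res_symbol_def by (cases "\<bar>m\<bar> = 1") (auto intro!: holomorphic_intros hol)
  show "(\<lambda>z. cpl_symbol (\<epsilon> z) (\<omega> z) (\<mu> z) m) holomorphic_on ball s \<rho>"
  proof (cases "\<bar>m\<bar> = 1")
    case False
    have w: "0 < wt m / 12" by simp
    have "0 < cmod (dispersion (\<epsilon> z) (\<omega> z) (\<mu> z) m)" if z: "z \<in> ball s \<rho>" for z
      using dispersion_lower[OF near_bounds(8)[OF near[OF z] \<sigma> \<mu>[OF z]] near_bounds(2)[OF near[OF z] \<sigma>] False]
        w by linarith
    then show ?thesis using False unfolding cpl_symbol_def dispersion_def
      by (auto intro!: holomorphic_intros hol)
  qed (simp add: cpl_symbol_def)
next
  fix z m assume z: "z \<in> ball s \<rho>"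
  show "cmod (res_symbol \<Omega> (\<epsilon> z) (\<omega> z) (\<mu> z) m) \<le> \<bar>\<Omega>\<bar> + L\<mu>\<^sup>2 + 3 * L\<mu> + 1"
    by (rule res_symbol_bound[OF near[OF z] \<sigma> \<mu>[OF z]])
  show "cmod (cpl_symbol (\<epsilon> z) (\<omega> z) (\<mu> z) m) \<le> 2"
    by (rule cpl_symbol_le_2[OF near[OF z] \<sigma> \<mu>[OF z]])
qed (use F in auto)

end

section \<open>Persistence of a simple kernel\<close>

text \<open>The coordinate \<open>i0\<close> of a kernel vector is normalised; the slot \<open>i0\<close> of the unknown \<open>y\<close>
  then stores the spectral parameter \<open>\<mu> - \<Lambda>\<close> instead.\<close>

definition drop_coord :: "'i \<Rightarrow> 'i ell2 \<Rightarrow> 'i ell2" where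
  "drop_coord i x = x - coord x i *c unit_vec i"

lemma coord_drop_coord [simp]: "coord (drop_coord i x) j = (if j = i then 0 else coord x j)"
  by (simp add: drop_coord_def)

lemma bclin_drop_coord: "bclin (drop_coord i)"
  unfolding drop_coord_def[abs_def] by (intro bclin_sub bclin_ident bclin_coord)

lemma norm_drop_coord: "norm (drop_coord i x) \<le> norm x"
proof -
  have "drop_coord i x = wcomp (\<lambda>j. if j = i then 0 else 1) (\<lambda>j. j) x"
    by (rule ell2_eqI) (simp add: wcomp(1)[OF inj_on_id2, where c = 1])
  moreover have "norm (wcomp (\<lambda>j. if j = i then 0 else 1) (\<lambda>j. j) x) \<le> 1 * norm x"
    by (rule wcomp(2)[OF inj_on_id2]) simp
  ultimately show ?thesis by simp
qed

text \<open>\<open>J\<close> stands for the derivative of the operator family in \<mu>. The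
  assumption \<open>inv\<close> says that the derivative of the limit equation in the pair of
  eigenvector and \<mu>, taken at (\<open>B0\<close>, \<Lambda>), is invertible.\<close>

locale simple_kernel =
  fixes G0 J :: "'i ell2 \<Rightarrow> 'i ell2" and B0 :: "'i ell2" and i0 :: 'i and \<Lambda> :: complex and K :: real
  assumes J: "bclin J" and G0: "bclin G0" and kernel: "G0 B0 = 0" and K: "0 \<le> K"
    and inv: "bcinv (\<lambda>x. G0 (drop_coord i0 x) + coord x i0 *c J B0)"
begin

definition fill :: "'i ell2 \<Rightarrow> 'i ell2" where
  "fill y = drop_coord i0 y + coord B0 i0 *c unit_vec i0"

definition center :: "'i ell2" where "center = drop_coord i0 B0"

text \<open>All that the fixed point argument uses about the family. Keeping it abstract lets one
  theorem run for the real parameter and for the points of a complex disc.\<close>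

definition admissible :: "real \<Rightarrow> (complex \<Rightarrow> 'i ell2 \<Rightarrow> 'i ell2) \<Rightarrow> bool" where
  "admissible \<sigma> H \<longleftrightarrow> 0 \<le> \<sigma> \<and> (\<forall>\<mu>. cmod (\<mu> - \<Lambda>) \<le> 1 \<longrightarrow> bclin (H \<mu>)) \<and>
     (\<forall>\<mu> x. cmod (\<mu> - \<Lambda>) \<le> 1 \<longrightarrow> norm (H \<mu> x - G0 x) \<le> K * (\<sigma> + cmod (\<mu> - \<Lambda>)) * norm x) \<and>
     (\<forall>\<mu> \<mu>' x. cmod (\<mu> - \<Lambda>) \<le> 1 \<longrightarrow> cmod (\<mu>' - \<Lambda>) \<le> 1 \<longrightarrow>
        norm (H \<mu> x - H \<mu>' x - (\<mu> - \<mu>') *c J x) \<le> K * \<sigma> * cmod (\<mu> - \<mu>') * norm x)"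

definition solves :: "(complex \<Rightarrow> 'i ell2 \<Rightarrow> 'i ell2) \<Rightarrow> 'i ell2 \<Rightarrow> bool" where
  "solves H y \<longleftrightarrow> H (\<Lambda> + coord y i0) (fill y) = 0"

lemma coord_fill [simp]: "coord (fill y) j = (if j = i0 then coord B0 i0 else coord y j)"
  by (simp add: fill_def)

lemma fill_diff: "fill y - fill y' = drop_coord i0 (y - y')"
  by (rule ell2_eqI) simp

lemma fill_center: "fill center = B0"
  by (rule ell2_eqI) (simp add: center_def)

lemma coord_center: "coord center i0 = 0"
  by (simp add: center_def)

text \<open>A simplified Newton iteration, with the derivative frozen at the limit problem. The
  second part is stated for an arbitrary selection \<open>Y\<close> of solutions, since uniqueness
  in the ball makes the iterates converge to whatever was selected.\<close>

theorem persistence: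
  "\<exists>r \<sigma>0 C. 0 < r \<and> r \<le> 1 \<and> 0 < \<sigma>0 \<and> 0 \<le> C \<and>
     (\<forall>\<sigma> H. \<sigma> \<le> \<sigma>0 \<longrightarrow> admissible \<sigma> H \<longrightarrow>
        (\<exists>y. y \<in> cball center r \<and> norm (y - center) \<le> C * \<sigma> \<and> solves H y \<and>
           (\<forall>y'\<in>cball center r. solves H y' \<longrightarrow> y' = y))) \<and>
     (\<forall>\<sigma> s \<rho> H Y. \<sigma> \<le> \<sigma>0 \<longrightarrow> (\<forall>z\<in>ball s \<rho>. admissible \<sigma> (H z)) \<longrightarrow>
        (\<forall>F m. hol_family F s \<rho> \<longrightarrow> m holomorphic_on ball s \<rho> \<longrightarrow> (\<forall>z\<in>ball s \<rho>. cmod (m z - \<Lambda>) \<le> 1) \<longrightarrow>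
           hol_family (\<lambda>z. H z (m z) (F z)) s \<rho>) \<longrightarrow>
        (\<forall>z\<in>ball s \<rho>. Y z \<in> cball center r \<and> solves (H z) (Y z)) \<longrightarrow> hol_family Y s \<rho>)"
proof -
  define L0 where "L0 = (\<lambda>x. G0 (drop_coord i0 x) + coord x i0 *c J B0)"
  obtain Q where Q: "bclin Q" and LQ: "\<And>x. L0 (Q x) = x" and QL: "\<And>x. Q (L0 x) = x"
    using inv unfolding L0_def[symmetric] bcinv_def by blast
  interpret Q: bounded_linear Q using Q by (rule bclinD)
  interpret G0: bounded_linear G0 using G0 by (rule bclinD)
  interpret J: bounded_linear J using J by (rule bclinD)
  obtain N where N: "\<And>x. norm (Q x) \<le> norm x * N" "N > 0" using Q.pos_bounded by blast
  obtain j where j: "\<And>x. norm (J x) \<le> norm x * j" "j > 0" using J.pos_bounded by blast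
  define b where "b = norm B0"
  have b: "0 \<le> b" by (simp add: b_def)
  \<comment> \<open>The summands answer the three error terms \<open>e1\<close>, \<open>e2\<close>,
    \<open>e3\<close> of the contraction estimate.\<close>
  define M where "M = K + K * (b + 1) + j + 1"
  have M: "1 \<le> M" "K \<le> M" using K b j by (auto simp: M_def)
  \<comment> \<open>The Lipschitz constant of the Newton map will be N M (\<sigma> + r), which is at
    most 1/2 once \<sigma> and r are at most \<open>q\<close>.\<close>
  define q where "q = 1 / (4 * N * M)"
  have q: "0 < q" using N M by (simp add: q_def)
  define r where "r = min 1 q"
  have r: "0 < r" "r \<le> 1" "r \<le> q" using q by (auto simp: r_def)
  define C where "C = 2 * (N * K * b)"
  have C: "0 \<le> C" using N K b by (simp add: C_def)
  \<comment> \<open>The second bound keeps the first Newton step, of size at most C \<sigma> / 2,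
    below r / 2.\<close>
  define \<sigma>0 where "\<sigma>0 = min q (r / (C + 1))"
  have \<sigma>0: "0 < \<sigma>0" "\<sigma>0 \<le> q" using q r C by (auto simp: \<sigma>0_def)
  have \<sigma>0r: "C * \<sigma> \<le> r" if "0 \<le> \<sigma>" "\<sigma> \<le> \<sigma>0" for \<sigma>
  proof -
    have "\<sigma> \<le> r / (C + 1)" using that by (simp add: \<sigma>0_def)
    then have "\<sigma> * (C + 1) \<le> r" using C by (simp add: field_simps)
    then show ?thesis using that(1) by (simp add: algebra_simps)
  qed
  define \<Psi> where "\<Psi> H y = y - Q (H (\<Lambda> + coord y i0) (fill y))" for H y
  have fix_iff: "\<Psi> H y = y \<longleftrightarrow> solves H y" for H y
  proof -
    have "Q v = 0 \<longleftrightarrow> v = 0" for v using LQ Q.zero by metis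
    then show ?thesis by (simp add: \<Psi>_def solves_def)
  qed
  have small: "cmod (coord y i0) \<le> norm (y - center)" for y
    using norm_coord_le[of "y - center" i0] by (simp add: coord_center)
  have contr: "norm (\<Psi> H y - \<Psi> H y') \<le> norm (y - y') / 2"
    if adm: "admissible \<sigma> H" and \<sigma>: "\<sigma> \<le> \<sigma>0" and y: "y \<in> cball center r" and y': "y' \<in> cball center r" for \<sigma> H y y'
  proof -
    define \<mu> \<mu>' where "\<mu> = \<Lambda> + coord y i0" and "\<mu>' = \<Lambda> + coord y' i0"
    have yr: "norm (y - center) \<le> r" "norm (y' - center) \<le> r"
      using y y' by (auto simp: dist_norm norm_minus_commute)
    have m: "cmod (\<mu> - \<Lambda>) \<le> r" "cmod (\<mu>' - \<Lambda>) \<le> r" "cmod (\<mu> - \<Lambda>) \<le> 1" "cmod (\<mu>' - \<Lambda>) \<le> 1"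
      using small[of y] small[of y'] yr r by (auto simp: \<mu>_def \<mu>'_def)
    have s: "0 \<le> \<sigma>" using adm by (simp add: admissible_def)
    define d where "d = norm (y - y')"
    have d0: "0 \<le> d" by (simp add: d_def)
    have mm: "\<mu> - \<mu>' = coord (y - y') i0" by (simp add: \<mu>_def \<mu>'_def)
    have md: "cmod (\<mu> - \<mu>') \<le> d" unfolding mm d_def by (rule norm_coord_le)
    have fd: "norm (fill y - fill y') \<le> d" unfolding fill_diff d_def by (rule norm_drop_coord)
    have fB: "norm (fill y' - B0) \<le> r"
    proof -
      have "norm (fill y' - fill center) \<le> norm (y' - center)" unfolding fill_diff by (rule norm_drop_coord)
      then show ?thesis using yr by (simp add: fill_center)
    qed
    have fy': "norm (fill y') \<le> b + 1"
      using norm_triangle_ineq[of "fill y' - B0" B0] fB r by (simp add: b_def)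
    interpret H: bounded_linear "H \<mu>" using adm m by (intro bclinD) (simp add: admissible_def)
    define e1 where "e1 = H \<mu> (fill y - fill y') - G0 (fill y - fill y')"
    define e2 where "e2 = H \<mu> (fill y') - H \<mu>' (fill y') - (\<mu> - \<mu>') *c J (fill y')"
    define e3 where "e3 = (\<mu> - \<mu>') *c J (fill y' - B0)"
    have "H \<mu> (fill y) - H \<mu>' (fill y') - L0 (y - y') = e1 + e2 + e3"
      unfolding e1_def e2_def e3_def L0_def mm[symmetric] fill_diff[symmetric] H.diff J.diff
      by (rule ell2_eqI) (simp add: algebra_simps)
    moreover have "norm e1 \<le> K * (\<sigma> + r) * d"
    proof -
      have "norm e1 \<le> K * (\<sigma> + cmod (\<mu> - \<Lambda>)) * norm (fill y - fill y')"
        using adm m(3) unfolding e1_def admissible_def by blast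
      also have "\<dots> \<le> K * (\<sigma> + r) * d" using K s m r fd d0 by (intro mult_mono mult_nonneg_nonneg) auto
      finally show ?thesis .
    qed
    moreover have "norm e2 \<le> K * \<sigma> * d * (b + 1)"
    proof -
      have "norm e2 \<le> K * \<sigma> * cmod (\<mu> - \<mu>') * norm (fill y')"
        using adm m(3,4) unfolding e2_def admissible_def by blast
      also have "\<dots> \<le> K * \<sigma> * d * (b + 1)" using K s md fy' b d0 by (intro mult_mono mult_nonneg_nonneg) auto
      finally show ?thesis .
    qed
    moreover have "norm e3 \<le> d * (r * j)"
      unfolding e3_def norm_cscale using md fB j r d0
      by (intro mult_mono order_trans[OF j(1)] mult_right_mono) auto
    ultimately have "norm (H \<mu> (fill y) - H \<mu>' (fill y') - L0 (y - y'))
        \<le> K * (\<sigma> + r) * d + K * \<sigma> * d * (b + 1) + d * (r * j)"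
      using norm_triangle_ineq[of "e1 + e2" e3] norm_triangle_ineq[of e1 e2] by simp
    also have "\<dots> \<le> K * (\<sigma> + r) * d + K * (b + 1) * (\<sigma> + r) * d + (j + 1) * (\<sigma> + r) * d"
    proof -
      have "K * (b + 1) * \<sigma> * d \<le> K * (b + 1) * (\<sigma> + r) * d"
        using K b r by (intro mult_right_mono mult_left_mono) (auto simp: d_def)
      moreover have "j * r * d \<le> (j + 1) * (\<sigma> + r) * d"
        using j s r by (intro mult_right_mono mult_mono) (auto simp: d_def)
      ultimately show ?thesis by (simp add: mult_ac)
    qed
    also have "\<dots> = M * (\<sigma> + r) * d" by (simp add: M_def algebra_simps)
    finally have est: "norm (H \<mu> (fill y) - H \<mu>' (fill y') - L0 (y - y')) \<le> M * (\<sigma> + r) * d" .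
    have "\<Psi> H y - \<Psi> H y' = - Q (H \<mu> (fill y) - H \<mu>' (fill y') - L0 (y - y'))"
      unfolding Q.diff[of _ "L0 (y - y')"] QL by (simp add: \<Psi>_def \<mu>_def \<mu>'_def Q.diff)
    then have "norm (\<Psi> H y - \<Psi> H y') \<le> norm (H \<mu> (fill y) - H \<mu>' (fill y') - L0 (y - y')) * N"
      using N(1) by simp
    also have "\<dots> \<le> M * (\<sigma> + r) * d * N" using N by (intro mult_right_mono est) auto
    also have "\<dots> \<le> M * (q + q) * d * N"
      using N M \<sigma> \<sigma>0 r by (intro mult_right_mono mult_left_mono) (auto simp: d_def)
    also have "\<dots> = d / 2" using N M by (simp add: q_def field_simps)
    finally show ?thesis by (simp add: d_def)
  qed
  \<comment> \<open>The centre encodes the pair (\<Lambda>, \<open>B0\<close>); as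
    \<open>G0 B0 = 0\<close>, only a residual of order \<sigma> remains.\<close>
  have start: "norm (\<Psi> H center - center) \<le> N * K * b * \<sigma>" if adm: "admissible \<sigma> H" for \<sigma> H
  proof -
    have "norm (\<Psi> H center - center) \<le> norm (H \<Lambda> B0) * N"
      using N(1) by (simp add: \<Psi>_def fill_center coord_center)
    also have "norm (H \<Lambda> B0) \<le> K * (\<sigma> + cmod (\<Lambda> - \<Lambda>)) * b"
    proof -
      have "norm (H \<Lambda> B0 - G0 B0) \<le> K * (\<sigma> + cmod (\<Lambda> - \<Lambda>)) * norm B0"
        using adm unfolding admissible_def by (metis cancel_comm_monoid_add_class.diff_cancel norm_zero zero_le_one)
      then show ?thesis by (simp add: kernel b_def)
    qed
    finally show ?thesis using N by (simp add: mult_ac)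
  qed
  have half: "N * K * b * \<sigma> \<le> r / 2" if "admissible \<sigma> H" "\<sigma> \<le> \<sigma>0" for \<sigma> H
    using \<sigma>0r[of \<sigma>] that by (simp add: admissible_def C_def)
  have ex: "\<exists>y. y \<in> cball center r \<and> norm (y - center) \<le> C * \<sigma> \<and> solves H y \<and>
           (\<forall>y'\<in>cball center r. solves H y' \<longrightarrow> y' = y)"
    if adm: "admissible \<sigma> H" and \<sigma>: "\<sigma> \<le> \<sigma>0" for \<sigma> H
  proof -
    note fp = cball_contraction_fixpoint[of r center "\<Psi> H", OF less_imp_le[OF r(1)] contr[OF adm \<sigma>] start[OF adm] half[OF adm \<sigma>]]
    obtain y where y: "y \<in> cball center r" "\<Psi> H y = y" and uniq: "\<And>y'. y' \<in> cball center r \<Longrightarrow> \<Psi> H y' = y' \<Longrightarrow> y' = y"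
      using fp(2) by blast
    have "norm (y - center) \<le> C * \<sigma>" using fp(3)[OF _ _ y] by (simp add: C_def mult_ac)
    then show ?thesis using y uniq fix_iff by blast
  qed
  have hol: "hol_family Y s \<rho>"
    if \<sigma>: "\<sigma> \<le> \<sigma>0" and adm: "\<forall>z\<in>ball s \<rho>. admissible \<sigma> (H z)"
      and pres: "\<forall>F m. hol_family F s \<rho> \<longrightarrow> m holomorphic_on ball s \<rho> \<longrightarrow> (\<forall>z\<in>ball s \<rho>. cmod (m z - \<Lambda>) \<le> 1) \<longrightarrow>
           hol_family (\<lambda>z. H z (m z) (F z)) s \<rho>"
      and Y: "\<forall>z\<in>ball s \<rho>. Y z \<in> cball center r \<and> solves (H z) (Y z)" for \<sigma> s \<rho> H Y
  proof (rule hol_family_fixpoint[where ?x0.0 = center and r = r and \<Psi> = "\<lambda>z. \<Psi> (H z)"])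
    fix z x assume z: "z \<in> ball s \<rho>" and x: "x \<in> cball center r"
    have a: "admissible \<sigma> (H z)" using adm z by blast
    show "\<Psi> (H z) x \<in> cball center r"
      using cball_contraction_fixpoint(1)[of r center "\<Psi> (H z)", OF less_imp_le[OF r(1)] contr[OF a \<sigma>] start[OF a] half[OF a \<sigma>]] x
      by blast
  next
    fix z x y assume "z \<in> ball s \<rho>" "x \<in> cball center r" "y \<in> cball center r"
    then show "norm (\<Psi> (H z) x - \<Psi> (H z) y) \<le> norm (x - y) / 2" using contr[OF _ \<sigma>] adm by blast
  next
    fix F assume F: "hol_family F s \<rho>" and Fr: "\<And>z. z \<in> ball s \<rho> \<Longrightarrow> F z \<in> cball center r"
    have "hol_family (\<lambda>z. fill (F z)) s \<rho>"
      unfolding fill_def by (intro hol_family_add hol_family_const hol_family_bclin[OF F bclin_drop_coord])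
    moreover have "(\<lambda>z. \<Lambda> + coord (F z) i0) holomorphic_on ball s \<rho>"
      using F by (auto simp: hol_family_def intro!: holomorphic_intros)
    moreover have "cmod (\<Lambda> + coord (F z) i0 - \<Lambda>) \<le> 1" if "z \<in> ball s \<rho>" for z
    proof -
      have "norm (F z - center) \<le> r" using Fr[OF that] by (simp add: dist_norm norm_minus_commute)
      then show ?thesis using small[of "F z"] r by simp
    qed
    ultimately have "hol_family (\<lambda>z. H z (\<Lambda> + coord (F z) i0) (fill (F z))) s \<rho>"
      using pres[rule_format, of "\<lambda>z. fill (F z)" "\<lambda>z. \<Lambda> + coord (F z) i0"] by blast
    then show "hol_family (\<lambda>z. \<Psi> (H z) (F z)) s \<rho>"
      unfolding \<Psi>_def by (intro hol_family_diff[OF F] hol_family_bclin[OF _ Q])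
  next
    show "0 \<le> r" using r by simp
    show "Y z \<in> cball center r \<and> \<Psi> (H z) (Y z) = Y z" if "z \<in> ball s \<rho>" for z
      using Y that fix_iff by blast
  qed
  have ex': "\<forall>\<sigma> H. \<sigma> \<le> \<sigma>0 \<longrightarrow> admissible \<sigma> H \<longrightarrow>
        (\<exists>y. y \<in> cball center r \<and> norm (y - center) \<le> C * \<sigma> \<and> solves H y \<and>
           (\<forall>y'\<in>cball center r. solves H y' \<longrightarrow> y' = y))"
    by (intro allI impI) (rule ex)
  have hol': "\<forall>\<sigma> s \<rho> H Y. \<sigma> \<le> \<sigma>0 \<longrightarrow> (\<forall>z\<in>ball s \<rho>. admissible \<sigma> (H z)) \<longrightarrow>
        (\<forall>F m. hol_family F s \<rho> \<longrightarrow> m holomorphic_on ball s \<rho> \<longrightarrow> (\<forall>z\<in>ball s \<rho>. cmod (m z - \<Lambda>) \<le> 1) \<longrightarrow>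
           hol_family (\<lambda>z. H z (m z) (F z)) s \<rho>) \<longrightarrow>
        (\<forall>z\<in>ball s \<rho>. Y z \<in> cball center r \<and> solves (H z) (Y z)) \<longrightarrow> hol_family Y s \<rho>"
  proof (rule allI, rule allI, rule allI, rule allI, rule allI, rule impI, rule impI, rule impI, rule impI)
    fix \<sigma> s \<rho> H Y
    assume "\<sigma> \<le> \<sigma>0" "\<forall>z\<in>ball s \<rho>. admissible \<sigma> (H z)"
      "\<forall>F m. hol_family F s \<rho> \<longrightarrow> m holomorphic_on ball s \<rho> \<longrightarrow> (\<forall>z\<in>ball s \<rho>. cmod (m z - \<Lambda>) \<le> 1) \<longrightarrow>
           hol_family (\<lambda>z. H z (m z) (F z)) s \<rho>"
      "\<forall>z\<in>ball s \<rho>. Y z \<in> cball center r \<and> solves (H z) (Y z)"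
    then show "hol_family Y s \<rho>" by (rule hol)
  qed
  show ?thesis
    by (rule exI[of _ r], rule exI[of _ \<sigma>0], rule exI[of _ C]) (intro conjI r(1) r(2) \<sigma>0(1) C ex' hol')
qed

end

section \<open>The limit problem and the dNLS operator\<close>

lemma laplacian_add: "laplacian (\<lambda>n. u n + v n) n = laplacian u n + laplacian v n"
  by (simp add: laplacian_def sum.distrib[symmetric] algebra_simps)

lemma laplacian_cmult: "laplacian (\<lambda>n. c * u n) n = c * laplacian u n" for c :: complex
  by (simp add: laplacian_def sum_distrib_left algebra_simps)

text \<open>Chebyshev's inequality. It provides the finite set of sites at which the potential will
  be cut off.\<close>

lemma finite_l2_large:
  fixes u :: "'n \<Rightarrow> 'v::real_normed_vector"
  assumes "u \<in> l2" "0 < \<eta>"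
  shows "finite {n. \<eta> < norm (u n)}"
proof (rule ccontr)
  assume "infinite {n. \<eta> < norm (u n)}"
  obtain k :: nat where k: "(l2_norm u / \<eta>)\<^sup>2 < real k" using reals_Archimedean2 by blast
  obtain F where F: "F \<subseteq> {n. \<eta> < norm (u n)}" "finite F" "card F = k"
    using infinite_arbitrarily_large[OF \<open>infinite _\<close>] by blast
  have "real k * \<eta>\<^sup>2 = (\<Sum>n\<in>F. \<eta>\<^sup>2)" by (simp add: F)
  also have "\<dots> \<le> (\<Sum>n\<in>F. (norm (u n))\<^sup>2)"
    using F(1) assms(2) by (intro sum_mono power_mono) auto
  also have "\<dots> = (L2_set (\<lambda>n. norm (u n)) F)\<^sup>2" by (simp add: L2_set_def sum_nonneg)
  also have "\<dots> \<le> (l2_norm u)\<^sup>2" by (intro power_mono L2_set_le_l2_norm assms) simp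
  finally show False using k assms(2) by (simp add: power_divide field_simps)
qed

text \<open>\<open>gam p\<close> is the binomial coefficient of 2 p + 1 over p. The identities
  convert the coefficients in the expansion of (e^(i t) + e^(-i t))^(2 p) that link the modes 1 and
  -1.\<close>

lemma gam_binomial:
  assumes "p \<ge> 1"
  shows "real (2 * p + 1) * real ((2 * p) choose p) = (1 + real p) * gam p"
    and "real (2 * p + 1) * real ((2 * p) choose (p - 1)) = real p * gam p"
    and "(2 * p) choose (p + 1) = (2 * p) choose (p - 1)"
proof -
  have s: "fact (2 * p + 1) = real (2 * p + 1) * fact (2 * p)" by simp
  have sp: "fact (p + 1) = real (p + 1) * fact p" by simp
  have pp: "fact p = real p * fact (p - 1)" using assms by (simp add: fact_reduce)
  have "real ((2 * p) choose p) = fact (2 * p) / (fact p * fact (2 * p - p))"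
    by (rule binomial_fact) simp
  moreover have "2 * p - p = p" by simp
  ultimately have 1: "real ((2 * p) choose p) = fact (2 * p) / (fact p * fact p)" by simp
  show "real (2 * p + 1) * real ((2 * p) choose p) = (1 + real p) * gam p"
  proof -
    have "c * (F / (f * f)) = q * (c * F / (f * (q * f)))" if "f \<noteq> 0" "q \<noteq> 0" for c F f q :: real
      using that by (simp add: field_simps)
    from this[of "fact p" "real (p + 1)"] show ?thesis unfolding gam_def 1 s sp by simp
  qed
  have "real ((2 * p) choose (p - 1)) = fact (2 * p) / (fact (p - 1) * fact (2 * p - (p - 1)))"
    by (rule binomial_fact) simp
  moreover have "2 * p - (p - 1) = p + 1" using assms by simp
  ultimately have 2: "real ((2 * p) choose (p - 1)) = fact (2 * p) / (fact (p - 1) * fact (p + 1))" by simp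
  show "real (2 * p + 1) * real ((2 * p) choose (p - 1)) = real p * gam p"
  proof -
    have "c * (F / (f * g)) = q * (c * F / ((q * f) * g))" if "q \<noteq> 0" for c F f g q :: real
      using that by (simp add: field_simps)
    from this[of "real p"] show ?thesis unfolding gam_def 2 s pp using assms by simp
  qed
  have "(2 * p) choose (p + 1) = (2 * p) choose (2 * p - (p + 1))" using assms by (intro binomial_symmetric) simp
  moreover have "2 * p - (p + 1) = p - 1" using assms by simp
  ultimately show "(2 * p) choose (p + 1) = (2 * p) choose (p - 1)" by simp
qed

section \<open>Powers of the limit convolution and the dNLS operator\<close>

context kg_data
begin

lemma coord_conv_A0:
  "coord (conv A0 x) (m, n) = of_real (\<A> n) * (coord x (m - 1, n) + coord x (m + 1, n))"
proof -
  have "((\<lambda>k. A0 k n * coord x (m - k, n)) has_sum (\<Sum>k\<in>{1, -1}. A0 k n * coord x (m - k, n))) UNIV"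
    by (rule has_sum_finite_neutralI[of "{1, -1}"]) (auto simp: A0_def)
  from has_sum_unique[OF has_sum_coord_conv[OF dominated_A0, of n x m] this]
  show ?thesis by (simp add: A0_def algebra_simps)
qed

text \<open>At each site, convolution with \<open>A0\<close> is a number times the sum of the two
  opposite mode shifts. These commute, so the binomial theorem holds; the induction is Pascal's
  rule.\<close>

lemma coord_conv_A0_power:
  "coord ((conv A0 ^^ N) x) (m, n)
    = of_real (\<A> n ^ N) * (\<Sum>j\<le>N. of_nat (N choose j) * coord x (m - int N + 2 * int j, n))"
proof (induction N arbitrary: m)
  case (Suc N)
  define f where "f j = coord x (m - int (Suc N) + 2 * int j, n)" for j
  have s1: "(\<Sum>j\<le>N. of_nat (N choose j) * coord x (m - 1 - int N + 2 * int j, n)) = (\<Sum>j\<le>N. of_nat (N choose j) * f j)"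
    by (simp add: f_def algebra_simps)
  have s2: "(\<Sum>j\<le>N. of_nat (N choose j) * coord x (m + 1 - int N + 2 * int j, n)) = (\<Sum>j\<le>N. of_nat (N choose j) * f (Suc j))"
    by (simp add: f_def algebra_simps)
  have "(\<Sum>j\<le>Suc N. of_nat (Suc N choose j) * f j)
      = f 0 + (\<Sum>j\<le>N. of_nat (Suc N choose Suc j) * f (Suc j))"
    by (simp only: sum.atMost_Suc_shift) simp
  also have "\<dots> = (f 0 + (\<Sum>j\<le>N. of_nat (N choose Suc j) * f (Suc j))) + (\<Sum>j\<le>N. of_nat (N choose j) * f (Suc j))"
    by (simp add: sum.distrib[symmetric] algebra_simps)
  also have "f 0 + (\<Sum>j\<le>N. of_nat (N choose Suc j) * f (Suc j)) = (\<Sum>j\<le>Suc N. of_nat (N choose j) * f j)"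
    by (simp only: sum.atMost_Suc_shift) simp
  also have "\<dots> = (\<Sum>j\<le>N. of_nat (N choose j) * f j)" by simp
  finally show ?case
    by (simp add: coord_conv_A0 Suc s1 s2 f_def algebra_simps)
qed simp

definition pot :: "int ^ 'd \<Rightarrow> complex" where "pot n = of_real (gam p * \<A> n ^ (2 * p))"

text \<open>Of the binomial sum only two terms reach a mode 1 or -1. The matrix with rows (p+1, p)
  and (p, p+1) acts as 2 p + 1 on the even combination and as 1 on the odd one: the two potentials
  of the dNLS operator.\<close>

lemma coord_conv_A0_modes:
  assumes p: "p \<ge> 1" and x: "\<And>m. \<bar>m\<bar> \<noteq> 1 \<Longrightarrow> coord x (m, n) = 0"
  shows "of_nat (2 * p + 1) * coord ((conv A0 ^^ (2 * p)) x) (1, n)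
      = pot n * (of_nat (p + 1) * coord x (1, n) + of_nat p * coord x (-1, n))"
    and "of_nat (2 * p + 1) * coord ((conv A0 ^^ (2 * p)) x) (-1, n)
      = pot n * (of_nat (p + 1) * coord x (-1, n) + of_nat p * coord x (1, n))"
proof -
  have b1: "of_nat (2 * p + 1) * of_nat ((2 * p) choose p) = of_nat (p + 1) * complex_of_real (gam p)"
    using arg_cong[OF gam_binomial(1)[OF p], of complex_of_real] by simp
  have b2: "of_nat (2 * p + 1) * of_nat ((2 * p) choose (p - 1)) = of_nat p * complex_of_real (gam p)"
    using arg_cong[OF gam_binomial(2)[OF p], of complex_of_real] by simp
  have "(\<Sum>j\<le>2 * p. of_nat ((2 * p) choose j) * coord x (1 - int (2 * p) + 2 * int j, n))
      = (\<Sum>j\<in>{p - 1, p}. of_nat ((2 * p) choose j) * coord x (1 - int (2 * p) + 2 * int j, n))"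
  proof (rule sum.mono_neutral_right)
    show "\<forall>i\<in>{..2 * p} - {p - 1, p}. of_nat ((2 * p) choose i) * coord x (1 - int (2 * p) + 2 * int i, n) = 0"
    proof
      fix i assume i: "i \<in> {..2 * p} - {p - 1, p}"
      have "\<bar>1 - int (2 * p) + 2 * int i\<bar> \<noteq> 1"
      proof
        assume "\<bar>1 - int (2 * p) + 2 * int i\<bar> = 1"
        then have "i = p \<or> i + 1 = p" by linarith
        then show False using i by auto
      qed
      then show "of_nat ((2 * p) choose i) * coord x (1 - int (2 * p) + 2 * int i, n) = 0" using x by simp
    qed
  qed (use p in auto)
  also have "\<dots> = of_nat ((2 * p) choose (p - 1)) * coord x (-1, n) + of_nat ((2 * p) choose p) * coord x (1, n)"
  proof -
    have "1 - int (2 * p) + 2 * int (p - 1) = -1" "1 - int (2 * p) + 2 * int p = 1" "p - 1 \<noteq> p" using p by auto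
    then show ?thesis by simp
  qed
  finally have "of_nat (2 * p + 1) * coord ((conv A0 ^^ (2 * p)) x) (1, n)
      = of_real (\<A> n ^ (2 * p)) * ((of_nat (2 * p + 1) * of_nat ((2 * p) choose (p - 1))) * coord x (-1, n)
         + (of_nat (2 * p + 1) * of_nat ((2 * p) choose p)) * coord x (1, n))"
    unfolding coord_conv_A0_power by (simp add: algebra_simps)
  then show "of_nat (2 * p + 1) * coord ((conv A0 ^^ (2 * p)) x) (1, n)
      = pot n * (of_nat (p + 1) * coord x (1, n) + of_nat p * coord x (-1, n))"
    unfolding b1 b2 pot_def by (simp add: algebra_simps)
  have "(\<Sum>j\<le>2 * p. of_nat ((2 * p) choose j) * coord x (-1 - int (2 * p) + 2 * int j, n))
      = (\<Sum>j\<in>{p, p + 1}. of_nat ((2 * p) choose j) * coord x (-1 - int (2 * p) + 2 * int j, n))"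
  proof (rule sum.mono_neutral_right)
    show "\<forall>i\<in>{..2 * p} - {p, p + 1}. of_nat ((2 * p) choose i) * coord x (-1 - int (2 * p) + 2 * int i, n) = 0"
    proof
      fix i assume i: "i \<in> {..2 * p} - {p, p + 1}"
      have "\<bar>-1 - int (2 * p) + 2 * int i\<bar> \<noteq> 1"
      proof
        assume "\<bar>-1 - int (2 * p) + 2 * int i\<bar> = 1"
        then have "i = p \<or> i = p + 1" by linarith
        then show False using i by auto
      qed
      then show "of_nat ((2 * p) choose i) * coord x (-1 - int (2 * p) + 2 * int i, n) = 0" using x by simp
    qed
  qed (use p in auto)
  also have "\<dots> = of_nat ((2 * p) choose p) * coord x (-1, n) + of_nat ((2 * p) choose (p - 1)) * coord x (1, n)"
    unfolding gam_binomial(3)[OF p, symmetric] by simp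
  finally have "of_nat (2 * p + 1) * coord ((conv A0 ^^ (2 * p)) x) (-1, n)
      = of_real (\<A> n ^ (2 * p)) * ((of_nat (2 * p + 1) * of_nat ((2 * p) choose p)) * coord x (-1, n)
         + (of_nat (2 * p + 1) * of_nat ((2 * p) choose (p - 1))) * coord x (1, n))"
    unfolding coord_conv_A0_power by (simp add: algebra_simps)
  then show "of_nat (2 * p + 1) * coord ((conv A0 ^^ (2 * p)) x) (-1, n)
      = pot n * (of_nat (p + 1) * coord x (-1, n) + of_nat p * coord x (1, n))"
    unfolding b1 b2 pot_def by (simp add: algebra_simps)
qed

definition G0 :: "(int \<times> (int ^ 'd)) ell2 \<Rightarrow> (int \<times> (int ^ 'd)) ell2" where
  "G0 = kg_op p \<Omega> A0 0 1 \<Lambda>"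

lemma near_limit: "near 0 0 1 A0"
  unfolding near_def by (auto intro!: exI[of _ "\<lambda>_. 0"] simp: dominated_def)

lemma bclin_G0: "bclin G0"
  unfolding G0_def using bclin_kg_op[OF near_limit] \<sigma>1 by simp

lemma coord_G0:
  "coord (G0 x) (m, n) = (if \<bar>m\<bar> = 1
     then (of_real \<Omega> + 2 * \<i> * of_int m * \<Lambda>) * coord x (m, n)
       + (of_nat (2 * p + 1) * coord ((conv A0 ^^ (2 * p)) x) (m, n) - laplacian (\<lambda>k. coord x (m, k)) n)
     else coord x (m, n))"
proof -
  have s: "0 \<le> \<sigma>1" using \<sigma>1 by simp
  have l: "cmod (\<Lambda> - \<Lambda>) \<le> 1" by simp
  show ?thesis
    unfolding G0_def kg_op_def coord_add diag(1)[OF res_symbol_bound[OF near_limit s l]]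
      diag(1)[OF cpl_symbol_le_2[OF near_limit s l]]
    by (simp add: res_symbol_def cpl_symbol_def op_T_def coord_lap)
qed

text \<open>The substitution is x(1) = u + i v, x(-1) = u - i v. The opposite signs of 2 i m
  \<Lambda> in the two modes then turn into one spectral shift by 2 \<Lambda> of the dNLS
  operator.\<close>

lemma coord_G0_modes:
  assumes p: "p \<ge> 1" and x: "\<And>m n. \<bar>m\<bar> \<noteq> 1 \<Longrightarrow> coord x (m, n) = 0"
    and u: "u = (\<lambda>n. (coord x (1, n) + coord x (-1, n)) / 2)"
    and v: "v = (\<lambda>n. (coord x (1, n) - coord x (-1, n)) / (2 * \<i>))"
    and S: "S = shift_op (dnls_op p \<Omega> \<A>) (2 * \<Lambda>) (u, v)"
  shows "coord (G0 x) (1, n) = snd S n - \<i> * fst S n" and "coord (G0 x) (-1, n) = snd S n + \<i> * fst S n"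
proof -
  have c1: "coord x (1, n) = u n + \<i> * v n" and c2: "coord x (-1, n) = u n + (-\<i>) * v n" for n
    by (auto simp: u v field_simps)
  have f: "fst S n = - (of_real \<Omega> * v n - laplacian v n + pot n * v n) - 2 * \<Lambda> * u n"
    and s: "snd S n = of_real \<Omega> * u n - laplacian u n + (1 + 2 * of_nat p) * pot n * u n - 2 * \<Lambda> * v n"
    by (auto simp: S shift_op_def dnls_op_def pot_def algebra_simps)
  have l1: "laplacian (\<lambda>k. coord x (1, k)) n = laplacian u n + \<i> * laplacian v n"
    unfolding c1 laplacian_add laplacian_cmult ..
  have l2: "laplacian (\<lambda>k. coord x (-1, k)) n = laplacian u n + (-\<i>) * laplacian v n"
    unfolding c2 laplacian_add laplacian_cmult ..
  have g1: "coord (G0 x) (1, n) = (of_real \<Omega> + 2 * \<i> * \<Lambda>) * coord x (1, n)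
      + (of_nat (2 * p + 1) * coord ((conv A0 ^^ (2 * p)) x) (1, n) - laplacian (\<lambda>k. coord x (1, k)) n)"
    unfolding coord_G0 by simp
  have g2: "coord (G0 x) (-1, n) = (of_real \<Omega> - 2 * \<i> * \<Lambda>) * coord x (-1, n)
      + (of_nat (2 * p + 1) * coord ((conv A0 ^^ (2 * p)) x) (-1, n) - laplacian (\<lambda>k. coord x (-1, k)) n)"
    unfolding coord_G0 by simp
  have m1: "of_nat (2 * p + 1) * coord ((conv A0 ^^ (2 * p)) x) (1, n)
      = pot n * (of_nat (p + 1) * coord x (1, n) + of_nat p * coord x (-1, n))"
    by (rule coord_conv_A0_modes(1)[OF p]) (rule x)
  have m2: "of_nat (2 * p + 1) * coord ((conv A0 ^^ (2 * p)) x) (-1, n)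
      = pot n * (of_nat (p + 1) * coord x (-1, n) + of_nat p * coord x (1, n))"
    by (rule coord_conv_A0_modes(2)[OF p]) (rule x)
  show "coord (G0 x) (1, n) = snd S n - \<i> * fst S n"
    unfolding g1 m1 l1 unfolding f s c1 c2 by (simp add: algebra_simps)
  show "coord (G0 x) (-1, n) = snd S n + \<i> * fst S n"
    unfolding g2 m2 l2 unfolding f s c1 c2 by (simp add: algebra_simps)
qed

text \<open>Cutting the potential off to a finite set of sites splits the limit operator into a small
  perturbation of a multiple of the identity and a finite rank operator: the neighbour sum has norm
  at most \<open>2 d\<close>, and \<open>\<bar>\<Omega> \<plusminus> 2 i \<Lambda> + 2 d\<bar> > 2 d\<close> off the continuous spectrum.\<close>

lemma G0_decomposition:
  assumes p: "p \<ge> 1" and Re: "Re \<Lambda> = 0" and cont: "2 * \<Lambda> \<notin> continuous_spectrum_dnls CARD('d) \<Omega>"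
  shows "\<exists>M F. bclin M \<and> bcinv M \<and> finite_rank F \<and> (\<forall>x. G0 x = M x + F x)"
proof -
  \<comment> \<open>The diagonal left after splitting the Laplacian into the neighbour sum minus 2
    d. On the modes 1 and -1 it is real, as \<Lambda> is imaginary, and avoiding the continuous
    spectrum means that its modulus exceeds 2 d.\<close>
  define \<gamma> :: "int \<Rightarrow> complex" where
    "\<gamma> m = (if \<bar>m\<bar> = 1 then of_real \<Omega> + 2 * \<i> * of_int m * \<Lambda> + of_nat (2 * CARD('d)) else 1)" for m
  define \<theta> where "\<theta> = 2 * Im \<Lambda>"
  have L: "2 * \<Lambda> = \<i> * of_real \<theta>" using Re by (simp add: complex_eq_iff \<theta>_def)
  have nin: "\<theta> \<notin> {\<Omega>..\<Omega> + 4 * real CARD('d)}" "- \<theta> \<notin> {\<Omega>..\<Omega> + 4 * real CARD('d)}"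
    using cont imageI[of \<theta> _ "\<lambda>t. \<i> * of_real t"] imageI[of "- \<theta>" _ "\<lambda>t. - \<i> * of_real t"]
    unfolding continuous_spectrum_dnls_def L by auto
  have g1: "\<gamma> 1 = of_real (\<Omega> - \<theta> + 2 * real CARD('d))" "\<gamma> (-1) = of_real (\<Omega> + \<theta> + 2 * real CARD('d))"
    using L by (auto simp: \<gamma>_def complex_eq_iff \<theta>_def Re)
  define q where "q = min (cmod (\<gamma> 1)) (cmod (\<gamma> (-1)))"
  have q: "2 * real CARD('d) < q" using nin unfolding q_def g1 norm_of_real by auto
  have d0: "0 < real CARD('d)" by simp
  have q0: "0 < q" using q d0 by linarith
  have \<gamma>q: "q \<le> cmod (\<gamma> m)" if "\<bar>m\<bar> = 1" for m
  proof -
    have "m = 1 \<or> m = -1" using that by linarith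
    then show ?thesis by (auto simp: q_def)
  qed
  have \<gamma>nz: "\<gamma> m \<noteq> 0" for m using \<gamma>q[of m] q0 by (cases "\<bar>m\<bar> = 1") (auto simp: \<gamma>_def)
  define cb where "cb = cmod (\<gamma> 1) + cmod (\<gamma> (-1)) + 1"
  have \<gamma>b: "cmod (\<gamma> m) \<le> cb" for m
  proof (cases "\<bar>m\<bar> = 1")
    case True
    then have "m = 1 \<or> m = -1" by linarith
    then show ?thesis by (auto simp: cb_def)
  qed (simp add: cb_def, simp add: \<gamma>_def)
  have \<gamma>i: "cmod (1 / \<gamma> m) \<le> 1 / q + 1" for m
  proof (cases "\<bar>m\<bar> = 1")
    case True
    then have "1 / cmod (\<gamma> m) \<le> 1 / q" using \<gamma>q[OF True] q0 \<gamma>nz[of m] by (intro divide_left_mono mult_pos_pos) auto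
    then show ?thesis by (simp add: norm_divide)
  qed (use q0 in \<open>simp add: \<gamma>_def\<close>)
  have inv\<gamma>: "bcinv (diag \<gamma> :: (int \<times> (int ^ 'd)) ell2 \<Rightarrow> _)"
    unfolding bcinv_def
    by (intro exI[of _ "diag (\<lambda>m. 1 / \<gamma> m)"] conjI allI diag(3)[OF \<gamma>i] ell2_eqI; clarify?)
       (auto simp: diag(1)[OF \<gamma>i] diag(1)[OF \<gamma>b] \<gamma>nz)
  define ca where "ca = real (2 * p + 1) * (2 * a0 ^ (2 * p - 1))"
  have ca: "0 < ca" using a0 by (auto simp: ca_def)
  \<comment> \<open>With this threshold \<open>ca * \<eta>\<close> is half the gap q - 2 d, so the
    neighbour sum and the truncated potential together stay below q.\<close>
  define \<eta> where "\<eta> = (q - 2 * real CARD('d)) / (2 * ca)"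
  have \<eta>: "0 < \<eta>" using q ca by (simp add: \<eta>_def)
  define S where "S = {n. \<eta> < \<bar>\<A> n\<bar>}"
  have S: "finite S" using finite_l2_large[OF A_l2 \<eta>] by (simp add: S_def)
  define At where "At m n = (if n \<in> S then 0 else A0 m n)" for m n
  define gt where "gt m = (if \<bar>m\<bar> = 1 then \<eta> else 0)" for m :: int
  have gt: "(gt has_sum 2 * \<eta>) UNIV"
  proof (rule has_sum_finite_neutralI[of "{-1, 1}"])
    show "2 * \<eta> = sum gt {-1, 1}" by (simp add: gt_def)
  qed (auto simp: gt_def)
  have At: "dominated At gt"
    unfolding dominated_def using has_sum_imp_summable[OF gt] \<eta> by (auto simp: At_def A0_def gt_def S_def)
  have At_n: "norm (conv At x) \<le> 2 * \<eta> * norm x" for x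
    using norm_conv[OF At, of x] by (simp add: infsumI[OF gt])
  \<comment> \<open>Truncating one of the 2 p factors suffices: convolution acts site by site, so
    \<open>W\<close> is the full power with the sites of \<open>S\<close> erased.\<close>
  define W where "W = (\<lambda>x :: (int \<times> (int ^ 'd)) ell2. conv At ((conv A0 ^^ (2 * p - 1)) x))"
  have W: "bclin W" unfolding W_def by (intro bclin_compose[OF bclin_conv[OF At]] bclin_funpow bclin_conv[OF dominated_A0])
  have W_n: "norm (W x) \<le> 2 * \<eta> * (a0 ^ (2 * p - 1) * norm x)" for x
  proof -
    have c: "norm (conv A0 y) \<le> a0 * norm y" for y
      by (rule order_trans[OF norm_conv[OF dominated_A0]], rule mult_right_mono) (auto simp: infsum_g0 a0_def)
    have "norm ((conv A0 ^^ (2 * p - 1)) x) \<le> a0 ^ (2 * p - 1) * norm x"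
      using funpow_diff_bound(1)[of "conv A0" a0 "conv A0" 0] c bclin_conv[OF dominated_A0] a0 by simp
    then show ?thesis unfolding W_def using \<eta> by (intro order_trans[OF At_n] mult_left_mono) auto
  qed
  have W_c: "coord (W x) (m, n) = (if n \<in> S then 0 else coord ((conv A0 ^^ (2 * p)) x) (m, n))" for x m n
  proof -
    have "2 * p = Suc (2 * p - 1)" using p by simp
    then have e: "(conv A0 ^^ (2 * p)) x = conv A0 ((conv A0 ^^ (2 * p - 1)) x)" by (metis funpow.simps(2) o_apply)
    note hs = has_sum_coord_conv[OF At, of n "(conv A0 ^^ (2 * p - 1)) x" m]
    show ?thesis
    proof (cases "n \<in> S")
      case True
      then show ?thesis using has_sum_unique[OF hs, of 0] by (simp add: At_def W_def)
    next
      case False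
      then show ?thesis
        using has_sum_unique[OF hs, of "coord (conv A0 ((conv A0 ^^ (2 * p - 1)) x)) (m, n)"]
          has_sum_coord_conv[OF dominated_A0, of n "(conv A0 ^^ (2 * p - 1)) x" m]
        unfolding e by (simp add: At_def W_def)
    qed
  qed
  \<comment> \<open>Zero off the modes 1 and -1, where \<open>G0\<close> is already the identity and
    \<open>R\<close> has to vanish.\<close>
  define \<rho> where "\<rho> m = (if \<bar>m\<bar> = 1 then 1 / \<gamma> m else 0)" for m
  have \<rho>: "cmod (\<rho> m) \<le> 1 / q" for m
  proof (cases "\<bar>m\<bar> = 1")
    case True
    then have "1 / cmod (\<gamma> m) \<le> 1 / q" using \<gamma>q[OF True] q0 \<gamma>nz[of m] by (intro divide_left_mono mult_pos_pos) auto
    then show ?thesis using True by (simp add: norm_divide \<rho>_def)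
  qed (use q0 in \<open>simp add: \<rho>_def\<close>)
  define R where "R = (\<lambda>x. diag \<rho> (nbr x - of_nat (2 * p + 1) *c W x))"
  have R: "bclin R"
    unfolding R_def by (intro bclin_compose[OF diag(3)[OF \<rho>]] bclin_sub bclin_nbr bclin_compose[OF bclin_cscale_const W])
  \<comment> \<open>The midpoint between 2 d / q and 1.\<close>
  define k where "k = (2 * real CARD('d) + (q - 2 * real CARD('d)) / 2) / q"
  have k: "0 \<le> k" "k < 1" using q q0 d0 by (auto simp: k_def field_simps)
  have R_n: "norm (R x) \<le> k * norm x" for x
  proof -
    have "norm (R x) \<le> 1 / q * norm (nbr x - of_nat (2 * p + 1) *c W x)" unfolding R_def by (rule diag(2)[OF \<rho>])
    also have "\<dots> \<le> 1 / q * (2 * real CARD('d) * norm x + real (2 * p + 1) * (2 * \<eta> * (a0 ^ (2 * p - 1) * norm x)))"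
    proof (rule mult_left_mono)
      have "norm (of_nat (2 * p + 1) *c W x) \<le> real (2 * p + 1) * (2 * \<eta> * (a0 ^ (2 * p - 1) * norm x))"
        unfolding norm_cscale norm_of_nat by (intro mult_left_mono W_n) auto
      then show "norm (nbr x - of_nat (2 * p + 1) *c W x)
          \<le> 2 * real CARD('d) * norm x + real (2 * p + 1) * (2 * \<eta> * (a0 ^ (2 * p - 1) * norm x))"
        using norm_nbr[of x] norm_triangle_ineq4[of "nbr x" "of_nat (2 * p + 1) *c W x"] by linarith
    qed (use q0 in simp)
    also have "real (2 * p + 1) * (2 * \<eta> * (a0 ^ (2 * p - 1) * norm x)) = (ca * \<eta>) * norm x"
      by (simp add: ca_def)
    also have "ca * \<eta> = (q - 2 * real CARD('d)) / 2" using ca by (simp add: \<eta>_def)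
    finally show ?thesis by (simp add: k_def field_simps)
  qed
  \<comment> \<open>Restores the potential at the sites of \<open>S\<close> in the modes 1 and -1;
    the rank is finite because \<open>S\<close> is.\<close>
  define F where "F = (\<lambda>x :: (int \<times> (int ^ 'd)) ell2. \<Sum>i\<in>{1, -1} \<times> S.
      coord (of_nat (2 * p + 1) *c (conv A0 ^^ (2 * p)) x) i *c unit_vec i)"
  have F: "finite_rank F"
    unfolding F_def
    by (intro finite_rank_sum finite_rank_single bclin_compose[OF bclin_cscale_const] bclin_funpow bclin_conv[OF dominated_A0])
  have F_c: "coord (F x) (m, n) = (if \<bar>m\<bar> = 1 \<and> n \<in> S then of_nat (2 * p + 1) * coord ((conv A0 ^^ (2 * p)) x) (m, n) else 0)" for x m n
  proof -
    have "finite ({1, -1 :: int} \<times> S)" using S by simp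
    moreover have "(m, n) \<in> {1, -1} \<times> S \<longleftrightarrow> \<bar>m\<bar> = 1 \<and> n \<in> S" by auto
    ultimately show ?thesis
      unfolding F_def coord_sum coord_cscale coord_unit_vec by (simp add: if_distrib[of "\<lambda>t. _ * t"] cong: if_cong)
  qed
  have "G0 x = diag \<gamma> (x - R x) + F x" for x
  proof (rule ell2_eqI, clarify)
    fix m n
    define X where "X = coord ((conv A0 ^^ (2 * p)) x) (m, n)"
    have R_c: "coord (R x) (m, n) = \<rho> m * (coord (nbr x) (m, n) - of_nat (2 * p + 1) * coord (W x) (m, n))"
      unfolding R_def diag(1)[OF \<rho>] by simp
    have l: "laplacian (\<lambda>k. coord x (m, k)) n = coord (nbr x) (m, n) - of_nat (2 * CARD('d)) * coord x (m, n)"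
      unfolding coord_lap[symmetric] lap_def by simp
    show "coord (G0 x) (m, n) = coord (diag \<gamma> (x - R x) + F x) (m, n)"
    proof (cases "\<bar>m\<bar> = 1")
      case True
      have "\<gamma> m * coord (R x) (m, n) = coord (nbr x) (m, n) - of_nat (2 * p + 1) * coord (W x) (m, n)"
        using True \<gamma>nz[of m] unfolding R_c by (simp add: \<rho>_def)
      then show ?thesis
        using True unfolding coord_add diag(1)[OF \<gamma>b] coord_diff right_diff_distrib F_c W_c coord_G0 l
          X_def[symmetric]
        by (cases "n \<in> S") (simp_all add: \<gamma>_def algebra_simps)
    next
      case False
      then show ?thesis
        unfolding coord_add diag(1)[OF \<gamma>b] coord_diff R_c F_c coord_G0 by (simp add: \<gamma>_def \<rho>_def)
    qed
  qed
  moreover have "bclin (\<lambda>x. diag \<gamma> (x - R x))"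
    by (intro bclin_compose[OF diag(3)[OF \<gamma>b]] bclin_sub bclin_ident R)
  moreover have "bcinv (\<lambda>x. diag \<gamma> (x - R x))"
    by (rule bcinv_compose[OF inv\<gamma> bcinv_neumann[OF R R_n k]])
  ultimately show ?thesis using F by blast
qed

end

locale dnls_eigenvalue = kg_data p \<Omega> \<A> \<Lambda> for p \<Omega> and \<A> :: "int ^ 'd \<Rightarrow> real" and \<Lambda> +
  fixes bp bm :: "int ^ 'd \<Rightarrow> complex"
  assumes p: "p \<ge> 1" and Re_\<Lambda>: "Re \<Lambda> = 0"
    and eig: "eigenpair (dnls_op p \<Omega> \<A>) (2 * \<Lambda>) (bp, bm)"
    and simple: "simple_eigenvalue (dnls_op p \<Omega> \<A>) (2 * \<Lambda>)"
    and cont: "2 * \<Lambda> \<notin> continuous_spectrum_dnls CARD('d) \<Omega>"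
begin

lemma b_l2: "bp \<in> l2" "bm \<in> l2" and b_nonzero: "(bp, bm) \<noteq> zero_pair"
  and b_eq: "dnls_op p \<Omega> \<A> (bp, bm) = scale_pair (2 * \<Lambda>) (bp, bm)"
  using eig by (auto simp: eigenpair_def)

lemma shift_b: "shift_op (dnls_op p \<Omega> \<A>) (2 * \<Lambda>) (bp, bm) = zero_pair"
  unfolding shift_op_def b_eq by (simp add: scale_pair_def zero_pair_def)

text \<open>The generalized eigenspace is a line that contains the nonzero pair (bp, bm), which
  therefore spans it.\<close>

lemma generalized_eigenvector:
  assumes y: "y \<in> l2 \<times> l2" and k: "(shift_op (dnls_op p \<Omega> \<A>) (2 * \<Lambda>) ^^ k) y = zero_pair"
  shows "\<exists>c. y = scale_pair c (bp, bm)"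
proof -
  let ?S = "shift_op (dnls_op p \<Omega> \<A>) (2 * \<Lambda>)"
  obtain x where x: "{y \<in> l2 \<times> l2. \<exists>k. (?S ^^ k) y = zero_pair} = range (\<lambda>c. scale_pair c x)"
    using simple by (auto simp: simple_eigenvalue_def)
  have "(?S ^^ 1) (bp, bm) = zero_pair" using shift_b by simp
  then have "(bp, bm) \<in> {y \<in> l2 \<times> l2. \<exists>k. (?S ^^ k) y = zero_pair}" using b_l2 by blast
  then obtain a where a: "(bp, bm) = scale_pair a x" unfolding x by blast
  have "y \<in> {y \<in> l2 \<times> l2. \<exists>k. (?S ^^ k) y = zero_pair}" using y k by blast
  then obtain c where c: "y = scale_pair c x" unfolding x by blast
  have "a \<noteq> 0" using a b_nonzero by (auto simp: scale_pair_def zero_pair_def case_prod_unfold)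
  then have "y = scale_pair (c / a) (bp, bm)" unfolding a c by (simp add: scale_pair_def case_prod_unfold)
  then show ?thesis ..
qed

definition B0 :: "(int \<times> (int ^ 'd)) ell2" where
  "B0 = Ell2 (\<lambda>(m, n). if m = 1 then bp n + \<i> * bm n else if m = -1 then bp n - \<i> * bm n else 0)"

lemma coord_B0:
  "coord B0 (m, n) = (if m = 1 then bp n + \<i> * bm n else if m = -1 then bp n - \<i> * bm n else 0)"
proof -
  let ?U = "\<lambda>(m :: int) n. if m = 1 then bp n + \<i> * bm n else if m = -1 then bp n - \<i> * bm n else 0"
  have r: "(\<lambda>n. bp n + \<i> * bm n) \<in> l2" "(\<lambda>n. bp n + (-\<i>) * bm n) \<in> l2"
    by (intro l2_add l2_cmult b_l2)+
  have "?U m \<in> l2" for m :: int using r l2_zero by (cases "m = 1"; cases "m = -1") auto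
  moreover have "(\<lambda>m. (l2_norm (?U m))\<^sup>2) summable_on UNIV"
    by (rule finite_nonzero_values_imp_summable_on, rule finite_subset[of _ "{1, -1}"])
       (intro subsetI, rule ccontr, auto simp: l2_norm_def)
  ultimately have "(\<lambda>(m, n). ?U m n) \<in> l2"
    by (intro iffD2[OF l2_pair_iff(1)[of ?U]] conjI allI)
  then show ?thesis unfolding B0_def by (simp add: Ell2_inverse)
qed

lemma G0_B0: "G0 B0 = 0"
proof (rule ell2_eqI, clarify)
  fix m n
  have z: "\<And>m n. \<bar>m\<bar> \<noteq> 1 \<Longrightarrow> coord B0 (m, n) = 0" by (auto simp: coord_B0)
  have u: "bp = (\<lambda>n. (coord B0 (1, n) + coord B0 (-1, n)) / 2)"
    and v: "bm = (\<lambda>n. (coord B0 (1, n) - coord B0 (-1, n)) / (2 * \<i>))" by (auto simp: coord_B0)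
  have S: "zero_pair = shift_op (dnls_op p \<Omega> \<A>) (2 * \<Lambda>) (bp, bm)" by (rule shift_b[symmetric])
  show "coord (G0 B0) (m, n) = coord 0 (m, n)"
  proof (cases "\<bar>m\<bar> = 1")
    case True
    then have "m = 1 \<or> m = -1" by linarith
    then show ?thesis using coord_G0_modes[OF p z u v S, of n] by (auto simp: zero_pair_def)
  qed (simp add: coord_G0 z)
qed

lemma B0_nonzero: "\<exists>i. coord B0 i \<noteq> 0"
proof (rule ccontr)
  assume "\<nexists>i. coord B0 i \<noteq> 0"
  then have *: "coord B0 (1, n) = 0" "coord B0 (-1, n) = 0" for n by auto
  have "bp n = 0 \<and> bm n = 0" for n using *[of n] by (auto simp: coord_B0)
  then show False using b_nonzero by (auto simp: zero_pair_def)
qed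

lemma bclin_mode_op: "bclin (mode_op :: (int \<times> (int ^ 'd)) ell2 \<Rightarrow> _)"
  unfolding mode_op_def by (rule diag(3)[OF mode_symbol_bound])

lemma coord_mode_op: "coord (mode_op x) (m, n) = (if \<bar>m\<bar> = 1 then 2 * \<i> * of_int m else 0) * coord x (m, n)"
  unfolding mode_op_def by (rule diag(1)[OF mode_symbol_bound])

text \<open>A kernel element with parameter slot \<nu> gives a pair (u, v) that the shifted dNLS
  operator sends to 2 \<nu> times the eigenvector. It is thus annihilated by the square of that
  operator, and algebraic simplicity forces \<nu> = 0 and w to be a multiple of \<open>B0\<close>.
  The zero in the slot \<open>i0\<close> then kills w, as \<open>B0\<close> does not vanish
  there.\<close>

lemma linearization_inj:
  assumes i0: "coord B0 i0 \<noteq> 0" and eq: "G0 (drop_coord i0 x) + coord x i0 *c mode_op B0 = 0"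
  shows "x = 0"
proof -
  define w \<nu> where "w = drop_coord i0 x" and "\<nu> = coord x i0"
  have e: "coord (G0 w) (m, n) = - \<nu> * coord (mode_op B0) (m, n)" for m n
    using arg_cong[OF eq, of "\<lambda>t. coord t (m, n)"] by (simp add: w_def \<nu>_def eq_neg_iff_add_eq_0)
  \<comment> \<open>On these modes \<open>G0\<close> is the identity while \<open>mode_op\<close>
    vanishes, so the reduction to the dNLS pair loses nothing.\<close>
  have w0: "coord w (m, n) = 0" if "\<bar>m\<bar> \<noteq> 1" for m n
    using e[of m n] that by (simp add: coord_G0 coord_mode_op)
  define u where "u = (\<lambda>n. (coord w (1, n) + coord w (-1, n)) / 2)"
  define v where "v = (\<lambda>n. (coord w (1, n) - coord w (-1, n)) / (2 * \<i>))"
  define S where "S = shift_op (dnls_op p \<Omega> \<A>) (2 * \<Lambda>) (u, v)"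
  have S1: "snd S n - \<i> * fst S n = - \<nu> * (2 * \<i> * (bp n + \<i> * bm n))"
    and S2: "snd S n + \<i> * fst S n = - \<nu> * (- 2 * \<i> * (bp n - \<i> * bm n))" for n
    using coord_G0_modes[OF p w0 u_def v_def S_def, of n] e[of 1 n] e[of "-1" n]
    by (auto simp: coord_mode_op coord_B0)
  have "2 * snd S n = 2 * (2 * \<nu> * bm n)" for n
  proof -
    have "2 * snd S n = (snd S n - \<i> * fst S n) + (snd S n + \<i> * fst S n)" by simp
    then show ?thesis unfolding S1 S2 by (simp add: algebra_simps)
  qed
  moreover have "2 * \<i> * fst S n = 2 * \<i> * (2 * \<nu> * bp n)" for n
  proof -
    have "2 * \<i> * fst S n = (snd S n + \<i> * fst S n) - (snd S n - \<i> * fst S n)" by simp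
    then show ?thesis unfolding S1 S2 by (simp add: algebra_simps)
  qed
  ultimately have S: "S = scale_pair (2 * \<nu>) (bp, bm)" by (simp add: scale_pair_def prod_eq_iff fun_eq_iff)
  have row: "(\<lambda>n. coord w (m, n)) \<in> l2" for m
    using l2_pair_iff[of "\<lambda>m n. coord w (m, n)"] by (simp add: case_prod_unfold)
  have uv: "(u, v) \<in> l2 \<times> l2"
  proof -
    have eq: "u = (\<lambda>n. (1/2) * (coord w (1, n) + coord w (-1, n)))"
      "v = (\<lambda>n. (1 / (2 * \<i>)) * (coord w (1, n) + (-1) * coord w (-1, n)))"
      by (auto simp: u_def v_def)
    have "u \<in> l2" unfolding eq by (intro l2_cmult l2_add row)
    moreover have "v \<in> l2" unfolding eq by (intro l2_cmult l2_add row)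
    ultimately show ?thesis by blast
  qed
  have "shift_op (dnls_op p \<Omega> \<A>) (2 * \<Lambda>) (scale_pair (2 * \<nu>) (bp, bm)) = zero_pair"
  proof -
    have "dnls_op p \<Omega> \<A> (scale_pair c (bp, bm)) = scale_pair c (dnls_op p \<Omega> \<A> (bp, bm))" for c
      by (simp add: dnls_op_def scale_pair_def laplacian_cmult algebra_simps)
    then show ?thesis unfolding shift_op_def b_eq by (simp add: b_eq scale_pair_def zero_pair_def)
  qed
  then have "(shift_op (dnls_op p \<Omega> \<A>) (2 * \<Lambda>) ^^ 2) (u, v) = zero_pair"
    using S by (simp add: S_def numeral_2_eq_2)
  then obtain c where c: "(u, v) = scale_pair c (bp, bm)" using generalized_eigenvector[OF uv] by blast
  have "S = zero_pair"
  proof -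
    have "dnls_op p \<Omega> \<A> (scale_pair c (bp, bm)) = scale_pair c (dnls_op p \<Omega> \<A> (bp, bm))"
      by (simp add: dnls_op_def scale_pair_def laplacian_cmult algebra_simps)
    then show ?thesis unfolding S_def c shift_op_def b_eq by (simp add: b_eq scale_pair_def zero_pair_def)
  qed
  then have \<nu>: "\<nu> = 0" using S b_nonzero by (auto simp: scale_pair_def zero_pair_def fun_eq_iff)
  have "w = c *c B0"
  proof (rule ell2_eqI, clarify)
    fix m n
    have un: "u n = c * bp n" "v n = c * bm n" using c by (auto simp: scale_pair_def)
    have "coord w (1, n) = u n + \<i> * v n" "coord w (-1, n) = u n - \<i> * v n"
      by (auto simp: u_def v_def field_simps)
    then have w1: "coord w (1, n) = c * (bp n + \<i> * bm n)" "coord w (-1, n) = c * (bp n - \<i> * bm n)"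
      by (auto simp: un algebra_simps)
    show "coord w (m, n) = coord (c *c B0) (m, n)"
      using w0[of m n] w1 by (cases "m = 1"; cases "m = -1") (auto simp: coord_B0)
  qed
  moreover have "coord w i0 = 0" by (simp add: w_def)
  ultimately have "c = 0" using i0 by (metis coord_cscale mult_eq_0_iff)
  with \<open>w = c *c B0\<close> have "w = 0" by (auto intro: ell2_eqI)
  show "x = 0"
  proof (rule ell2_eqI)
    show "coord x i = coord 0 i" for i
      using \<open>w = 0\<close> \<nu> coord_drop_coord[of i0 x i] by (cases "i = i0") (auto simp: w_def \<nu>_def)
  qed
qed

text \<open>Replacing one coordinate by the parameter changes \<open>G0\<close> by a rank one
  operator only, so invertibility reduces to injectivity.\<close>

lemma linearization_bcinv:
  assumes i0: "coord B0 i0 \<noteq> 0"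
  shows "bcinv (\<lambda>x. G0 (drop_coord i0 x) + coord x i0 *c mode_op B0)"
proof -
  obtain M F where M: "bclin M" "bcinv M" and F: "finite_rank F" and dec: "\<And>x. G0 x = M x + F x"
    using G0_decomposition[OF p Re_\<Lambda> cont] by blast
  interpret G: bounded_linear G0 by (rule bclinD[OF bclin_G0])
  have eq: "G0 (drop_coord i0 x) + coord x i0 *c mode_op B0
      = M x + (F x + coord x i0 *c (mode_op B0 - G0 (unit_vec i0)))" for x
  proof -
    have "G0 (drop_coord i0 x) = G0 x - coord x i0 *c G0 (unit_vec i0)"
      unfolding drop_coord_def G.diff bclin_cscale[OF bclin_G0] ..
    then show ?thesis unfolding dec[of x] by (simp only:) (rule ell2_eqI, simp add: algebra_simps)
  qed
  have "finite_rank (\<lambda>x. F x + coord x i0 *c (mode_op B0 - G0 (unit_vec i0)))"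
    using finite_rank.add_rank1[OF F bclin_ident] by simp
  from bcinv_plus_finite_rank[OF M(2,1) this] show ?thesis
    unfolding eq[symmetric] using linearization_inj[OF i0] by blast
qed

end

section \<open>Fourier coefficients\<close>

text \<open>Fubini on the double series, reindexed by the bijection sending (m, k) to (k, m -
  k).\<close>

lemma discrete_convolution:
  fixes a b :: "int \<Rightarrow> complex"
  assumes a: "(\<lambda>k. norm (a k)) summable_on UNIV" and b: "(\<lambda>k. norm (b k)) summable_on UNIV"
  shows "(\<lambda>m. norm (\<Sum>\<^sub>\<infinity>k. a k * b (m - k))) summable_on UNIV"
    and "(\<Sum>\<^sub>\<infinity>m. \<Sum>\<^sub>\<infinity>k. a k * b (m - k)) = (\<Sum>\<^sub>\<infinity>k. a k) * (\<Sum>\<^sub>\<infinity>k. b k)"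
proof -
  let ?F = "\<lambda>(k, j). a k * b j" and ?G = "\<lambda>(m, k). a k * b (m - k)"
  have F: "(\<lambda>x. norm (?F x)) summable_on Sigma UNIV (\<lambda>_. UNIV)"
    unfolding Infinite_Sum.abs_summable_on_Sigma_iff
  proof (intro conjI ballI)
    show "(\<lambda>j. norm (?F (k, j))) summable_on UNIV" for k
      using b by (simp add: norm_mult summable_on_cmult_right)
    have "(\<Sum>\<^sub>\<infinity>j. norm (?F (k, j))) = norm (a k) * (\<Sum>\<^sub>\<infinity>j. norm (b j))" for k
      by (simp add: norm_mult infsum_cmult_right')
    then show "(\<lambda>k. norm (\<Sum>\<^sub>\<infinity>j. norm (?F (k, j)))) summable_on UNIV"
      using a by (simp add: infsum_nonneg abs_mult summable_on_cmult_left)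
  qed
  have bij: "bij_betw (\<lambda>(m, k). (k, m - k)) (Sigma UNIV (\<lambda>_. UNIV)) (Sigma UNIV (\<lambda>_. UNIV :: int set))"
    by (rule bij_betwI[where g = "\<lambda>(k, j). (k + j, k)"]) auto
  have GF: "?G x = ?F (case x of (m, k) \<Rightarrow> (k, m - k))" for x by (cases x) simp
  have G: "(\<lambda>x. norm (?G x)) summable_on Sigma UNIV (\<lambda>_. UNIV)"
    unfolding GF using summable_on_reindex_bij_betw[OF bij, of "\<lambda>x. norm (?F x)"] F by blast
  have Gs: "(\<lambda>k. norm (?G (m, k))) summable_on UNIV" and Gs2: "(\<lambda>m. norm (\<Sum>\<^sub>\<infinity>k. norm (?G (m, k)))) summable_on UNIV" for m
    using G unfolding Infinite_Sum.abs_summable_on_Sigma_iff by auto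
  show "(\<lambda>m. norm (\<Sum>\<^sub>\<infinity>k. a k * b (m - k))) summable_on UNIV"
  proof (rule Infinite_Sum.abs_summable_on_comparison_test[OF Gs2])
    fix m
    have "norm (\<Sum>\<^sub>\<infinity>k. a k * b (m - k)) \<le> (\<Sum>\<^sub>\<infinity>k. norm (a k * b (m - k)))"
      using Gs[of m] by (intro norm_infsum_bound) simp
    then show "norm (\<Sum>\<^sub>\<infinity>k. a k * b (m - k)) \<le> norm (\<Sum>\<^sub>\<infinity>k. norm (?G (m, k)))"
      by (simp add: infsum_nonneg)
  qed
  have "(\<Sum>\<^sub>\<infinity>m. \<Sum>\<^sub>\<infinity>k. a k * b (m - k)) = infsum ?G (Sigma UNIV (\<lambda>_. UNIV))"
    using infsum_Sigma'_banach[of "\<lambda>m k. a k * b (m - k)" UNIV "\<lambda>_. UNIV"] abs_summable_summable[OF G] by simp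
  also have "\<dots> = infsum ?F (Sigma UNIV (\<lambda>_. UNIV))"
    unfolding GF by (rule infsum_reindex_bij_betw[OF bij])
  also have "\<dots> = (\<Sum>\<^sub>\<infinity>k. \<Sum>\<^sub>\<infinity>j. a k * b j)"
    using infsum_Sigma'_banach[of "\<lambda>k j. a k * b j" UNIV "\<lambda>_. UNIV"] abs_summable_summable[OF F] by simp
  also have "\<dots> = (\<Sum>\<^sub>\<infinity>k. a k) * (\<Sum>\<^sub>\<infinity>k. b k)"
    by (simp add: infsum_cmult_right' infsum_cmult_left')
  finally show "(\<Sum>\<^sub>\<infinity>m. \<Sum>\<^sub>\<infinity>k. a k * b (m - k)) = (\<Sum>\<^sub>\<infinity>k. a k) * (\<Sum>\<^sub>\<infinity>k. b k)" .
qed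

text \<open>The exponential of m splits over k and m - k, so the product formula applies to the
  modulated coefficient sequences.\<close>

lemma fourier_conv:
  assumes A: "dominated A g" and x: "(\<lambda>m. norm (coord x (m, n))) summable_on UNIV"
  shows "(\<lambda>m. norm (coord (conv A x) (m, n))) summable_on UNIV"
    and "(\<Sum>\<^sub>\<infinity>m. coord (conv A x) (m, n) * cis (real_of_int m * \<tau>))
      = fourier_sum A \<tau> n * (\<Sum>\<^sub>\<infinity>m. coord x (m, n) * cis (real_of_int m * \<tau>))"
proof -
  have A': "(\<lambda>k. norm (A k n)) summable_on UNIV"
    by (rule Infinite_Sum.abs_summable_on_comparison_test'[where g = g]) (use A in \<open>auto simp: dominated_def\<close>)
  have c: "coord (conv A x) (m, n) = (\<Sum>\<^sub>\<infinity>k. A k n * coord x (m - k, n))" for m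
    by (rule infsumI[symmetric], rule has_sum_coord_conv[OF A])
  show "(\<lambda>m. norm (coord (conv A x) (m, n))) summable_on UNIV"
    unfolding c by (rule discrete_convolution(1)[OF A' x])
  have "coord (conv A x) (m, n) * cis (real_of_int m * \<tau>)
      = (\<Sum>\<^sub>\<infinity>k. (A k n * cis (real_of_int k * \<tau>)) * (coord x (m - k, n) * cis (real_of_int (m - k) * \<tau>)))" for m
  proof -
    have "cis (real_of_int m * \<tau>) = cis (real_of_int k * \<tau>) * cis (real_of_int (m - k) * \<tau>)" for k
      by (simp add: cis_mult algebra_simps)
    then have "A k n * coord x (m - k, n) * cis (real_of_int m * \<tau>)
        = (A k n * cis (real_of_int k * \<tau>)) * (coord x (m - k, n) * cis (real_of_int (m - k) * \<tau>))" for k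
      by (metis mult.assoc mult.left_commute)
    then show ?thesis unfolding c infsum_cmult_left'[symmetric] by (rule infsum_cong)
  qed
  then show "(\<Sum>\<^sub>\<infinity>m. coord (conv A x) (m, n) * cis (real_of_int m * \<tau>))
      = fourier_sum A \<tau> n * (\<Sum>\<^sub>\<infinity>m. coord x (m, n) * cis (real_of_int m * \<tau>))"
    unfolding fourier_sum_def
    using discrete_convolution(2)[of "\<lambda>k. A k n * cis (real_of_int k * \<tau>)" "\<lambda>m. coord x (m, n) * cis (real_of_int m * \<tau>)"] A' x
    by (simp add: norm_mult)
qed

lemma fourier_conv_power:
  assumes A: "dominated A g" and x: "(\<lambda>m. norm (coord x (m, n))) summable_on UNIV"
  shows "(\<lambda>m. norm (coord ((conv A ^^ k) x) (m, n))) summable_on UNIV \<and>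
    (\<Sum>\<^sub>\<infinity>m. coord ((conv A ^^ k) x) (m, n) * cis (real_of_int m * \<tau>))
      = fourier_sum A \<tau> n ^ k * (\<Sum>\<^sub>\<infinity>m. coord x (m, n) * cis (real_of_int m * \<tau>))"
proof (induction k)
  case (Suc k)
  then show ?case using fourier_conv[OF A, of "(conv A ^^ k) x" n] by simp
qed (use x in simp)

lemma has_integral_cis:
  "((\<lambda>\<tau>. cis (real_of_int k * \<tau>)) has_integral (if k = 0 then of_real (2 * pi) else 0)) {- pi..pi}"
proof (cases "k = 0")
  case True
  then show ?thesis using has_integral_const_real[of "1 :: complex" "- pi" pi] by (simp add: scaleR_conv_of_real)
next
  case False
  have "((\<lambda>\<tau>. cis (real_of_int k * \<tau>)) has_integral
      (cis (real_of_int k * pi) / (\<i> * of_int k) - cis (real_of_int k * (- pi)) / (\<i> * of_int k))) {- pi..pi}"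
  proof (rule fundamental_theorem_of_calculus)
    fix t :: real
    have "((\<lambda>t. exp (\<i> * of_int k * of_real t) / (\<i> * of_int k)) has_vector_derivative exp (\<i> * of_int k * of_real t))
        (at t within {- pi..pi})"
      using False by (auto intro!: derivative_eq_intros has_vector_derivative_real_field)
    then show "((\<lambda>t. cis (real_of_int k * t) / (\<i> * of_int k)) has_vector_derivative cis (real_of_int k * t))
        (at t within {- pi..pi})"
      by (simp add: cis_conv_exp mult_ac)
  qed simp
  moreover have "cis (real_of_int k * (- pi)) = cis (real_of_int k * pi)"
    using sin_npi_int[of k] by (simp add: complex_eq_iff mult.commute)
  ultimately show ?thesis using False by simp
qed

text \<open>Uniform convergence allows the limit over finite subsets to pass through the integral,
  and by orthogonality the integrals are constant as soon as the subset contains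
  \<open>j\<close>.\<close>

lemma fourier_coefficient:
  fixes c :: "int \<Rightarrow> complex"
  assumes c: "(\<lambda>k. norm (c k)) summable_on UNIV"
  shows "integral {- pi..pi} (\<lambda>\<tau>. (\<Sum>\<^sub>\<infinity>m. c m * cis (real_of_int m * \<tau>)) * cis (- (real_of_int j * \<tau>)))
    = of_real (2 * pi) * c j"
proof -
  let ?f = "\<lambda>m \<tau>. c m * cis (real_of_int (m - j) * \<tau>)"
  have eq: "(\<Sum>\<^sub>\<infinity>m. c m * cis (real_of_int m * \<tau>)) * cis (- (real_of_int j * \<tau>)) = (\<Sum>\<^sub>\<infinity>m. ?f m \<tau>)" for \<tau>
    unfolding infsum_cmult_left'[symmetric] by (rule infsum_cong) (simp add: cis_mult algebra_simps)
  have ul: "uniform_limit {- pi..pi} (\<lambda>X \<tau>. \<Sum>m\<in>X. ?f m \<tau>) (\<lambda>\<tau>. \<Sum>\<^sub>\<infinity>m. ?f m \<tau>) (finite_subsets_at_top UNIV)"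
    by (rule Weierstrass_m_test_general[OF _ c]) (simp add: norm_mult)
  have cont: "continuous_on {- pi..pi} (\<lambda>\<tau>. \<Sum>m\<in>X. ?f m \<tau>)" for X
    by (intro continuous_intros)
  obtain I J where I: "\<And>X. ((\<lambda>\<tau>. \<Sum>m\<in>X. ?f m \<tau>) has_integral I X) {- pi..pi}"
    and J: "((\<lambda>\<tau>. \<Sum>\<^sub>\<infinity>m. ?f m \<tau>) has_integral J) {- pi..pi}"
    and lim: "(I \<longlongrightarrow> J) (finite_subsets_at_top UNIV)"
    by (rule uniform_limit_integral[OF ul cont finite_subsets_at_top_neq_bot]) blast
  have IX: "I X = of_real (2 * pi) * c j" if X: "finite X" "j \<in> X" for X
  proof -
    have i1: "((\<lambda>\<tau>. \<Sum>m\<in>X. ?f m \<tau>) has_integral (\<Sum>m\<in>X. c m * (if m - j = 0 then of_real (2 * pi) else 0))) {- pi..pi}"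
      by (intro has_integral_sum X has_integral_mult_right has_integral_cis)
    have i2: "(\<Sum>m\<in>X. c m * (if m - j = 0 then of_real (2 * pi) else 0)) = of_real (2 * pi) * c j"
    proof -
      have "(\<Sum>m\<in>X. c m * (if m - j = 0 then of_real (2 * pi) else 0)) = (\<Sum>m\<in>X. if m = j then of_real (2 * pi) * c m else 0)"
        by (intro sum.cong) auto
      then show ?thesis using X by simp
    qed
    show ?thesis using has_integral_unique[OF I[of X] i1] unfolding i2 .
  qed
  have "\<forall>\<^sub>F X in finite_subsets_at_top UNIV. I X = of_real (2 * pi) * c j"
    unfolding eventually_finite_subsets_at_top by (intro exI[of _ "{j}"] conjI allI impI, simp, simp, rule IX, blast, blast)
  then have "(I \<longlongrightarrow> of_real (2 * pi) * c j) (finite_subsets_at_top UNIV)"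
    by (rule tendsto_eventually)
  then have "J = of_real (2 * pi) * c j" using lim by (rule tendsto_unique[OF finite_subsets_at_top_neq_bot, THEN sym])
  then show ?thesis unfolding eq using J by (simp add: integral_unique)
qed

text \<open>The plain inclusion of \<open>l22\<close> into l2, where the fixed point lives; it is
  not the inverse of the isometry \<open>unweight\<close>.\<close>

definition ell2_of :: "(int \<Rightarrow> 'n \<Rightarrow> complex) \<Rightarrow> (int \<times> 'n) ell2" where
  "ell2_of B = Ell2 (\<lambda>(m, n). B m n)"

lemma coord_ell2_of:
  assumes "B \<in> l22"
  shows "coord (ell2_of B) (m, n) = B m n"
proof -
  obtain x where x: "B = unweight x" using l22_imp_unweight[OF assms] by blast
  have "(\<lambda>(m, n). B m n) \<in> l2"
  proof (rule l2_scaled_bound(1)[OF coord_l2[of x] inj_on_id2, of 1])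
    fix i :: "int \<times> 'a"
    obtain m n where i: "i = (m, n)" by (cases i)
    have "cmod (coord x (m, n)) / wt m \<le> cmod (coord x (m, n)) / 1"
      using wt_ge_1[of m] by (intro divide_left_mono) auto
    then show "norm (case i of (m, n) \<Rightarrow> B m n) \<le> 1 * norm (coord x i)"
      by (simp add: i x unweight_def norm_divide)
  qed simp
  then show ?thesis by (simp add: ell2_of_def Ell2_inverse)
qed

lemma l22_dominated:
  assumes "B \<in> l22"
  shows "\<exists>M. dominated B (\<lambda>m. M * (1 / wt m)) \<and> 0 \<le> M"
proof -
  obtain x where x: "B = unweight x" using l22_imp_unweight[OF assms] by blast
  have "dominated B (\<lambda>m. norm x * (1 / wt m))"
    unfolding dominated_def using norm_unweight_le[of x] summable_on_cmult_right[OF summable_wt, of "norm x"]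
    by (simp add: x)
  then show ?thesis by (intro exI[of _ "norm x"]) simp
qed

text \<open>The integral is 2 \<pi> times a coefficient of the iterated convolution, and the
  prefactor 1 / (2 \<pi>) cancels it.\<close>

lemma kg_spectral_iff:
  assumes A: "A \<in> l22"
  shows "kg_spectral p \<Omega> \<epsilon> A lam B \<longleftrightarrow> B \<in> l22 \<and> B \<noteq> (\<lambda>m n. 0) \<and>
    (\<forall>m n. (1 + (lam + \<i> * of_int m * of_real (omega \<Omega> \<epsilon>))\<^sup>2) * B m n
      + of_real \<epsilon> * coord (op_T p A (ell2_of B)) (m, n) = 0)"
proof (cases "B \<in> l22")
  case True
  obtain M where M: "dominated A (\<lambda>m. M * (1 / wt m))" using l22_dominated[OF A] by blast
  have Bs: "(\<lambda>m. norm (coord (ell2_of B) (m, n))) summable_on UNIV" for n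
  proof -
    obtain M' where M': "dominated B (\<lambda>m. M' * (1 / wt m))" using l22_dominated[OF True] by blast
    show ?thesis unfolding coord_ell2_of[OF True]
      by (rule Infinite_Sum.abs_summable_on_comparison_test'[where g = "\<lambda>m. M' * (1 / wt m)"])
         (use M' in \<open>auto simp: dominated_def\<close>)
  qed
  have int: "integral {- pi..pi} (\<lambda>\<tau>. fourier_sum A \<tau> n ^ (2 * p) * fourier_sum B \<tau> n * cis (- (real_of_int m * \<tau>)))
     = of_real (2 * pi) * coord ((conv A ^^ (2 * p)) (ell2_of B)) (m, n)" for m n
  proof -
    have fp: "(\<lambda>m. norm (coord ((conv A ^^ (2 * p)) (ell2_of B)) (m, n))) summable_on UNIV \<and>
        (\<Sum>\<^sub>\<infinity>m. coord ((conv A ^^ (2 * p)) (ell2_of B)) (m, n) * cis (real_of_int m * \<tau>))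
        = fourier_sum A \<tau> n ^ (2 * p) * (\<Sum>\<^sub>\<infinity>m. coord (ell2_of B) (m, n) * cis (real_of_int m * \<tau>))" for \<tau>
      by (rule fourier_conv_power[OF M Bs])
    have fs: "fourier_sum A \<tau> n ^ (2 * p) * fourier_sum B \<tau> n
        = (\<Sum>\<^sub>\<infinity>m. coord ((conv A ^^ (2 * p)) (ell2_of B)) (m, n) * cis (real_of_int m * \<tau>))" for \<tau>
      using conjunct2[OF fp[of \<tau>]] by (simp add: fourier_sum_def[of B] coord_ell2_of[OF True])
    show ?thesis unfolding fs by (rule fourier_coefficient) (rule conjunct1[OF fp])
  qed
  have T: "coord (op_T p A (ell2_of B)) (m, n)
      = of_nat (2 * p + 1) * coord ((conv A ^^ (2 * p)) (ell2_of B)) (m, n) - laplacian (B m) n" for m n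
    by (simp add: op_T_def coord_lap coord_ell2_of[OF True])
  have "complex_of_real (\<epsilon> * (1 + 2 * real p) / (2 * pi)) * (of_real (2 * pi) * X) = of_real \<epsilon> * (of_nat (2 * p + 1) * X)" for X
    by (simp add: field_simps)
  then have "(D * B m n + complex_of_real (\<epsilon> * (1 + 2 * real p) / (2 * pi))
      * integral {- pi..pi} (\<lambda>\<tau>. fourier_sum A \<tau> n ^ (2 * p) * fourier_sum B \<tau> n * cis (- (real_of_int m * \<tau>)))
        = of_real \<epsilon> * laplacian (B m) n)
    \<longleftrightarrow> D * B m n + of_real \<epsilon> * coord (op_T p A (ell2_of B)) (m, n) = 0" for D m n
    unfolding int T by (simp add: right_diff_distrib add_diff_eq eq_iff_diff_eq_0[symmetric])
  then show ?thesis unfolding kg_spectral_def using True by simp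
qed (simp add: kg_spectral_def)

context kg_data
begin

text \<open>For m = 1 and m = -1 the relation \<omega>^2 = 1 - \<epsilon> \<Omega> makes the
  dispersion factor exactly \<epsilon> times \<open>res_symbol\<close>. In the other modes the two
  equations differ by the nonzero dispersion factor.\<close>

lemma kg_op_zero_iff:
  fixes \<epsilon> :: real
  assumes near: "near \<sigma> (of_real \<epsilon>) (of_real (omega \<Omega> \<epsilon>)) A" "\<sigma> \<le> \<sigma>1" and \<mu>: "cmod (\<mu> - \<Lambda>) \<le> 1"
    and \<epsilon>: "\<epsilon> \<noteq> 0" "\<epsilon> * \<Omega> \<le> 1"
  shows "kg_op p \<Omega> A (of_real \<epsilon>) (of_real (omega \<Omega> \<epsilon>)) \<mu> x = 0 \<longleftrightarrow>
    (\<forall>m n. (1 + (of_real \<epsilon> * \<mu> + \<i> * of_int m * of_real (omega \<Omega> \<epsilon>))\<^sup>2) * coord x (m, n)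
      + of_real \<epsilon> * coord (op_T p A x) (m, n) = 0)" (is "?L \<longleftrightarrow> (\<forall>m n. ?R m n)")
proof -
  let ?\<omega> = "complex_of_real (omega \<Omega> \<epsilon>)" and ?\<epsilon> = "complex_of_real \<epsilon>"
  have om: "?\<omega>\<^sup>2 = 1 - ?\<epsilon> * of_real \<Omega>"
    using \<epsilon>(2) by (simp add: omega_def of_real_power[symmetric] del: of_real_power)
  have "coord (kg_op p \<Omega> A ?\<epsilon> ?\<omega> \<mu> x) (m, n) = 0 \<longleftrightarrow> ?R m n" for m n
  proof -
    have c: "coord (kg_op p \<Omega> A ?\<epsilon> ?\<omega> \<mu> x) (m, n)
        = res_symbol \<Omega> ?\<epsilon> ?\<omega> \<mu> m * coord x (m, n) + cpl_symbol ?\<epsilon> ?\<omega> \<mu> m * coord (op_T p A x) (m, n)"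
      unfolding kg_op_def coord_add diag(1)[OF res_symbol_bound[OF near \<mu>]] diag(1)[OF cpl_symbol_le_2[OF near \<mu>]] ..
    show ?thesis
    proof (cases "\<bar>m\<bar> = 1")
      case True
      then have "real_of_int m * real_of_int m = 1"
        by (metis abs_mult_self_eq mult_1 of_int_1 of_int_mult)
      then have m2: "complex_of_int m * complex_of_int m = 1" by (metis of_real_1 of_real_mult of_real_of_int_eq)
      have "1 + (?\<epsilon> * \<mu> + \<i> * of_int m * ?\<omega>)\<^sup>2
          = 1 + ?\<epsilon>\<^sup>2 * \<mu>\<^sup>2 + 2 * ?\<epsilon> * \<i> * of_int m * \<mu> * ?\<omega> - (of_int m * of_int m) * ?\<omega>\<^sup>2"
        by (simp add: power2_eq_square algebra_simps)
      also have "\<dots> = ?\<epsilon> * res_symbol \<Omega> ?\<epsilon> ?\<omega> \<mu> m"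
        unfolding m2 om using True by (simp add: res_symbol_def power2_eq_square algebra_simps)
      finally have s: "1 + (?\<epsilon> * \<mu> + \<i> * of_int m * ?\<omega>)\<^sup>2 = ?\<epsilon> * res_symbol \<Omega> ?\<epsilon> ?\<omega> \<mu> m" .
      have "?R m n \<longleftrightarrow> ?\<epsilon> * coord (kg_op p \<Omega> A ?\<epsilon> ?\<omega> \<mu> x) (m, n) = 0"
        unfolding s c using True by (simp add: cpl_symbol_def algebra_simps)
      then show ?thesis using \<epsilon>(1) by simp
    next
      case False
      have w: "0 < wt m / 12" by simp
      have D: "dispersion ?\<epsilon> ?\<omega> \<mu> m \<noteq> 0"
        using dispersion_lower[OF near_bounds(8)[OF near \<mu>] near_bounds(2)[OF near] False] w by (metis norm_zero not_le)
      have "?R m n \<longleftrightarrow> dispersion ?\<epsilon> ?\<omega> \<mu> m * coord (kg_op p \<Omega> A ?\<epsilon> ?\<omega> \<mu> x) (m, n) = 0"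
        unfolding c using False D by (simp add: res_symbol_def cpl_symbol_def dispersion_def[symmetric] distrib_left)
      then show ?thesis using D by simp
    qed
  qed
  then show ?thesis by (metis coord_zero ell2_eqI surj_pair)
qed

end

section \<open>The eigenvalue branch\<close>

lemma row_norm_le: "l2_norm (\<lambda>n. coord x (m, n)) \<le> norm x" for x :: "(int \<times> 'n) ell2"
proof -
  have "inj (Pair m :: 'n \<Rightarrow> _)" by (simp add: inj_def)
  from l2_scaled_bound(2)[OF coord_l2[of x] this, of 1 "\<lambda>n. coord x (m, n)"]
  show ?thesis by (simp add: norm_ell2_def)
qed

text \<open>Branches are compared by sums over modes of l2 norms; this turns such closeness into
  closeness in \<open>ell2\<close>, where uniqueness holds.\<close>

lemma norm_le_row_sum:
  fixes x :: "(int \<times> 'n) ell2"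
  assumes s: "(\<lambda>m. l2_norm (\<lambda>n. coord x (m, n))) summable_on UNIV"
  shows "norm x \<le> (\<Sum>\<^sub>\<infinity>m. l2_norm (\<lambda>n. coord x (m, n)))"
proof -
  let ?f = "\<lambda>m. l2_norm (\<lambda>n. coord x (m, n))"
  have "L2_set (\<lambda>m. norm (?f m)) F \<le> (\<Sum>\<^sub>\<infinity>m. ?f m)" if "finite F" for F
  proof -
    have "L2_set (\<lambda>m. norm (?f m)) F \<le> (\<Sum>m\<in>F. norm (?f m))" by (rule L2_set_le_sum) simp
    also have "\<dots> \<le> (\<Sum>\<^sub>\<infinity>m. ?f m)" using finite_sum_le_infsum[OF s that] by simp
    finally show ?thesis .
  qed
  then have "l2_norm ?f \<le> (\<Sum>\<^sub>\<infinity>m. ?f m)" by (rule l2_boundI(2))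
  moreover have "(norm x)\<^sup>2 = (l2_norm ?f)\<^sup>2"
    using l2_norm_pair[of "\<lambda>m n. coord x (m, n)"] by (simp add: norm_ell2_def case_prod_unfold l2_norm_power2[of ?f])
  then have "norm x = l2_norm ?f" by (rule power2_eq_imp_eq) simp_all
  ultimately show ?thesis by simp
qed

definition cconj :: "'i ell2 \<Rightarrow> 'i ell2" where
  "cconj x = Ell2 (\<lambda>i. cnj (coord x i))"

lemma coord_cconj [simp]: "coord (cconj x) i = cnj (coord x i)"
proof -
  have "(\<lambda>i. cnj (coord x i)) \<in> l2"
    by (rule l2_scaled_bound(1)[OF coord_l2[of x] inj_on_id2, of 1]) auto
  then show ?thesis by (simp add: cconj_def Ell2_inverse)
qed

lemma conv_cconj:
  assumes A: "dominated A g" and real: "\<And>m n. A m n \<in> \<real>"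
  shows "conv A (cconj x) = cconj (conv A x)"
proof (rule ell2_eqI, clarify)
  fix m n
  have r: "cnj (A k n) = A k n" for k using real by (simp add: Reals_cnj_iff)
  have "((\<lambda>k. cnj (A k n * coord x (m - k, n))) has_sum cnj (coord (conv A x) (m, n))) UNIV"
    using has_sum_coord_conv[OF A, of n x m] by (simp only: has_sum_cnj_iff)
  then have "((\<lambda>k. A k n * coord (cconj x) (m - k, n)) has_sum cnj (coord (conv A x) (m, n))) UNIV"
    by (simp add: r)
  from has_sum_unique[OF has_sum_coord_conv[OF A] this]
  show "coord (conv A (cconj x)) (m, n) = coord (cconj (conv A x)) (m, n)" by simp
qed

lemma op_T_cconj:
  assumes A: "dominated A g" and real: "\<And>m n. A m n \<in> \<real>"
  shows "op_T p A (cconj x) = cconj (op_T p A x)"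
proof -
  have "(conv A ^^ k) (cconj x) = cconj ((conv A ^^ k) x)" for k
    by (induction k) (simp_all add: conv_cconj[OF A real])
  then show ?thesis
    by (intro ell2_eqI) (auto simp: op_T_def coord_lap laplacian_def)
qed

text \<open>The product of csqrt w - 1 and csqrt w + 1 is w - 1, and the principal root has
  nonnegative real part, so the second factor has modulus at least 1.\<close>

lemma csqrt_near_1: "cmod (csqrt w - 1) \<le> cmod (w - 1)"
proof -
  have "1 \<le> Re (csqrt w + 1)" using Re_csqrt[of w] by simp
  then have "1 \<le> cmod (csqrt w + 1)" using complex_Re_le_cmod order_trans by blast
  then have "cmod (csqrt w - 1) * 1 \<le> cmod (csqrt w - 1) * cmod (csqrt w + 1)" by (intro mult_left_mono) auto
  also have "\<dots> = cmod ((csqrt w)\<^sup>2 - 1)" by (simp add: norm_mult[symmetric] power2_eq_square algebra_simps)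
  finally show ?thesis by simp
qed

lemma omega_csqrt: "\<epsilon> * \<Omega> \<le> 1 \<Longrightarrow> complex_of_real (omega \<Omega> \<epsilon>) = csqrt (1 - of_real \<epsilon> * of_real \<Omega>)"
  by (simp add: omega_def csqrt_of_real_nonneg)

context kg_data
begin

text \<open>In these modes the diagonal symbol is 1, so the kernel equation expresses the mode
  through \<open>op_T\<close>. The coupling symbol contributes both smallness in \<epsilon> and the
  decay 1 / \<open>wt m\<close>.\<close>

lemma kg_op_zero_modes:
  assumes near: "near \<sigma> \<epsilon> \<omega> A" "\<sigma> \<le> \<sigma>1" and \<mu>: "cmod (\<mu> - \<Lambda>) \<le> 1"
    and z: "kg_op p \<Omega> A \<epsilon> \<omega> \<mu> x = 0" and m: "\<bar>m\<bar> \<noteq> 1"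
  shows "coord x (m, n) = - (cpl_symbol \<epsilon> \<omega> \<mu> m * coord (op_T p A x) (m, n))"
    and "l2_norm (\<lambda>n. coord x (m, n)) \<le> 12 * cmod \<epsilon> * CT * norm x / wt m"
proof -
  have *: "coord x (m, n) = - (cpl_symbol \<epsilon> \<omega> \<mu> m * coord (op_T p A x) (m, n))" for n
    using arg_cong[OF z, of "\<lambda>t. coord t (m, n)"] m
    unfolding kg_op_def coord_add diag(1)[OF res_symbol_bound[OF near \<mu>]] diag(1)[OF cpl_symbol_le_2[OF near \<mu>]]
    by (simp add: res_symbol_def eq_neg_iff_add_eq_0)
  then show "coord x (m, n) = - (cpl_symbol \<epsilon> \<omega> \<mu> m * coord (op_T p A x) (m, n))" .
  have "inj (Pair m :: int ^ 'd \<Rightarrow> _)" by (simp add: inj_def)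
  moreover have "cmod (cpl_symbol \<epsilon> \<omega> \<mu> m) \<le> 12 * cmod \<epsilon> / wt m"
    using cpl_symbol_bound(1)[OF near_bounds(8)[OF near \<mu>] near_bounds(2)[OF near] m] by (simp add: field_simps)
  then have "norm (coord x (m, n)) \<le> 12 * cmod \<epsilon> / wt m * norm (coord (op_T p A x) (m, n))" for n
    unfolding * norm_minus_cancel norm_mult by (rule mult_right_mono) simp
  ultimately have "l2_norm (\<lambda>n. coord x (m, n)) \<le> 12 * cmod \<epsilon> / wt m * norm (op_T p A x)"
    unfolding norm_ell2_def by (intro l2_scaled_bound(2)[OF coord_l2]) auto
  also have "\<dots> \<le> 12 * cmod \<epsilon> / wt m * (CT * norm x)"
    by (intro mult_left_mono op_T_bounds(2)[OF near]) auto
  finally show "l2_norm (\<lambda>n. coord x (m, n)) \<le> 12 * cmod \<epsilon> * CT * norm x / wt m" by simp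
qed

text \<open>Conjugating coefficients without flipping the mode corresponds to conjugating
  W(-\<tau>). It maps \<epsilon> \<mu> + i m \<omega> to minus the same expression at - cnj \<mu>,
  and the square absorbs the sign.\<close>

lemma kg_op_cconj:
  fixes \<epsilon> \<omega> :: real
  assumes near: "near \<sigma> (of_real \<epsilon>) (of_real \<omega>) A" "\<sigma> \<le> \<sigma>1" and \<mu>: "cmod (\<mu> - \<Lambda>) \<le> 1"
    and real: "\<And>m n. A m n \<in> \<real>" and Re: "Re \<Lambda> = 0"
  shows "kg_op p \<Omega> A (of_real \<epsilon>) (of_real \<omega>) (- cnj \<mu>) (cconj x) = cconj (kg_op p \<Omega> A (of_real \<epsilon>) (of_real \<omega>) \<mu> x)"
    and "cmod (- cnj \<mu> - \<Lambda>) \<le> 1"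
proof -
  have "- cnj \<mu> - \<Lambda> = - cnj (\<mu> - \<Lambda>)" using Re by (simp add: complex_eq_iff)
  then show \<mu>': "cmod (- cnj \<mu> - \<Lambda>) \<le> 1" using \<mu> by (simp del: complex_cnj_diff)
  obtain h where A: "dominated A h" using near_dominated[OF near] by blast
  show "kg_op p \<Omega> A (of_real \<epsilon>) (of_real \<omega>) (- cnj \<mu>) (cconj x) = cconj (kg_op p \<Omega> A (of_real \<epsilon>) (of_real \<omega>) \<mu> x)"
  proof (rule ell2_eqI, clarify)
    fix m n
    have r: "res_symbol \<Omega> (of_real \<epsilon>) (of_real \<omega>) (- cnj \<mu>) m = cnj (res_symbol \<Omega> (of_real \<epsilon>) (of_real \<omega>) \<mu> m)"
      by (simp add: res_symbol_def)
    have "of_real \<epsilon> * (- cnj \<mu>) + \<i> * of_int m * of_real \<omega> = - cnj (of_real \<epsilon> * \<mu> + \<i> * of_int m * of_real \<omega>)"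
      by simp
    then have "dispersion (of_real \<epsilon>) (of_real \<omega>) (- cnj \<mu>) m = cnj (dispersion (of_real \<epsilon>) (of_real \<omega>) \<mu> m)"
      unfolding dispersion_def by (simp only: power2_minus complex_cnj_power complex_cnj_add complex_cnj_one)
    then have c: "cpl_symbol (of_real \<epsilon>) (of_real \<omega>) (- cnj \<mu>) m = cnj (cpl_symbol (of_real \<epsilon>) (of_real \<omega>) \<mu> m)"
      by (simp add: cpl_symbol_def)
    show "coord (kg_op p \<Omega> A (of_real \<epsilon>) (of_real \<omega>) (- cnj \<mu>) (cconj x)) (m, n)
        = coord (cconj (kg_op p \<Omega> A (of_real \<epsilon>) (of_real \<omega>) \<mu> x)) (m, n)"
      unfolding coord_cconj kg_op_def coord_add diag(1)[OF res_symbol_bound[OF near \<mu>]] diag(1)[OF cpl_symbol_le_2[OF near \<mu>]]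
        diag(1)[OF res_symbol_bound[OF near \<mu>']] diag(1)[OF cpl_symbol_le_2[OF near \<mu>']] op_T_cconj[OF A real] r c
      by simp
  qed
qed

end

section \<open>The breather branch near its limit\<close>

locale breather_eigenvalue = dnls_eigenvalue p \<Omega> \<A> \<Lambda> bp bm
  for p \<Omega> and \<A> :: "int ^ 'd \<Rightarrow> real" and \<Lambda> bp bm +
  fixes A :: "real \<Rightarrow> int \<Rightarrow> int ^ 'd \<Rightarrow> complex" and \<delta> :: real
  assumes \<delta>: "0 < \<delta>" and branch: "breather_branch p \<Omega> \<A> \<delta> A"
begin

lemma breather:
  assumes "\<epsilon> \<in> {0<..<\<delta>}"
  shows "A \<epsilon> \<in> l22" and "\<And>m n. A \<epsilon> m n \<in> \<real>" and "\<And>m. A \<epsilon> (- m) = A \<epsilon> m"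
  using assms branch unfolding breather_branch_def breather_def by metis+

text \<open>Evenness in the mode transfers the estimates for m = 0, 1 and m \<ge> 2 to the negative
  modes, at the price of a factor 2. The l2 norm of a mode dominates all its sites.\<close>

lemma breather_close:
  "\<exists>Cb\<ge>0. \<forall>\<epsilon>\<in>{0<..<\<delta>}. \<exists>h. dominated (\<lambda>m n. A \<epsilon> m n - A0 m n) h \<and> infsum h UNIV \<le> Cb * \<epsilon>"
proof -
  obtain C where C: "\<And>\<epsilon>. \<epsilon> \<in> {0<..<\<delta>} \<Longrightarrow> l2_norm (A \<epsilon> 0) + l2_norm (\<lambda>n. A \<epsilon> 1 n - of_real (\<A> n))
          + (\<Sum>\<^sub>\<infinity>m\<in>{2..}. l2_norm (A \<epsilon> m)) \<le> C * \<epsilon>"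
    using branch unfolding breather_branch_def by blast
  have "\<exists>h. dominated (\<lambda>m n. A \<epsilon> m n - A0 m n) h \<and> infsum h UNIV \<le> 2 * \<bar>C\<bar> * \<epsilon>" if \<epsilon>: "\<epsilon> \<in> {0<..<\<delta>}" for \<epsilon>
  proof -
    define h where "h m = l2_norm (\<lambda>n. A \<epsilon> m n - A0 m n)" for m
    obtain x where x: "A \<epsilon> = unweight x" using l22_imp_unweight breather(1)[OF \<epsilon>] by blast
    have Al2: "A \<epsilon> m \<in> l2" for m using breather(1)[OF \<epsilon>] by (simp add: l22_def)
    have c\<A>: "(\<lambda>n. complex_of_real (\<A> n)) \<in> l2" "l2_norm (\<lambda>n. complex_of_real (\<A> n)) \<le> l2_norm \<A>"
      using l2_scaled_bound[OF A_l2 inj_on_id2, of 1 "\<lambda>n. complex_of_real (\<A> n)"] by auto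
    have A0l2: "A0 m \<in> l2 \<and> l2_norm (A0 m) \<le> g0 m" for m
    proof (cases "\<bar>m\<bar> = 1")
      case True
      then show ?thesis using c\<A> by (simp add: A0_def[abs_def] g0_def)
    next
      case False
      then show ?thesis using l2_zero by (simp add: A0_def[abs_def] g0_def) (simp add: l2_norm_def)
    qed
    have dl2: "(\<lambda>n. A \<epsilon> m n + (-1) * A0 m n) \<in> l2 \<and> l2_norm (\<lambda>n. A \<epsilon> m n + (-1) * A0 m n) \<le> l2_norm (A \<epsilon> m) + g0 m" for m
    proof -
      have "A0 m \<in> l2" using A0l2 by blast
      note n = l2_cmult[OF this, of "-1"]
      show ?thesis using l2_add[OF Al2[of m] n(1)] n(2) A0l2[of m] by simp
    qed
    have hle: "h m \<le> norm x * (1 / wt m) + g0 m" for m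
      using dl2[of m] l2_norm_unweight_le[of x m] by (simp add: h_def x)
    \<comment> \<open>This has to come from \<open>l22\<close>: \<open>infsum\<close> is 0 on
      families that are not summable, so a bound on it alone would carry no information.\<close>
    have hs: "h summable_on UNIV"
    proof (rule summable_on_comparison_test)
      show "(\<lambda>m. norm x * (1 / wt m) + g0 m) summable_on UNIV"
        by (intro summable_on_add summable_on_cmult_right summable_wt has_sum_imp_summable[OF has_sum_g0])
      show "h m \<le> norm x * (1 / wt m) + g0 m" for m by (rule hle)
      show "0 \<le> h m" for m by (simp add: h_def)
    qed
    have dom: "dominated (\<lambda>m n. A \<epsilon> m n - A0 m n) h"
      unfolding dominated_def h_def[symmetric]
    proof (intro conjI allI hs)
      fix m n
      have "(\<lambda>n. A \<epsilon> m n - A0 m n) \<in> l2" using dl2[of m] by simp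
      from norm_le_l2_norm[OF this, of n] show "cmod (A \<epsilon> m n - A0 m n) \<le> h m" by (simp add: h_def)
    qed
    have sub: "h summable_on S" for S by (rule summable_on_subset[OF hs]) simp
    have sym: "h (- m) = h m" for m by (simp add: h_def breather(3)[OF \<epsilon>] A0_def)
    have U: "(UNIV :: int set) = {0} \<union> ({1..} \<union> {..-1})" by auto
    have "infsum h UNIV = h 0 + (infsum h {1..} + infsum h {..-1})"
      unfolding U by (subst infsum_Un_disjoint; (intro sub | force)?)+
    also have "infsum h {..-1} = infsum h {1..}"
    proof -
      have "bij_betw uminus {1..} {..- 1 :: int}" by (rule bij_betwI[where g = uminus]) auto
      from infsum_reindex_bij_betw[OF this, of h] show ?thesis by (simp add: sym)
    qed
    also have "infsum h {1..} = h 1 + infsum h {2..}"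
    proof -
      have "{1..} = insert 1 {2 :: int..}" by auto
      then show ?thesis using infsum_insert[OF sub[of "{2..}"], of 1] by simp
    qed
    also have "infsum h {2..} = (\<Sum>\<^sub>\<infinity>m\<in>{2..}. l2_norm (A \<epsilon> m))"
      by (rule infsum_cong) (simp add: h_def A0_def)
    also have "h 0 = l2_norm (A \<epsilon> 0)" by (simp add: h_def A0_def)
    also have "h 1 = l2_norm (\<lambda>n. A \<epsilon> 1 n - of_real (\<A> n))" by (simp add: h_def A0_def)
    finally have "infsum h UNIV \<le> 2 * (C * \<epsilon>)" using C[OF \<epsilon>] l2_norm_nonneg[of "A \<epsilon> 0"] by linarith
    also have "\<dots> \<le> 2 * \<bar>C\<bar> * \<epsilon>" using \<epsilon> by (simp add: mult_right_mono)
    finally show ?thesis using dom by blast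
  qed
  then show ?thesis by (intro exI[of _ "2 * \<bar>C\<bar>"]) auto
qed

text \<open>As \<Lambda> is imaginary, the pair (cnj bp, - cnj bm) is again an eigenvector for 2
  \<Lambda>, and it generates the conjugate of \<open>B0\<close>. Simplicity makes it a multiple of
  (bp, bm).\<close>

lemma eigenvector_conj: "\<exists>c. \<forall>i. cnj (coord B0 i) = c * coord B0 i"
proof -
  let ?y = "(\<lambda>n. cnj (bp n), \<lambda>n. - cnj (bm n))"
  have L: "cnj \<Lambda> = - \<Lambda>" using Re_\<Lambda> by (simp add: complex_eq_iff)
  have lc: "laplacian (\<lambda>n. cnj (u n)) n = cnj (laplacian u n)" "laplacian (\<lambda>n. - cnj (u n)) n = - cnj (laplacian u n)" for u :: "int ^ 'd \<Rightarrow> complex" and n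
    by (simp_all add: laplacian_def sum_negf[symmetric])
  have e1: "- (of_real \<Omega> * bm n - laplacian bm n + of_real (gam p * \<A> n ^ (2 * p)) * bm n) = 2 * \<Lambda> * bp n"
    and e2: "of_real \<Omega> * bp n - laplacian bp n + of_real (gam p * (1 + 2 * real p) * \<A> n ^ (2 * p)) * bp n = 2 * \<Lambda> * bm n" for n
    using b_eq by (auto simp: dnls_op_def scale_pair_def fun_eq_iff)
  have "dnls_op p \<Omega> \<A> ?y = scale_pair (2 * \<Lambda>) ?y"
  proof -
    have "- (of_real \<Omega> * (- cnj (bm n)) - laplacian (\<lambda>n. - cnj (bm n)) n + of_real (gam p * \<A> n ^ (2 * p)) * (- cnj (bm n)))
        = 2 * \<Lambda> * cnj (bp n)" for n
      using arg_cong[OF e1[of n], of cnj] by (simp add: lc L algebra_simps)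
    moreover have "of_real \<Omega> * cnj (bp n) - laplacian (\<lambda>n. cnj (bp n)) n + of_real (gam p * (1 + 2 * real p) * \<A> n ^ (2 * p)) * cnj (bp n)
        = 2 * \<Lambda> * (- cnj (bm n))" for n
      using arg_cong[OF e2[of n], of cnj] by (simp add: lc L)
    ultimately show ?thesis unfolding dnls_op_def scale_pair_def prod.case by (simp only:)
  qed
  then have "shift_op (dnls_op p \<Omega> \<A>) (2 * \<Lambda>) ?y = zero_pair"
    by (simp add: shift_op_def scale_pair_def zero_pair_def)
  then have "(shift_op (dnls_op p \<Omega> \<A>) (2 * \<Lambda>) ^^ 1) ?y = zero_pair" by simp
  moreover have "?y \<in> l2 \<times> l2"
    using l2_scaled_bound(1)[OF b_l2(1) inj_on_id2, of 1 "\<lambda>n. cnj (bp n)"]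
      l2_scaled_bound(1)[OF b_l2(2) inj_on_id2, of 1 "\<lambda>n. - cnj (bm n)"] by simp
  ultimately obtain c where c: "?y = scale_pair c (bp, bm)" using generalized_eigenvector by blast
  then have c1: "cnj (bp n) = c * bp n" and "- cnj (bm n) = c * bm n" for n
    by (auto simp: scale_pair_def fun_eq_iff)
  then have c2: "cnj (bm n) = - (c * bm n)" for n by (metis minus_minus)
  have "cnj (coord B0 (m, n)) = c * coord B0 (m, n)" for m n
    by (simp add: coord_B0 c1 c2 algebra_simps)
  then show ?thesis by (intro exI[of _ c]) auto
qed

text \<open>The breather is continued to complex \<open>z\<close> near \<open>s\<close> so that holomorphy of the fixed point
  yields analyticity of the branch in the real parameter.\<close>

lemma complexify:
  assumes s: "s \<in> {0<..<\<delta>}" "2 * \<bar>\<Omega>\<bar> * s < 1" and c: "1 + \<bar>\<Omega>\<bar> + Cb \<le> c" "0 \<le> Cb"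
    and close: "\<exists>h. dominated (\<lambda>m n. A s m n - A0 m n) h \<and> infsum h UNIV \<le> Cb * s"
  shows "\<exists>\<rho>>0. \<exists>Az g. (\<forall>k n. (\<lambda>z. Az z k n) holomorphic_on ball (of_real s) \<rho>) \<and>
     (\<lambda>z. csqrt (1 - z * of_real \<Omega>)) holomorphic_on ball (of_real s) \<rho> \<and>
     (\<forall>z\<in>ball (of_real s) \<rho>. near (2 * c * s) z (csqrt (1 - z * of_real \<Omega>)) (Az z) \<and> dominated (Az z) g) \<and>
     (\<forall>t\<in>{0<..<\<delta>}. \<bar>t - s\<bar> < \<rho> \<longrightarrow> Az (of_real t) = A t)"
proof -
  have s0: "0 < s" using s by simp
  have an: "analytic_l22 A {0<..<\<delta>}" using branch by (simp add: breather_branch_def)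
  obtain \<rho>1 G K where \<rho>1: "\<rho>1 > 0" and G: "hol_family G (of_real s) \<rho>1"
    and lip: "\<And>z. z \<in> ball (of_real s) \<rho>1 \<Longrightarrow> norm (G z - G (of_real s)) \<le> K * cmod (z - of_real s)"
    and eq: "\<And>t. t \<in> {0<..<\<delta>} \<Longrightarrow> \<bar>t - s\<bar> < \<rho>1 \<Longrightarrow> A t = unweight (G (of_real t))"
    using analytic_l22_complexify[OF an open_greaterThanLessThan s(1)] by blast
  obtain M where M: "\<And>z. z \<in> ball (of_real s) \<rho>1 \<Longrightarrow> norm (G z) \<le> M" using G unfolding hol_family_def by blast
  define W where "W = (\<Sum>\<^sub>\<infinity>m. 1 / wt m)"
  have W: "0 \<le> W" unfolding W_def by (intro infsum_nonneg) simp
  \<comment> \<open>The bound by \<open>s\<close> gives |z| \<le> 2 s; the last one keeps the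
    Lipschitz error of the continued breather, summed over the modes with weights 1 /
    \<open>wt m\<close>, below s.\<close>
  define \<rho> where "\<rho> = min \<rho>1 (min s (s / (\<bar>K\<bar> * W + 1)))"
  have kw: "0 < \<bar>K\<bar> * W + 1" using W by (simp add: add_nonneg_pos)
  have \<rho>: "0 < \<rho>" "\<rho> \<le> \<rho>1" "\<rho> \<le> s" "\<bar>K\<bar> * \<rho> * W \<le> s"
  proof -
    show "0 < \<rho>" "\<rho> \<le> \<rho>1" "\<rho> \<le> s" using \<rho>1 s0 kw by (auto simp: \<rho>_def)
    then have "\<rho> * (\<bar>K\<bar> * W + 1) \<le> s" using kw by (simp add: \<rho>_def pos_le_divide_eq[symmetric])
    then show "\<bar>K\<bar> * \<rho> * W \<le> s" using \<open>0 < \<rho>\<close> by (simp add: algebra_simps)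
  qed
  have sub: "ball (of_real s) \<rho> \<subseteq> ball (of_real s :: complex) \<rho>1" using \<rho> by auto
  define Az where "Az z = unweight (G z)" for z
  obtain h where h: "dominated (\<lambda>m n. A s m n - A0 m n) h" "infsum h UNIV \<le> Cb * s" using close by blast
  have hs: "h summable_on UNIV" using h by (simp add: dominated_def)
  have As: "A s = Az (of_real s)" using eq[OF s(1)] \<rho>1 by (simp add: Az_def)
  have holz: "(\<lambda>z. Az z k n) holomorphic_on ball (of_real s) \<rho>" for k n
    unfolding Az_def unweight_def using G holomorphic_on_subset[OF _ sub]
    by (intro holomorphic_intros) (auto simp: hol_family_def)
  have zs: "cmod z \<le> 2 * s" "cmod (z - of_real s) \<le> \<rho>" if "z \<in> ball (of_real s) \<rho>" for z
  proof -
    show 1: "cmod (z - of_real s) \<le> \<rho>" using that by (simp add: dist_norm norm_minus_commute)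
    show "cmod z \<le> 2 * s" using norm_triangle_ineq[of "z - of_real s" "of_real s"] 1 \<rho>(3) s0 by simp
  qed
  have zO: "cmod (z * of_real \<Omega>) \<le> 2 * \<bar>\<Omega>\<bar> * s" if "z \<in> ball (of_real s) \<rho>" for z
    using mult_right_mono[OF zs(1)[OF that], of "\<bar>\<Omega>\<bar>"] by (simp add: norm_mult mult_ac)
  \<comment> \<open>On the disc |z \<Omega>| < 1, so the argument of the root has positive real part
    and avoids the branch cut.\<close>
  have "(\<lambda>z. csqrt (1 - z * of_real \<Omega>)) holomorphic_on ball (of_real s) \<rho>"
  proof (intro holomorphic_intros)
    fix z assume z: "z \<in> ball (complex_of_real s) \<rho>"
    have "Re (z * of_real \<Omega>) \<le> cmod (z * of_real \<Omega>)" by (rule complex_Re_le_cmod)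
    then have "0 < Re (1 - z * of_real \<Omega>)" using zO[OF z] s(2) by simp
    then show "1 - z * of_real \<Omega> \<notin> \<real>\<^sub>\<le>\<^sub>0" by (simp add: complex_nonpos_Reals_iff)
  qed
  moreover have "near (2 * c * s) z (csqrt (1 - z * of_real \<Omega>)) (Az z)" if z: "z \<in> ball (of_real s) \<rho>" for z
    unfolding near_def
  proof (intro conjI exI)
    have cc: "1 \<le> c" "\<bar>\<Omega>\<bar> \<le> c" "1 + Cb \<le> c" using c by linarith+
    have "1 * s \<le> c * s" "\<bar>\<Omega>\<bar> * s \<le> c * s" "(1 + Cb) * s \<le> c * s"
      using cc s0 by (auto intro: mult_right_mono simp del: mult_le_cancel_right mult_le_cancel_right_pos)
    note cs = this
    show "cmod z \<le> 2 * c * s" using zs(1)[OF z] cs(1) by simp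
    have "cmod (csqrt (1 - z * of_real \<Omega>) - 1) \<le> cmod (z * of_real \<Omega>)"
      using csqrt_near_1[of "1 - z * of_real \<Omega>"] by (simp add: norm_minus_commute)
    then show "cmod (csqrt (1 - z * of_real \<Omega>) - 1) \<le> 2 * c * s" using zO[OF z] cs(2) by (simp only: mult.assoc)
    have ws: "(\<lambda>m. \<bar>K\<bar> * \<rho> * (1 / wt m)) summable_on UNIV" by (intro summable_on_cmult_right summable_wt)
    show "dominated (\<lambda>m n. Az z m n - A0 m n) (\<lambda>m. \<bar>K\<bar> * \<rho> * (1 / wt m) + h m)"
      unfolding dominated_def
    proof (intro conjI allI summable_on_add ws hs)
      fix m n
      have "Az z m n - A0 m n = unweight (G z - G (of_real s)) m n + (A s m n - A0 m n)"
        by (simp add: As Az_def unweight_def diff_divide_distrib)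
      then have "cmod (Az z m n - A0 m n) \<le> cmod (unweight (G z - G (of_real s)) m n) + cmod (A s m n - A0 m n)"
        by (simp only:) (rule norm_triangle_ineq)
      also have "\<dots> \<le> \<bar>K\<bar> * \<rho> * (1 / wt m) + h m"
      proof (rule add_mono)
        have "cmod (unweight (G z - G (of_real s)) m n) \<le> norm (G z - G (of_real s)) / wt m" by (rule norm_unweight_le)
        also have "norm (G z - G (of_real s)) \<le> \<bar>K\<bar> * \<rho>"
        proof -
          have "norm (G z - G (of_real s)) \<le> K * cmod (z - of_real s)" using lip z sub by blast
          also have "\<dots> \<le> \<bar>K\<bar> * \<rho>" using zs(2)[OF z] by (intro mult_mono) auto
          finally show ?thesis .
        qed
        then have "norm (G z - G (of_real s)) / wt m \<le> \<bar>K\<bar> * \<rho> / wt m" by (intro divide_right_mono) auto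
        finally show "cmod (unweight (G z - G (of_real s)) m n) \<le> \<bar>K\<bar> * \<rho> * (1 / wt m)" by simp
        show "cmod (A s m n - A0 m n) \<le> h m" using h(1) by (simp add: dominated_def)
      qed
      finally show "cmod (Az z m n - A0 m n) \<le> \<bar>K\<bar> * \<rho> * (1 / wt m) + h m" .
    qed
    have "(\<Sum>\<^sub>\<infinity>m. \<bar>K\<bar> * \<rho> * (1 / wt m) + h m) = \<bar>K\<bar> * \<rho> * W + infsum h UNIV"
      unfolding infsum_add[OF ws hs] W_def by (simp only: infsum_cmult_right')
    also have "\<dots> \<le> s + Cb * s" using \<rho>(4) h(2) by linarith
    also have "\<dots> = (1 + Cb) * s" by (simp add: algebra_simps)
    also have "\<dots> \<le> 2 * c * s" using cs(3) cs(1) s0 by linarith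
    finally show "(\<Sum>\<^sub>\<infinity>m. \<bar>K\<bar> * \<rho> * (1 / wt m) + h m) \<le> 2 * c * s" .
  qed
  moreover have "dominated (Az z) (\<lambda>m. M * (1 / wt m))" if z: "z \<in> ball (of_real s) \<rho>" for z
    unfolding dominated_def
  proof (intro conjI allI summable_on_cmult_right summable_wt)
    fix m n
    have "norm (G z) / wt m \<le> M / wt m" using M z sub by (intro divide_right_mono) auto
    then show "cmod (Az z m n) \<le> M * (1 / wt m)" using norm_unweight_le[of "G z" m n] by (simp add: Az_def)
  qed
  moreover have "\<forall>t\<in>{0<..<\<delta>}. \<bar>t - s\<bar> < \<rho> \<longrightarrow> Az (of_real t) = A t" using eq \<rho> by (auto simp: Az_def)
  ultimately show ?thesis using holz \<rho>(1)
    by (intro exI[of _ \<rho>] conjI exI[of _ Az] exI[of _ "\<lambda>m. M * (1 / wt m)"]) auto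
qed


text \<open>Uniqueness is claimed among branches obeying the same constant as the one constructed.
  That constant is fixed before the interval, which is then shrunk until every competitor falls,
  after rescaling, into the ball of uniqueness.\<close>

theorem eigenvalue_branch:
  "\<exists>\<epsilon>\<^sub>0 C\<^sub>0. 0 < \<epsilon>\<^sub>0 \<and> \<epsilon>\<^sub>0 \<le> \<delta> \<and> 0 < C\<^sub>0 \<and>
    (\<exists>lam B. kg_eigen_branch p \<Omega> A \<Lambda> bp bm \<epsilon>\<^sub>0 C\<^sub>0 lam B \<and>
      (\<forall>\<epsilon>\<^sub>1 lam' B'. 0 < \<epsilon>\<^sub>1 \<and> \<epsilon>\<^sub>1 \<le> \<epsilon>\<^sub>0 \<and>
         kg_eigen_branch p \<Omega> A \<Lambda> bp bm \<epsilon>\<^sub>1 C\<^sub>0 lam' B' \<longrightarrow>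
         (\<forall>\<epsilon>\<in>{0<..<\<epsilon>\<^sub>1}. lam' \<epsilon> = lam \<epsilon> \<and>
            (\<exists>c. c \<noteq> 0 \<and> (\<forall>m n. B' \<epsilon> m n = c * B \<epsilon> m n)))))"
proof -
  obtain i0 where i0: "coord B0 i0 \<noteq> 0" using B0_nonzero by blast
  interpret P: simple_kernel G0 mode_op B0 i0 \<Lambda> CK
    by unfold_locales (use bclin_mode_op bclin_G0 G0_B0 CK linearization_bcinv[OF i0] in auto)
  obtain r \<sigma>0 C where PR: "0 < r \<and> r \<le> 1 \<and> 0 < \<sigma>0 \<and> 0 \<le> C \<and>
     (\<forall>\<sigma> H. \<sigma> \<le> \<sigma>0 \<longrightarrow> P.admissible \<sigma> H \<longrightarrow>
        (\<exists>y. y \<in> cball P.center r \<and> norm (y - P.center) \<le> C * \<sigma> \<and> P.solves H y \<and>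
           (\<forall>y'\<in>cball P.center r. P.solves H y' \<longrightarrow> y' = y))) \<and>
     (\<forall>\<sigma> s \<rho> H Y. \<sigma> \<le> \<sigma>0 \<longrightarrow> (\<forall>z\<in>ball s \<rho>. P.admissible \<sigma> (H z)) \<longrightarrow>
        (\<forall>F m. hol_family F s \<rho> \<longrightarrow> m holomorphic_on ball s \<rho> \<longrightarrow> (\<forall>z\<in>ball s \<rho>. cmod (m z - \<Lambda>) \<le> 1) \<longrightarrow>
           hol_family (\<lambda>z. H z (m z) (F z)) s \<rho>) \<longrightarrow>
        (\<forall>z\<in>ball s \<rho>. Y z \<in> cball P.center r \<and> P.solves (H z) (Y z)) \<longrightarrow> hol_family Y s \<rho>)"
    using P.persistence by (elim exE) (rule that, assumption)
  have r: "0 < r" "r \<le> 1" and \<sigma>0: "0 < \<sigma>0" and C: "0 \<le> C" using PR by simp_all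
  note PR' = PR[THEN conjunct2, THEN conjunct2, THEN conjunct2, THEN conjunct2]
  note ex = PR'[THEN conjunct1, THEN spec, THEN spec, THEN mp, THEN mp]
  note hol = PR'[THEN conjunct2, THEN spec, THEN spec, THEN spec, THEN spec, THEN spec, THEN mp, THEN mp, THEN mp, THEN mp]
  have adm: "P.admissible \<sigma> (kg_op p \<Omega> A' \<epsilon> \<omega>)" if "near \<sigma> \<epsilon> \<omega> A'" "\<sigma> \<le> \<sigma>1" for \<sigma> \<epsilon> \<omega> A'
    unfolding P.admissible_def
  proof (intro conjI allI impI)
    show "0 \<le> \<sigma>" by (rule near_bounds(4)[OF that])
    show "bclin (kg_op p \<Omega> A' \<epsilon> \<omega> \<mu>)" if "cmod (\<mu> - \<Lambda>) \<le> 1" for \<mu>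
      by (rule bclin_kg_op[OF \<open>near \<sigma> \<epsilon> \<omega> A'\<close> \<open>\<sigma> \<le> \<sigma>1\<close> that])
    show "norm (kg_op p \<Omega> A' \<epsilon> \<omega> \<mu> x - G0 x) \<le> CK * (\<sigma> + cmod (\<mu> - \<Lambda>)) * norm x" if "cmod (\<mu> - \<Lambda>) \<le> 1" for \<mu> x
      unfolding G0_def by (rule kg_op_near[OF \<open>near \<sigma> \<epsilon> \<omega> A'\<close> \<open>\<sigma> \<le> \<sigma>1\<close> that])
    show "norm (kg_op p \<Omega> A' \<epsilon> \<omega> \<mu> x - kg_op p \<Omega> A' \<epsilon> \<omega> \<mu>' x - (\<mu> - \<mu>') *c mode_op x)
        \<le> CK * \<sigma> * cmod (\<mu> - \<mu>') * norm x" if "cmod (\<mu> - \<Lambda>) \<le> 1" "cmod (\<mu>' - \<Lambda>) \<le> 1" for \<mu> \<mu>' x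
      by (rule kg_op_lipschitz[OF \<open>near \<sigma> \<epsilon> \<omega> A'\<close> \<open>\<sigma> \<le> \<sigma>1\<close> that])
  qed
  obtain Cb where Cb: "0 \<le> Cb" and close: "\<And>\<epsilon>. \<epsilon> \<in> {0<..<\<delta>} \<Longrightarrow>
      \<exists>h. dominated (\<lambda>m n. A \<epsilon> m n - A0 m n) h \<and> infsum h UNIV \<le> Cb * \<epsilon>"
    using breather_close by blast
  define c1 where "c1 = 1 + \<bar>\<Omega>\<bar> + Cb"
  have c1: "1 \<le> c1" using Cb by (simp add: c1_def)
  define \<sigma>s where "\<sigma>s = min \<sigma>0 \<sigma>1"
  have \<sigma>s: "0 < \<sigma>s" "\<sigma>s \<le> \<sigma>0" "\<sigma>s \<le> \<sigma>1" using \<sigma>0 \<sigma>1 by (auto simp: \<sigma>s_def)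
  define Cs where "Cs = C * c1"
  have Cs: "0 \<le> Cs" using C c1 by (simp add: Cs_def)
  define b where "b = norm B0"
  have b: "0 \<le> b" by (simp add: b_def)
  define W where "W = (\<Sum>\<^sub>\<infinity>m. 1 / wt m)"
  have W: "0 \<le> W" unfolding W_def by (intro infsum_nonneg) simp
  define Ct where "Ct = 12 * CT * (b + 1)"
  have Ct: "0 \<le> Ct" using CT b by (simp add: Ct_def)
  \<comment> \<open>2 \<open>Cs\<close> pays for the modes 1 and -1, \<open>Ct\<close> for the mode
    0 and \<open>Ct * W\<close> for all others.\<close>
  define C0 where "C0 = 2 * Cs + Ct * (1 + W) + 1"
  have C0: "1 \<le> C0" "Cs \<le> C0" "2 * Cs \<le> C0" "Ct + Ct * W \<le> C0"
    using Cs Ct W mult_nonneg_nonneg[OF Ct W] by (auto simp: C0_def distrib_left)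
  define \<beta> where "\<beta> = cmod (coord B0 i0)"
  have \<beta>: "0 < \<beta>" using i0 by (simp add: \<beta>_def)
  \<comment> \<open>Bounds the distance of a rescaled competitor c x from \<open>B0\<close>: 4
    \<open>C0\<close> is |c| \<le> 2 times the distance 2 \<open>C0\<close> of x, and the second
    term is |c - 1| times the norm of \<open>B0\<close>.\<close>
  define C2 where "C2 = 4 * C0 + 4 * C0 * b / \<beta>"
  have C2: "0 \<le> C2" using C0 b \<beta> by (simp add: C2_def)
  \<comment> \<open>In order: the breather exists; the complex disc, where \<sigma> = 2
    \<open>c1\<close> s, stays in the range of the contraction; rescaled competitors lie in the
    ball; their coordinate at \<open>i0\<close> is at least \<beta> / 2; the frequency root is
    holomorphic.\<close>
  define e0 where "e0 = min \<delta> (min (\<sigma>s / (2 * c1)) (min (r / (C2 + C0)) (min (\<beta> / (4 * C0)) (1 / (2 * \<bar>\<Omega>\<bar> + 1)))))"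
  have e0: "0 < e0" "e0 \<le> \<delta>"
    using \<delta> \<sigma>s c1 r C2 C0 \<beta> by (auto simp: e0_def add_nonneg_pos)
  have small: "\<epsilon> \<in> {0<..<\<delta>}" "2 * c1 * \<epsilon> \<le> \<sigma>s" "(C2 + C0) * \<epsilon> \<le> r" "4 * C0 * \<epsilon> \<le> \<beta>" "2 * \<bar>\<Omega>\<bar> * \<epsilon> < 1" "0 < \<epsilon>" "\<epsilon> * \<Omega> \<le> 1" "c1 * \<epsilon> \<le> \<sigma>s"
    if "\<epsilon> \<in> {0<..<e0}" for \<epsilon>
  proof -
    have lt: "0 < \<epsilon>" "\<epsilon> < \<delta>" "\<epsilon> < \<sigma>s / (2 * c1)" "\<epsilon> < r / (C2 + C0)" "\<epsilon> < \<beta> / (4 * C0)" "\<epsilon> < 1 / (2 * \<bar>\<Omega>\<bar> + 1)"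
      using that by (auto simp: e0_def)
    show "\<epsilon> \<in> {0<..<\<delta>}" "0 < \<epsilon>" using lt by auto
    show 1: "2 * c1 * \<epsilon> \<le> \<sigma>s" using lt(3) c1 by (simp add: field_simps)
    show "(C2 + C0) * \<epsilon> \<le> r" using lt(4) C2 C0 by (simp add: field_simps)
    show "4 * C0 * \<epsilon> \<le> \<beta>" using lt(5) C0 by (simp add: field_simps)
    have "\<epsilon> * (2 * \<bar>\<Omega>\<bar> + 1) < 1" using lt(6) by (simp add: pos_less_divide_eq)
    then show 2: "2 * \<bar>\<Omega>\<bar> * \<epsilon> < 1" using lt(1) by (simp add: algebra_simps)
    have "\<epsilon> * \<Omega> \<le> \<epsilon> * \<bar>\<Omega>\<bar>" using lt(1) by (intro mult_left_mono) auto
    moreover have "\<epsilon> * \<bar>\<Omega>\<bar> = \<bar>\<Omega>\<bar> * \<epsilon>" "0 \<le> \<bar>\<Omega>\<bar> * \<epsilon>" using lt(1) by simp_all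
    ultimately show "\<epsilon> * \<Omega> \<le> 1" using 2 by linarith
    have "0 \<le> c1 * \<epsilon>" using c1 lt(1) by simp
    then show "c1 * \<epsilon> \<le> \<sigma>s" using 1 by simp
  qed
  let ?H = "\<lambda>\<epsilon>. kg_op p \<Omega> (A \<epsilon>) (complex_of_real \<epsilon>) (complex_of_real (omega \<Omega> \<epsilon>))"
  have near: "near (c1 * \<epsilon>) (of_real \<epsilon>) (of_real (omega \<Omega> \<epsilon>)) (A \<epsilon>)" if \<epsilon>: "\<epsilon> \<in> {0<..<e0}" for \<epsilon>
  proof -
    note sm = small[OF \<epsilon>]
    obtain h where h: "dominated (\<lambda>m n. A \<epsilon> m n - A0 m n) h" "infsum h UNIV \<le> Cb * \<epsilon>" using close[OF sm(1)] by blast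
    have ce: "1 * \<epsilon> \<le> c1 * \<epsilon>" "\<bar>\<Omega>\<bar> * \<epsilon> \<le> c1 * \<epsilon>" "Cb * \<epsilon> \<le> c1 * \<epsilon>"
      using sm(6) Cb by (auto intro!: mult_right_mono simp: c1_def simp del: mult_le_cancel_right_pos)
    have "cmod (of_real (omega \<Omega> \<epsilon>) - 1) \<le> cmod (complex_of_real \<epsilon> * of_real \<Omega>)"
      unfolding omega_csqrt[OF sm(7)] using csqrt_near_1[of "1 - of_real \<epsilon> * of_real \<Omega>"] by simp
    then have "cmod (of_real (omega \<Omega> \<epsilon>) - 1) \<le> \<bar>\<Omega>\<bar> * \<epsilon>" using sm(6) by (simp add: norm_mult mult.commute)
    then have "cmod (of_real (omega \<Omega> \<epsilon>) - 1) \<le> c1 * \<epsilon>" using ce(2) by linarith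
    moreover have "cmod (of_real \<epsilon>) \<le> c1 * \<epsilon>" using ce(1) sm(6) by (simp del: mult_le_cancel_right_pos)
    moreover have "infsum h UNIV \<le> c1 * \<epsilon>" using ce(3) h(2) by linarith
    ultimately show ?thesis unfolding near_def using h(1) by blast
  qed
  have near_s: "c1 * \<epsilon> \<le> \<sigma>1" "c1 * \<epsilon> \<le> \<sigma>0" if "\<epsilon> \<in> {0<..<e0}" for \<epsilon>
    using small(8)[OF that] \<sigma>s by linarith+
  have "\<exists>Y. \<forall>\<epsilon>\<in>{0<..<e0}. Y \<epsilon> \<in> cball P.center r \<and> norm (Y \<epsilon> - P.center) \<le> Cs * \<epsilon> \<and> P.solves (?H \<epsilon>) (Y \<epsilon>) \<and>
      (\<forall>y'\<in>cball P.center r. P.solves (?H \<epsilon>) y' \<longrightarrow> y' = Y \<epsilon>)"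
    unfolding Cs_def using ex[OF near_s(2) adm[OF near near_s(1)]] by (intro bchoice ballI) (simp add: mult.assoc)
  then obtain Y where Y: "\<And>\<epsilon>. \<epsilon> \<in> {0<..<e0} \<Longrightarrow> Y \<epsilon> \<in> cball P.center r"
    and Yn: "\<And>\<epsilon>. \<epsilon> \<in> {0<..<e0} \<Longrightarrow> norm (Y \<epsilon> - P.center) \<le> Cs * \<epsilon>"
    and Ys: "\<And>\<epsilon>. \<epsilon> \<in> {0<..<e0} \<Longrightarrow> P.solves (?H \<epsilon>) (Y \<epsilon>)"
    and Yu: "\<And>\<epsilon> y'. \<epsilon> \<in> {0<..<e0} \<Longrightarrow> y' \<in> cball P.center r \<Longrightarrow> P.solves (?H \<epsilon>) y' \<Longrightarrow> y' = Y \<epsilon>"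
    by blast
  have small_\<nu>: "cmod (coord y i0) \<le> norm (y - P.center)" for y
    using norm_coord_le[of "y - P.center" i0] by (simp add: P.coord_center)
  have small_fill: "norm (P.fill y - B0) \<le> norm (y - P.center)" for y
    using norm_drop_coord[of i0 "y - P.center"] P.fill_diff[of y P.center] by (simp add: P.fill_center)
  have cb: "y \<in> cball P.center r \<longleftrightarrow> norm (y - P.center) \<le> r" for y by (simp add: dist_norm norm_minus_commute)
  define \<mu> where "\<mu> \<epsilon> = \<Lambda> + coord (Y \<epsilon>) i0" for \<epsilon>
  define X where "X \<epsilon> = P.fill (Y \<epsilon>)" for \<epsilon>
  have \<mu>1: "cmod (\<mu> \<epsilon> - \<Lambda>) \<le> 1" and \<mu>C: "cmod (\<mu> \<epsilon> - \<Lambda>) \<le> Cs * \<epsilon>" and XC: "norm (X \<epsilon> - B0) \<le> Cs * \<epsilon>"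
    and Xb: "norm (X \<epsilon>) \<le> b + 1" and HX: "?H \<epsilon> (\<mu> \<epsilon>) (X \<epsilon>) = 0" if \<epsilon>: "\<epsilon> \<in> {0<..<e0}" for \<epsilon>
  proof -
    show "cmod (\<mu> \<epsilon> - \<Lambda>) \<le> 1" "cmod (\<mu> \<epsilon> - \<Lambda>) \<le> Cs * \<epsilon>"
      using small_\<nu>[of "Y \<epsilon>"] Y[OF \<epsilon>, unfolded cb] Yn[OF \<epsilon>] r by (auto simp: \<mu>_def)
    show "norm (X \<epsilon> - B0) \<le> Cs * \<epsilon>" using small_fill[of "Y \<epsilon>"] Yn[OF \<epsilon>] by (simp add: X_def)
    have "norm (X \<epsilon> - B0) \<le> 1" using small_fill[of "Y \<epsilon>"] Y[OF \<epsilon>, unfolded cb] r by (simp add: X_def)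
    then show "norm (X \<epsilon>) \<le> b + 1" using norm_triangle_ineq[of "X \<epsilon> - B0" B0] by (simp add: b_def)
    show "?H \<epsilon> (\<mu> \<epsilon>) (X \<epsilon>) = 0" using Ys[OF \<epsilon>] by (simp add: P.solves_def \<mu>_def X_def)
  qed
  define lam where "lam \<epsilon> = of_real \<epsilon> * \<mu> \<epsilon>" for \<epsilon>
  define B where "B \<epsilon> m n = coord (X \<epsilon>) (m, n)" for \<epsilon> m n
  \<comment> \<open>Uniqueness of \<open>Y\<close> in terms of eigenpairs: since x is normalised at
    \<open>i0\<close>, that slot is free to store \<mu>' - \<Lambda>.\<close>
  have uniq: "\<mu>' = \<mu> \<epsilon> \<and> x = X \<epsilon>"
    if \<epsilon>: "\<epsilon> \<in> {0<..<e0}" and n: "norm (x - B0) + cmod (\<mu>' - \<Lambda>) \<le> r" and x0: "coord x i0 = coord B0 i0"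
      and H: "?H \<epsilon> \<mu>' x = 0" for \<epsilon> \<mu>' x
  proof -
    define y where "y = drop_coord i0 x + (\<mu>' - \<Lambda>) *c unit_vec i0"
    have f: "P.fill y = x" by (rule ell2_eqI) (simp add: y_def x0)
    have c: "coord y i0 = \<mu>' - \<Lambda>" by (simp add: y_def)
    have "y - P.center = drop_coord i0 (x - B0) + (\<mu>' - \<Lambda>) *c unit_vec i0"
      by (rule ell2_eqI) (simp add: y_def P.center_def)
    moreover have "norm ((\<mu>' - \<Lambda>) *c unit_vec i0) \<le> cmod (\<mu>' - \<Lambda>)"
      using mult_left_mono[OF norm_unit_vec_le[of i0], of "cmod (\<mu>' - \<Lambda>)"] by simp
    ultimately have "norm (y - P.center) \<le> norm (x - B0) + cmod (\<mu>' - \<Lambda>)"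
      using norm_triangle_ineq[of "drop_coord i0 (x - B0)" "(\<mu>' - \<Lambda>) *c unit_vec i0"] norm_drop_coord[of i0 "x - B0"] by simp
    then have "y \<in> cball P.center r" unfolding cb using n by linarith
    moreover have "P.solves (?H \<epsilon>) y" using H by (simp add: P.solves_def f c)
    ultimately have "y = Y \<epsilon>" by (rule Yu[OF \<epsilon>])
    then show ?thesis using f c by (auto simp: X_def \<mu>_def)
  qed
  have decay: "l2_norm (B \<epsilon> m) \<le> Ct * \<epsilon> * (1 / wt m)" if \<epsilon>: "\<epsilon> \<in> {0<..<e0}" and m: "\<bar>m\<bar> \<noteq> 1" for \<epsilon> m
  proof -
    have "l2_norm (B \<epsilon> m) \<le> 12 * cmod (of_real \<epsilon>) * CT * norm (X \<epsilon>) / wt m"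
      using kg_op_zero_modes(2)[OF near[OF \<epsilon>] near_s(1)[OF \<epsilon>] \<mu>1[OF \<epsilon>] HX[OF \<epsilon>] m] by (simp add: B_def[abs_def])
    also have "\<dots> \<le> 12 * cmod (of_real \<epsilon>) * CT * (b + 1) / wt m"
      using CT Xb[OF \<epsilon>] by (intro divide_right_mono mult_left_mono) auto
    finally show ?thesis using small(6)[OF \<epsilon>] by (simp add: Ct_def mult_ac)
  qed
  text \<open>Weighting the modes keeps the family bounded because the dispersion factor grows
    quadratically; this lifts the branch from \<open>ell2\<close> to \<open>l22\<close>.\<close>
  have local_hol: "\<exists>\<rho>>0. \<exists>Z V. hol_family Z (of_real s) \<rho> \<and> hol_family V (of_real s) \<rho> \<and>
      (\<forall>t\<in>{0<..<e0}. \<bar>t - s\<bar> < \<rho> \<longrightarrow> Y t = Z (of_real t) \<and> B t = unweight (V (of_real t)))"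
    if s: "s \<in> {0<..<e0}" for s
  proof -
    note sm = small[OF s]
    define \<sigma> where "\<sigma> = 2 * c1 * s"
    have \<sigma>: "\<sigma> \<le> \<sigma>0" "\<sigma> \<le> \<sigma>1" using sm(2) \<sigma>s by (auto simp: \<sigma>_def)
    obtain \<rho> Az g where \<rho>: "\<rho> > 0" and Az: "\<And>k n. (\<lambda>z. Az z k n) holomorphic_on ball (of_real s) \<rho>"
      and om: "(\<lambda>z. csqrt (1 - z * of_real \<Omega>)) holomorphic_on ball (of_real s) \<rho>"
      and nz: "\<And>z. z \<in> ball (of_real s) \<rho> \<Longrightarrow> near \<sigma> z (csqrt (1 - z * of_real \<Omega>)) (Az z)"
      and dz: "\<And>z. z \<in> ball (of_real s) \<rho> \<Longrightarrow> dominated (Az z) g"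
      and real: "\<And>t. t \<in> {0<..<\<delta>} \<Longrightarrow> \<bar>t - s\<bar> < \<rho> \<Longrightarrow> Az (of_real t) = A t"
      using complexify[OF sm(1,5) _ Cb close[OF sm(1)], of c1] unfolding \<sigma>_def c1_def by blast
    let ?K = "\<lambda>z. kg_op p \<Omega> (Az z) z (csqrt (1 - z * of_real \<Omega>))"
    have admz: "\<forall>z\<in>ball (of_real s) \<rho>. P.admissible \<sigma> (?K z)" using adm[OF nz \<sigma>(2)] by blast
    have "\<exists>Z. \<forall>z\<in>ball (of_real s) \<rho>. Z z \<in> cball P.center r \<and> P.solves (?K z) (Z z)"
      using ex[OF \<sigma>(1)] admz by (intro bchoice) meson
    then obtain Z where Z: "\<forall>z\<in>ball (of_real s) \<rho>. Z z \<in> cball P.center r \<and> P.solves (?K z) (Z z)" by blast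
    have holK: "hol_family (\<lambda>z. ?K z (m z) (F z)) (of_real s) \<rho>"
      if "hol_family F (of_real s) \<rho>" "m holomorphic_on ball (of_real s) \<rho>" "\<forall>z\<in>ball (of_real s) \<rho>. cmod (m z - \<Lambda>) \<le> 1" for F m
      using that by (intro hol_family_kg_op[OF _ nz \<sigma>(2) Az dz _ om]) (auto intro!: holomorphic_intros)
    have holZ: "hol_family Z (of_real s) \<rho>"
      by (rule hol[OF \<sigma>(1) admz _ Z]) (use holK in blast)
    define M where "M z = \<Lambda> + coord (Z z) i0" for z
    define F where "F z = P.fill (Z z)" for z
    have holM: "M holomorphic_on ball (of_real s) \<rho>"
      unfolding M_def by (intro holomorphic_intros hol_familyD[OF holZ])
    have holF: "hol_family F (of_real s) \<rho>"
      unfolding F_def P.fill_def by (intro hol_family_add hol_family_const hol_family_bclin[OF holZ bclin_drop_coord])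
    have M1: "cmod (M z - \<Lambda>) \<le> 1" if "z \<in> ball (of_real s) \<rho>" for z
    proof -
      have "norm (Z z - P.center) \<le> r" using Z that unfolding cb by blast
      then show ?thesis using small_\<nu>[of "Z z"] r by (simp add: M_def)
    qed
    have HF: "?K z (M z) (F z) = 0" if "z \<in> ball (of_real s) \<rho>" for z
      using Z that by (auto simp: M_def F_def P.solves_def)
    define w1 where "w1 m = (if \<bar>m\<bar> = 1 then complex_of_real (wt m) else 0)" for m
    define w2 where "w2 z m = (if \<bar>m\<bar> = 1 then 0 else of_real (wt m) * cpl_symbol z (csqrt (1 - z * of_real \<Omega>)) (M z) m)" for z m
    have w1: "cmod (w1 m) \<le> 2" for m
    proof (cases "\<bar>m\<bar> = 1")
      case True
      then have "\<bar>real_of_int m\<bar> = 1" by linarith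
      then have "(real_of_int m)\<^sup>2 = 1" by (metis power2_abs one_power2)
      then show ?thesis using True by (simp add: w1_def wt_def)
    qed (simp add: w1_def)
    have w2: "cmod (w2 z m) \<le> 12" if z: "z \<in> ball (of_real s) \<rho>" for z m
    proof (cases "\<bar>m\<bar> = 1")
      case False
      then have "cmod (w2 z m) \<le> 12 * cmod z"
        using cpl_symbol_bound(1)[OF near_bounds(8)[OF nz[OF z] \<sigma>(2) M1[OF z]] near_bounds(2)[OF nz[OF z] \<sigma>(2)] False]
        by (simp add: w2_def norm_mult)
      also have "\<dots> \<le> 12" using near_bounds(5)[OF nz[OF z] \<sigma>(2)] by simp
      finally show ?thesis .
    qed (simp add: w2_def)
    have w2h: "(\<lambda>z. w2 z m) holomorphic_on ball (of_real s) \<rho>" for m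
    proof (cases "\<bar>m\<bar> = 1")
      case False
      have w: "0 < wt m / 12" by simp
      have "0 < cmod (dispersion z (csqrt (1 - z * of_real \<Omega>)) (M z) m)" if z: "z \<in> ball (of_real s) \<rho>" for z
        using dispersion_lower[OF near_bounds(8)[OF nz[OF z] \<sigma>(2) M1[OF z]] near_bounds(2)[OF nz[OF z] \<sigma>(2)] False] w by linarith
      then show ?thesis using False unfolding w2_def cpl_symbol_def dispersion_def
        by (auto intro!: holomorphic_intros om holM)
    qed (simp add: w2_def)
    \<comment> \<open>\<open>V\<close> is \<open>F\<close> with mode m multiplied by
      \<open>wt m\<close>. In the modes other than 1 and -1 the kernel equation is substituted
      first, because the weighted symbol \<open>w2\<close> is bounded while the weight is
      not.\<close>
    define V where "V z = diag w1 (F z) - diag (w2 z) (op_T p (Az z) (F z))" for z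
    have holV: "hol_family V (of_real s) \<rho>"
      unfolding V_def
      by (intro hol_family_diff hol_family_bclin[OF holF diag(3)[OF w1]] hol_family_diag[OF _ w2h w2] hol_family_op_T[OF holF Az dz])
    have V: "unweight (V z) m n = coord (F z) (m, n)" if z: "z \<in> ball (of_real s) \<rho>" for z m n
    proof (cases "\<bar>m\<bar> = 1")
      case True
      then show ?thesis unfolding unweight_def V_def coord_diff diag(1)[OF w1] diag(1)[OF w2[OF z]]
        by (simp add: w1_def w2_def)
    next
      case False
      then show ?thesis unfolding unweight_def V_def coord_diff diag(1)[OF w1] diag(1)[OF w2[OF z]]
        using kg_op_zero_modes(1)[OF nz[OF z] \<sigma>(2) M1[OF z] HF[OF z] False, of n]
        by (simp add: w1_def w2_def)
    qed
    have "Y t = Z (of_real t) \<and> B t = unweight (V (of_real t))" if t: "t \<in> {0<..<e0}" "\<bar>t - s\<bar> < \<rho>" for t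
    proof -
      have tb: "of_real t \<in> ball (complex_of_real s) \<rho>" using t by (simp add: dist_norm abs_minus_commute flip: of_real_diff)
      have KH: "?K (of_real t) = ?H t"
        using real[OF small(1)[OF t(1)] t(2)] omega_csqrt[OF small(7)[OF t(1)]] by simp
      \<comment> \<open>For real t both solve the same equation in the same ball, so uniqueness
        glues the local holomorphic solutions to the global real one.\<close>
      have "Z (of_real t) = Y t"
        using Z[rule_format, OF tb] unfolding KH by (intro Yu[OF t(1)]) blast+
      moreover have "B t = unweight (V (of_real t))"
        using V[OF tb] calculation by (auto simp: B_def F_def X_def fun_eq_iff)
      ultimately show ?thesis by simp
    qed
    then show ?thesis using \<rho> holZ holV by blast
  qed
  have Bl22: "B \<epsilon> \<in> l22" if \<epsilon>: "\<epsilon> \<in> {0<..<e0}" for \<epsilon>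
  proof -
    obtain \<rho> Z V where "\<rho> > 0" "\<forall>t\<in>{0<..<e0}. \<bar>t - \<epsilon>\<bar> < \<rho> \<longrightarrow> Y t = Z (complex_of_real t) \<and> B t = unweight (V (complex_of_real t))"
      using local_hol[OF \<epsilon>] by blast
    then have "B \<epsilon> = unweight (V (of_real \<epsilon>))" using \<epsilon> by auto
    then show ?thesis by (simp add: unweight_l22)
  qed
  have ell2_B: "ell2_of (B \<epsilon>) = X \<epsilon>" if "\<epsilon> \<in> {0<..<e0}" for \<epsilon>
    by (rule ell2_eqI) (auto simp: coord_ell2_of[OF Bl22[OF that]] B_def)
  have spec: "kg_spectral p \<Omega> \<epsilon> (A \<epsilon>) (lam \<epsilon>) (B \<epsilon>)" if \<epsilon>: "\<epsilon> \<in> {0<..<e0}" for \<epsilon>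
    unfolding kg_spectral_iff[OF breather(1)[OF small(1)[OF \<epsilon>]]]
  proof (intro conjI Bl22[OF \<epsilon>])
    obtain m n where mn: "i0 = (m, n)" by (cases i0)
    have "coord (X \<epsilon>) i0 \<noteq> 0" using i0 by (simp add: X_def)
    then have "B \<epsilon> m n \<noteq> 0" by (simp add: B_def mn)
    then show "B \<epsilon> \<noteq> (\<lambda>m n. 0)" by (auto simp: fun_eq_iff)
    show "\<forall>m n. (1 + (lam \<epsilon> + \<i> * of_int m * of_real (omega \<Omega> \<epsilon>))\<^sup>2) * B \<epsilon> m n
        + of_real \<epsilon> * coord (op_T p (A \<epsilon>) (ell2_of (B \<epsilon>))) (m, n) = 0"
      using kg_op_zero_iff[OF near[OF \<epsilon>] near_s(1)[OF \<epsilon>] \<mu>1[OF \<epsilon>] _ small(7)[OF \<epsilon>], of "X \<epsilon>"] HX[OF \<epsilon>] small(6)[OF \<epsilon>]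
      unfolding ell2_B[OF \<epsilon>] by (simp add: lam_def B_def)
  qed
  have imag: "Re (lam \<epsilon>) = 0" if \<epsilon>: "\<epsilon> \<in> {0<..<e0}" for \<epsilon>
  proof -
    obtain c where c: "\<And>i. cnj (coord B0 i) = c * coord B0 i" using eigenvector_conj by blast
    have "cmod (coord B0 i0) = cmod c * cmod (coord B0 i0)" using arg_cong[OF c[of i0], of cmod] by (simp add: norm_mult)
    then have c1: "cmod c = 1" using i0 by simp
    then have cn: "cnj c * c = 1" by (metis complex_norm_square mult.commute of_real_1 one_power2)
    \<comment> \<open>Conjugation sends \<open>B0\<close> to c \<open>B0\<close> with |c| = 1; the
      factor cnj c restores the normalisation at \<open>i0\<close>, so that \<open>uniq\<close> can
      compare the reflected eigenpair with the original.\<close>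
    define x where "x = cnj c *c cconj (X \<epsilon>)"
    have "coord (x - B0) i = cnj c * cnj (coord (X \<epsilon> - B0) i)" for i
      using cn by (simp add: x_def c right_diff_distrib mult.assoc[symmetric])
    then have "norm (coord (x - B0) i) \<le> 1 * norm (coord (X \<epsilon> - B0) i)" for i by (simp only: norm_mult complex_mod_cnj c1)
    then have nx: "norm (x - B0) \<le> norm (X \<epsilon> - B0)"
      unfolding norm_ell2_def using l2_scaled_bound(2)[OF coord_l2[of "X \<epsilon> - B0"] inj_on_id2, of 1 "coord (x - B0)"] by simp
    have L: "- cnj (\<mu> \<epsilon>) - \<Lambda> = - cnj (\<mu> \<epsilon> - \<Lambda>)" using Re_\<Lambda> by (simp add: complex_eq_iff)
    have n\<mu>: "cmod (- cnj (\<mu> \<epsilon>) - \<Lambda>) = cmod (\<mu> \<epsilon> - \<Lambda>)" unfolding L norm_minus_cancel complex_mod_cnj ..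
    have "- cnj (\<mu> \<epsilon>) = \<mu> \<epsilon> \<and> x = X \<epsilon>"
    proof (rule uniq[OF \<epsilon>])
      have "2 * Cs * \<epsilon> \<le> (C2 + C0) * \<epsilon>" using C0 C2 small(6)[OF \<epsilon>] by (intro mult_right_mono) auto
      then show "norm (x - B0) + cmod (- cnj (\<mu> \<epsilon>) - \<Lambda>) \<le> r"
        using nx XC[OF \<epsilon>] \<mu>C[OF \<epsilon>] small(3)[OF \<epsilon>] unfolding n\<mu> by linarith
      show "coord x i0 = coord B0 i0"
        using cn by (simp add: x_def X_def c mult.assoc[symmetric])
      have "?H \<epsilon> (- cnj (\<mu> \<epsilon>)) (cconj (X \<epsilon>)) = cconj (?H \<epsilon> (\<mu> \<epsilon>) (X \<epsilon>))"
        by (rule kg_op_cconj(1)[OF near[OF \<epsilon>] near_s(1)[OF \<epsilon>] \<mu>1[OF \<epsilon>] breather(2)[OF small(1)[OF \<epsilon>]] Re_\<Lambda>])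
      also have "\<dots> = 0" unfolding HX[OF \<epsilon>] by (rule ell2_eqI) simp
      finally have z: "?H \<epsilon> (- cnj (\<mu> \<epsilon>)) (cconj (X \<epsilon>)) = 0" .
      have "bclin (?H \<epsilon> (- cnj (\<mu> \<epsilon>)))"
        by (rule bclin_kg_op[OF near[OF \<epsilon>] near_s(1)[OF \<epsilon>]]) (use n\<mu> \<mu>1[OF \<epsilon>] in simp)
      from bclin_cscale[OF this] show "?H \<epsilon> (- cnj (\<mu> \<epsilon>)) x = 0"
        unfolding x_def by (simp only: z) (rule ell2_eqI, simp)
    qed
    then have "Re (\<mu> \<epsilon>) = 0" by (simp add: complex_eq_iff)
    then show ?thesis by (simp add: lam_def)
  qed
  have wsum: "(\<lambda>m. k * (1 / wt m)) summable_on S" for k S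
    by (rule summable_on_subset[OF summable_on_cmult_right[OF summable_wt]]) simp
  have main: "kg_eigen_branch p \<Omega> A \<Lambda> bp bm e0 C0 lam B"
    unfolding kg_eigen_branch_def
  proof (intro conjI ballI)
    show "analytic_scalar lam {0<..<e0}"
    proof (rule analytic_scalar_I)
      fix s assume "s \<in> {0<..<e0}"
      then obtain \<rho> Z V where \<rho>: "\<rho> > 0" and Z: "hol_family Z (of_real s) \<rho>"
        and eq: "\<And>t. t \<in> {0<..<e0} \<Longrightarrow> \<bar>t - s\<bar> < \<rho> \<Longrightarrow> Y t = Z (of_real t)" using local_hol by blast
      have "(\<lambda>z. z * (\<Lambda> + coord (Z z) i0)) holomorphic_on ball (of_real s) \<rho>"
        by (intro holomorphic_intros hol_familyD[OF Z])
      then show "\<exists>\<rho>>0. \<exists>g. g holomorphic_on ball (of_real s) \<rho> \<and> (\<forall>t\<in>{0<..<e0}. \<bar>t - s\<bar> < \<rho> \<longrightarrow> lam t = g (of_real t))"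
        using \<rho> eq by (intro exI[of _ \<rho>] conjI exI[of _ "\<lambda>z. z * (\<Lambda> + coord (Z z) i0)"]) (auto simp: lam_def \<mu>_def)
    qed
    show "analytic_l22 B {0<..<e0}"
      by (rule analytic_l22_I) (use local_hol in blast)
    fix \<epsilon> assume \<epsilon>: "\<epsilon> \<in> {0<..<e0}"
    show "kg_spectral p \<Omega> \<epsilon> (A \<epsilon>) (lam \<epsilon>) (B \<epsilon>)" by (rule spec[OF \<epsilon>])
    show "Re (lam \<epsilon>) = 0" by (rule imag[OF \<epsilon>])
    have e: "0 < \<epsilon>" by (rule small(6)[OF \<epsilon>])
    have "lam \<epsilon> - of_real \<epsilon> * \<Lambda> = of_real \<epsilon> * (\<mu> \<epsilon> - \<Lambda>)" by (simp add: lam_def algebra_simps)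
    then have "cmod (lam \<epsilon> - of_real \<epsilon> * \<Lambda>) = \<epsilon> * cmod (\<mu> \<epsilon> - \<Lambda>)" using e by (simp add: norm_mult)
    also have "\<dots> \<le> \<epsilon> * (C0 * \<epsilon>)"
      using e \<mu>C[OF \<epsilon>] C0(2) by (intro mult_left_mono order_trans[OF \<mu>C[OF \<epsilon>]] mult_right_mono) auto
    finally show "cmod (lam \<epsilon> - of_real \<epsilon> * \<Lambda>) \<le> C0 * \<epsilon>\<^sup>2" by (simp add: power2_eq_square mult_ac)
    have "(\<lambda>n. B \<epsilon> 1 n - bp n - \<i> * bm n) = (\<lambda>n. coord (X \<epsilon> - B0) (1, n))"
      "(\<lambda>n. B \<epsilon> (-1) n - bp n + \<i> * bm n) = (\<lambda>n. coord (X \<epsilon> - B0) (-1, n))"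
      by (auto simp: B_def coord_B0)
    then have "l2_norm (\<lambda>n. B \<epsilon> 1 n - bp n - \<i> * bm n) + l2_norm (\<lambda>n. B \<epsilon> (-1) n - bp n + \<i> * bm n) \<le> 2 * (Cs * \<epsilon>)"
      using row_norm_le[of "X \<epsilon> - B0" 1] row_norm_le[of "X \<epsilon> - B0" "-1"] XC[OF \<epsilon>] by simp
    also have "\<dots> \<le> C0 * \<epsilon>" using mult_right_mono[OF C0(3), of \<epsilon>] e by simp
    finally show "l2_norm (\<lambda>n. B \<epsilon> 1 n - bp n - \<i> * bm n) + l2_norm (\<lambda>n. B \<epsilon> (-1) n - bp n + \<i> * bm n) \<le> C0 * \<epsilon>" .
    have "(\<Sum>\<^sub>\<infinity>m\<in>{m. \<bar>m\<bar> \<ge> 2}. l2_norm (B \<epsilon> m)) \<le> (\<Sum>\<^sub>\<infinity>m. Ct * \<epsilon> * (1 / wt m))"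
    proof (rule infsum_mono_neutral)
      show "(\<lambda>m. l2_norm (B \<epsilon> m)) summable_on {m. 2 \<le> \<bar>m\<bar>}"
        by (rule summable_on_comparison_test[OF wsum[of "Ct * \<epsilon>"]]) (rule decay[OF \<epsilon>], auto)
      show "l2_norm (B \<epsilon> m) \<le> Ct * \<epsilon> * (1 / wt m)" if "m \<in> {m. 2 \<le> \<bar>m\<bar>} \<inter> UNIV" for m
        using that by (intro decay[OF \<epsilon>]) auto
    qed (use wsum Ct e in auto)
    also have "\<dots> = Ct * \<epsilon> * W" unfolding W_def by (rule infsum_cmult_right')
    finally have "l2_norm (B \<epsilon> 0) + (\<Sum>\<^sub>\<infinity>m\<in>{m. \<bar>m\<bar> \<ge> 2}. l2_norm (B \<epsilon> m)) \<le> Ct * \<epsilon> + Ct * \<epsilon> * W"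
      using decay[OF \<epsilon>, of 0] by (simp add: wt_def)
    also have "\<dots> = (Ct + Ct * W) * \<epsilon>" by (simp add: algebra_simps)
    also have "\<dots> \<le> C0 * \<epsilon>" using e C0(4) by (intro mult_right_mono) auto
    finally show "l2_norm (B \<epsilon> 0) + (\<Sum>\<^sub>\<infinity>m\<in>{m. \<bar>m\<bar> \<ge> 2}. l2_norm (B \<epsilon> m)) \<le> C0 * \<epsilon>" .
  qed
  have unique: "lam' \<epsilon> = lam \<epsilon> \<and> (\<exists>c. c \<noteq> 0 \<and> (\<forall>m n. B' \<epsilon> m n = c * B \<epsilon> m n))"
    if e1: "0 < e1" "e1 \<le> e0" and br: "kg_eigen_branch p \<Omega> A \<Lambda> bp bm e1 C0 lam' B'" and \<epsilon>1: "\<epsilon> \<in> {0<..<e1}" for e1 lam' B' \<epsilon>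
  proof -
    have \<epsilon>: "\<epsilon> \<in> {0<..<e0}" using \<epsilon>1 e1 by auto
    note sm = small[OF \<epsilon>]
    have e: "0 < \<epsilon>" by (rule sm(6))
    have ks: "kg_spectral p \<Omega> \<epsilon> (A \<epsilon>) (lam' \<epsilon>) (B' \<epsilon>)" and l': "cmod (lam' \<epsilon> - of_real \<epsilon> * \<Lambda>) \<le> C0 * \<epsilon>\<^sup>2"
      and b1: "l2_norm (\<lambda>n. B' \<epsilon> 1 n - bp n - \<i> * bm n) + l2_norm (\<lambda>n. B' \<epsilon> (-1) n - bp n + \<i> * bm n) \<le> C0 * \<epsilon>"
      and b2: "l2_norm (B' \<epsilon> 0) + (\<Sum>\<^sub>\<infinity>m\<in>{m. \<bar>m\<bar> \<ge> 2}. l2_norm (B' \<epsilon> m)) \<le> C0 * \<epsilon>"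
      using br \<epsilon>1 unfolding kg_eigen_branch_def by blast+
    note ks' = ks[unfolded kg_spectral_iff[OF breather(1)[OF sm(1)]]]
    have Bl: "B' \<epsilon> \<in> l22" using ks' by blast
    define x where "x = ell2_of (B' \<epsilon>)"
    have xc: "coord x (m, n) = B' \<epsilon> m n" for m n unfolding x_def by (rule coord_ell2_of[OF Bl])
    define \<mu>' where "\<mu>' = lam' \<epsilon> / of_real \<epsilon>"
    have l\<mu>: "lam' \<epsilon> = of_real \<epsilon> * \<mu>'" using e by (simp add: \<mu>'_def)
    have "\<epsilon> * cmod (\<mu>' - \<Lambda>) = cmod (lam' \<epsilon> - of_real \<epsilon> * \<Lambda>)"
      unfolding l\<mu> right_diff_distrib[symmetric] norm_mult using e by simp
    also have "\<dots> \<le> \<epsilon> * (C0 * \<epsilon>)" using l' by (simp add: power2_eq_square mult_ac)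
    finally have \<mu>'C: "cmod (\<mu>' - \<Lambda>) \<le> C0 * \<epsilon>" using e by simp
    have C0r: "C0 * \<epsilon> \<le> r"
      using sm(3) mult_nonneg_nonneg[OF C2 less_imp_le[OF e]] unfolding distrib_right by linarith
    have \<mu>'1: "cmod (\<mu>' - \<Lambda>) \<le> 1" using \<mu>'C C0r r by linarith
    have Hx: "?H \<epsilon> \<mu>' x = 0"
      using kg_op_zero_iff[OF near[OF \<epsilon>] near_s(1)[OF \<epsilon>] \<mu>'1 _ sm(7), of x] ks' e by (simp add: l\<mu> xc x_def[symmetric])
    let ?d = "\<lambda>m. l2_norm (\<lambda>n. coord (x - B0) (m, n))"
    obtain x' where x': "B' \<epsilon> = unweight x'" using l22_imp_unweight[OF Bl] by blast
    have dle: "?d m \<le> norm x' * (1 / wt m)" if "m \<notin> {1, -1}" for m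
    proof -
      have "(\<lambda>n. coord (x - B0) (m, n)) = unweight x' m" using that by (auto simp: xc coord_B0 x')
      then show ?thesis using l2_norm_unweight_le[of x' m] by simp
    qed
    \<comment> \<open>Taken from membership in \<open>l22\<close>, since a bound on
      \<open>infsum\<close> does not imply summability.\<close>
    have ds: "?d summable_on UNIV"
    proof -
      have "?d summable_on (UNIV - {1, -1})"
        by (rule summable_on_comparison_test[OF wsum[of "norm x'"]]) (rule dle, auto)
      then have "?d summable_on ((UNIV - {1, -1}) \<union> {1, -1})" by (rule summable_on_union) simp
      moreover have "(UNIV - {1, -1}) \<union> {1, -1} = (UNIV :: int set)" by auto
      ultimately show ?thesis by (simp only:)
    qed
    have "norm (x - B0) \<le> infsum ?d UNIV" by (rule norm_le_row_sum[OF ds])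
    also have "(UNIV :: int set) = {1, -1, 0} \<union> {m. \<bar>m\<bar> \<ge> 2}" by auto
    also have "infsum ?d \<dots> = infsum ?d {1, -1, 0} + infsum ?d {m. \<bar>m\<bar> \<ge> 2}"
      by (rule infsum_Un_disjoint[OF summable_on_subset[OF ds] summable_on_subset[OF ds]]) auto
    also have "infsum ?d {1, -1, 0} = ?d 1 + ?d (-1) + ?d 0" by simp
    also have "infsum ?d {m. \<bar>m\<bar> \<ge> 2} = (\<Sum>\<^sub>\<infinity>m\<in>{m. \<bar>m\<bar> \<ge> 2}. l2_norm (B' \<epsilon> m))"
    proof (rule infsum_cong)
      fix m :: int assume "m \<in> {m. \<bar>m\<bar> \<ge> 2}"
      then have "m \<noteq> 1" "m \<noteq> -1" by auto
      then show "?d m = l2_norm (B' \<epsilon> m)" by (simp add: xc coord_B0)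
    qed
    also have "?d 1 + ?d (-1) + ?d 0 + (\<Sum>\<^sub>\<infinity>m\<in>{m. \<bar>m\<bar> \<ge> 2}. l2_norm (B' \<epsilon> m)) \<le> 2 * (C0 * \<epsilon>)"
      using b1 b2 by (simp add: xc coord_B0 algebra_simps)
    finally have xB: "norm (x - B0) \<le> 2 * (C0 * \<epsilon>)" .
    define q where "q = coord x i0"
    have qb: "cmod (q - coord B0 i0) \<le> 2 * (C0 * \<epsilon>)"
      using norm_coord_le[of "x - B0" i0] xB by (simp add: q_def)
    have "\<beta> \<le> cmod q + cmod (q - coord B0 i0)"
      unfolding \<beta>_def using norm_triangle_ineq4[of q "q - coord B0 i0"] by simp
    then have qlow: "\<beta> / 2 \<le> cmod q" using qb sm(4) by linarith
    then have q0: "q \<noteq> 0" using \<beta> by auto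
    \<comment> \<open>A competing eigenvector need not be normalised at \<open>i0\<close>. Rescaling
      by \<open>c\<close> achieves this and moves it only by order \<epsilon>, because |q| \<ge>
      \<beta> / 2.\<close>
    define c where "c = coord B0 i0 / q"
    have c0: "c \<noteq> 0" using i0 q0 by (simp add: c_def)
    have cq: "cmod (c - 1) \<le> 4 * (C0 * \<epsilon>) / \<beta>"
    proof -
      have "c - 1 = (coord B0 i0 - q) / q" using q0 by (simp add: c_def diff_divide_distrib)
      then have "cmod (c - 1) = cmod (q - coord B0 i0) / cmod q" by (simp add: norm_divide norm_minus_commute)
      also have "\<dots> \<le> 2 * (C0 * \<epsilon>) / (\<beta> / 2)" using qb qlow \<beta> C0 e by (intro frac_le) auto
      finally show ?thesis by simp
    qed
    have "4 * (C0 * \<epsilon>) / \<beta> \<le> 1" using sm(4) \<beta> by simp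
    then have c2: "cmod c \<le> 2" using cq norm_triangle_ineq[of "c - 1" 1] by simp
    have "c *c x - B0 = c *c (x - B0) + (c - 1) *c B0" by (rule ell2_eqI) (simp add: algebra_simps)
    then have "norm (c *c x - B0) \<le> cmod c * norm (x - B0) + cmod (c - 1) * b"
      using norm_triangle_ineq[of "c *c (x - B0)" "(c - 1) *c B0"] by (simp add: b_def)
    also have "\<dots> \<le> 2 * (2 * (C0 * \<epsilon>)) + 4 * (C0 * \<epsilon>) / \<beta> * b"
      using c2 xB cq b order_trans[OF norm_ge_zero cq] by (intro add_mono mult_mono) auto
    also have "\<dots> = C2 * \<epsilon>" by (simp add: C2_def algebra_simps)
    finally have cx: "norm (c *c x - B0) \<le> C2 * \<epsilon>" .
    have "\<mu>' = \<mu> \<epsilon> \<and> c *c x = X \<epsilon>"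
    proof (rule uniq[OF \<epsilon>])
      show "norm (c *c x - B0) + cmod (\<mu>' - \<Lambda>) \<le> r" using cx \<mu>'C sm(3) by (simp add: distrib_right)
      show "coord (c *c x) i0 = coord B0 i0" using q0 by (simp add: c_def q_def)
      have "bclin (?H \<epsilon> \<mu>')" by (rule bclin_kg_op[OF near[OF \<epsilon>] near_s(1)[OF \<epsilon>] \<mu>'1])
      from bclin_cscale[OF this] show "?H \<epsilon> \<mu>' (c *c x) = 0"
        by (simp only: Hx) (rule ell2_eqI, simp)
    qed
    then have "\<mu>' = \<mu> \<epsilon>" and cX: "c *c x = X \<epsilon>" by auto
    then have "lam' \<epsilon> = lam \<epsilon>" by (simp add: l\<mu> lam_def)
    moreover have "B' \<epsilon> m n = inverse c * B \<epsilon> m n" for m n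
      unfolding B_def cX[symmetric] using c0 by (simp add: xc)
    ultimately show ?thesis using c0 by (intro conjI exI[of _ "inverse c"]) auto
  qed
  show ?thesis
    using e0 C0(1) main unique
    by (intro exI[of _ e0] exI[of _ C0] conjI exI[of _ lam] exI[of _ B] allI impI ballI) auto
qed

end

theorem theorem3:
  fixes p :: nat
    and \<Omega> \<delta> :: real
    and \<A> :: "int ^ 'd \<Rightarrow> real"
    and A :: "real \<Rightarrow> int \<Rightarrow> int ^ 'd \<Rightarrow> complex"
    and \<Lambda> :: complex
    and bp bm :: "int ^ 'd \<Rightarrow> complex"
  assumes "p \<ge> 1"
    and "\<Omega> \<notin> {- 4 * real CARD('d)..0}"
    and "stationary_dnls p \<Omega> \<A>"
    and "\<forall>v\<in>l2. J_op p \<Omega> \<A> v = (\<lambda>n. 0) \<longrightarrow> v = (\<lambda>n. 0)"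
    and "\<delta> > 0"
    and "breather_branch p \<Omega> \<A> \<delta> A"
    and "Re \<Lambda> = 0" and "\<Lambda> \<noteq> 0"
    and "eigenpair (dnls_op p \<Omega> \<A>) (2 * \<Lambda>) (bp, bm)"
    and "simple_eigenvalue (dnls_op p \<Omega> \<A>) (2 * \<Lambda>)"
    and "(2 * \<Lambda>) isolated_in pair_spectrum (dnls_op p \<Omega> \<A>)"
    and "2 * \<Lambda> \<notin> continuous_spectrum_dnls CARD('d) \<Omega>"
  shows "\<exists>\<epsilon>\<^sub>0 C\<^sub>0. 0 < \<epsilon>\<^sub>0 \<and> \<epsilon>\<^sub>0 \<le> \<delta> \<and> 0 < C\<^sub>0 \<and>
    (\<exists>lam B. kg_eigen_branch p \<Omega> A \<Lambda> bp bm \<epsilon>\<^sub>0 C\<^sub>0 lam B \<and>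
      (\<forall>\<epsilon>\<^sub>1 lam' B'. 0 < \<epsilon>\<^sub>1 \<and> \<epsilon>\<^sub>1 \<le> \<epsilon>\<^sub>0 \<and>
         kg_eigen_branch p \<Omega> A \<Lambda> bp bm \<epsilon>\<^sub>1 C\<^sub>0 lam' B' \<longrightarrow>
         (\<forall>\<epsilon>\<in>{0<..<\<epsilon>\<^sub>1}. lam' \<epsilon> = lam \<epsilon> \<and>
            (\<exists>c. c \<noteq> 0 \<and> (\<forall>m n. B' \<epsilon> m n = c * B \<epsilon> m n)))))"
proof -
  interpret breather_eigenvalue p \<Omega> \<A> \<Lambda> bp bm A \<delta>
    by unfold_locales (use assms in \<open>auto simp: stationary_dnls_def\<close>)
  show ?thesis by (rule eigenvalue_branch)
qed

end
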